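(* For every odd integer $\ell\ge1$ there exists $\phi\in\mathrm{Hom}^+(\mathcal A[T_{(\ell+2)\text{-Hypergraph}}],\mathbb R)$ satisfying $\mathrm{UInduce}[\ell]$ but not satisfying $\mathrm{UCouple}[1]$.
   Context: All languages are finite relational; predicates $P$ have arity $k(P)\ge1$. A canonical theory over $\mathcal L$ is a universal theory containing, for each $P\in\mathcal L$, the axiom that $P(x_1,\dots,x_{k(P)})$ fails whenever two $x_i$ coincide. $T_{k\text{-Hypergraph}}$: single $k$-ary predicate $E$ with the symmetry axioms $E(x_1,\dots,x_k)\to E(x_{\sigma(1)},\dots,x_{\sigma(k)})$, $\sigma\in S_k$. $T\cup T'$ is the disjoint union; $\mathcal M[T]$: isomorphism classes of finite models. $\mathrm{Hom}^+(\mathcal A[T],\mathbb R)$: functions $\phi:\mathcal M[T]\to[0,1]$, $\phi(M)=\lim_n p(M,N_n)$ for finite models $N_n$ of $T$ of strictly increasing size ($p(M,N)$ = probability a random $|M|$-subset of $V(N)$ induces a copy of $M$). $\phi(\langle K\rangle)=\frac{|\mathrm{Aut}(K)|}{|K|!}\phi([K])$. Theons: for an atomless complete probability space $\Omega=(X,\mathcal A,\mu)$, $\mathcal E_V(\Omega)=X^{r(V)}$ with $r(V)$ the finite nonempty subsets of $V$, $\alpha^*(x)_A=x_{\alpha(A)}$. A $T$-on is a family of measurable $\mathcal N_P\subseteq\mathcal E_{[k(P)]}(\Omega)$ such that for random $\theta\in\mathcal E_{\mathbb N_+}(\Omega)$ the structure on $\mathbb N_+$ with $R_P=\{\alpha\text{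 injective}:\alpha^*(\theta)\in\mathcal N_P\}$ is a.s. a model of $T$; $\phi_{\mathcal N}(M)$ is the probability that its restriction to $[|M|]$ is isomorphic to $M$; every $\phi$ is of this form. A peon $\mathcal N_P\subseteq\mathcal E_{[k]}(\Omega)$ has rank $\le r$ if $\mathcal N_P=\mathcal H\times X^{\{A\subseteq[k]:|A|>r\}}$; $\mathrm{rk}(\phi)$ is the minimal max-peon-rank of a representing $T$-on. Coupling of $\phi$ (theory $T$) and $\psi$ (theory $T'$): $\xi$ on $T\cup T'$ whose reducts are $\phi,\psi$; independent coupling $(\phi\otimes\psi)(\langle M\rangle)=\phi(\langle M|_T\rangle)\psi(\langle M|_{T'}\rangle)$; uniquely coupleable if this is the only coupling. $\mathrm{UCouple}[1]$: uniquely coupleable with every limit object of rank $\le1$ of every canonical theory. For $\ell\ge1$, $\phi$ satisfies $\mathrm{UInduce}[\ell]$ if for every $\psi$ of $T_{\ell\text{-Hypergraph}}$, every coupling $\xi$ of $\phi$ and $\psi$ and every $M\in\mathcal M[T\cup T_{\ell\text{-Hypergraph}}]$ whose hypergraph reduct is a complete $\ell$-uniform hypergraph, $\xi(M)=(\phi\otimes\psi)(M)$. *)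

theory Defs
  imports "HOL-Probability.Probability" "HOL-Combinatorics.Permutations"
begin

section \<open>Universal theories and their models\<close>

datatype 'p fm =
    Bot
  | Eq nat nat
  | Rel 'p "nat list"
  | Neg "'p fm"
  | Conj "'p fm" "'p fm"
  | Disj "'p fm" "'p fm"
  | Imp "'p fm" "'p fm"

record 'p rtheory =
  preds :: "'p set"
  arity :: "'p \<Rightarrow> nat"
  axs :: "'p fm set"

record ('p, 'v) rstruct =
  verts :: "'v set"
  rels :: "'p \<Rightarrow> 'v list set"

primrec sat :: "('p, 'v) rstruct \<Rightarrow> (nat \<Rightarrow> 'v) \<Rightarrow> 'p fm \<Rightarrow> bool" where
  "sat M v Bot \<longleftrightarrow> False"
| "sat M v (Eq i j) \<longleftrightarrow> v i = v j"
| "sat M v (Rel P is) \<longleftrightarrow> map v is \<in> rels M P"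
| "sat M v (Neg F) \<longleftrightarrow> \<not> sat M v F"
| "sat M v (Conj F G) \<longleftrightarrow> sat M v F \<and> sat M v G"
| "sat M v (Disj F G) \<longleftrightarrow> sat M v F \<or> sat M v G"
| "sat M v (Imp F G) \<longleftrightarrow> (sat M v F \<longrightarrow> sat M v G)"

primrec over_language :: "'p set \<Rightarrow> ('p \<Rightarrow> nat) \<Rightarrow> 'p fm \<Rightarrow> bool" where
  "over_language L ar Bot \<longleftrightarrow> True"
| "over_language L ar (Eq i j) \<longleftrightarrow> True"
| "over_language L ar (Rel P is) \<longleftrightarrow> P \<in> L \<and> length is = ar P"
| "over_language L ar (Neg F) \<longleftrightarrow> over_language L ar F"
| "over_language L ar (Conj F G) \<longleftrightarrow> over_language L ar F \<and> over_language L ar G"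
| "over_language L ar (Disj F G) \<longleftrightarrow> over_language L ar F \<and> over_language L ar G"
| "over_language L ar (Imp F G) \<longleftrightarrow> over_language L ar F \<and> over_language L ar G"

text \<open>Relations are empty outside the language, so that isomorphism of structures
  need not mention the language.\<close>

definition is_struct :: "'p rtheory \<Rightarrow> ('p, 'v) rstruct \<Rightarrow> bool" where
  "is_struct T M \<longleftrightarrow>
    (\<forall>P. rels M P \<subseteq> {xs. P \<in> preds T \<and> length xs = arity T P \<and> set xs \<subseteq> verts M})"

text \<open>The quantifier-free formulas in the field \<open>axs\<close> are read as universally closed;
  this is how universal theories are represented.\<close>

definition is_model :: "'p rtheory \<Rightarrow> ('p, 'v) rstruct \<Rightarrow> bool" where
  "is_model T M \<longleftrightarrow> is_struct T M \<and>
    (\<forall>v. range v \<subseteq> verts M \<longrightarrow> (\<forall>F\<in>axs T. sat M v F))"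

definition universal_theory :: "'p rtheory \<Rightarrow> bool" where
  "universal_theory T \<longleftrightarrow> finite (preds T) \<and> (\<forall>P\<in>preds T. arity T P \<ge> 1) \<and>
    (\<forall>F\<in>axs T. over_language (preds T) (arity T) F)"

definition canonical_axiom :: "'p \<Rightarrow> nat \<Rightarrow> 'p fm" where
  "canonical_axiom P k =
    Imp (foldr Disj [Eq i j. j \<leftarrow> [0..<k], i \<leftarrow> [0..<j]] Bot) (Neg (Rel P [0..<k]))"

definition canonical_theory :: "'p rtheory \<Rightarrow> bool" where
  "canonical_theory T \<longleftrightarrow> universal_theory T \<and>
    (\<forall>P\<in>preds T. canonical_axiom P (arity T P) \<in> axs T)"

definition hypergraph_theory :: "nat \<Rightarrow> unit rtheory" where
  "hypergraph_theory k = \<lparr>preds = UNIV, arity = (\<lambda>_. k),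
    axs = {canonical_axiom () k} \<union>
      {Imp (Rel () [0..<k]) (Rel () (map \<sigma> [0..<k])) | \<sigma>. \<sigma> permutes {..<k}}\<rparr>"

definition disj_union :: "'p rtheory \<Rightarrow> 'q rtheory \<Rightarrow> ('p + 'q) rtheory" where
  "disj_union T T' = \<lparr>preds = preds T <+> preds T', arity = case_sum (arity T) (arity T'),
    axs = map_fm Inl ` axs T \<union> map_fm Inr ` axs T'\<rparr>"

definition reductL :: "('p + 'q, 'v) rstruct \<Rightarrow> ('p, 'v) rstruct" where
  "reductL M = \<lparr>verts = verts M, rels = (\<lambda>P. rels M (Inl P))\<rparr>"

definition reductR :: "('p + 'q, 'v) rstruct \<Rightarrow> ('q, 'v) rstruct" where
  "reductR M = \<lparr>verts = verts M, rels = (\<lambda>P. rels M (Inr P))\<rparr>"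

definition induced :: "('p, 'v) rstruct \<Rightarrow> 'v set \<Rightarrow> ('p, 'v) rstruct" where
  "induced M U = \<lparr>verts = U, rels = (\<lambda>P. {xs \<in> rels M P. set xs \<subseteq> U})\<rparr>"

definition is_iso :: "('v \<Rightarrow> 'w) \<Rightarrow> ('p, 'v) rstruct \<Rightarrow> ('p, 'w) rstruct \<Rightarrow> bool" where
  "is_iso f M N \<longleftrightarrow> bij_betw f (verts M) (verts N) \<and>
    (\<forall>P xs. set xs \<subseteq> verts M \<longrightarrow> (xs \<in> rels M P \<longleftrightarrow> map f xs \<in> rels N P))"

definition isomorphic :: "('p, 'v) rstruct \<Rightarrow> ('p, 'w) rstruct \<Rightarrow> bool" where
  "isomorphic M N \<longleftrightarrow> (\<exists>f. is_iso f M N)"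

definition Aut :: "('p, 'v) rstruct \<Rightarrow> ('v \<Rightarrow> 'v) set" where
  "Aut M = {f. f permutes verts M \<and> is_iso f M M}"

text \<open>Finite models are taken with vertices in \<^typ>\<open>nat\<close>, which loses no isomorphism class.\<close>

definition fin_models :: "'p rtheory \<Rightarrow> ('p, nat) rstruct set" where
  "fin_models T = {M. is_model T M \<and> finite (verts M)}"

definition iso_class :: "'p rtheory \<Rightarrow> ('p, nat) rstruct \<Rightarrow> ('p, nat) rstruct set" where
  "iso_class T M = {M' \<in> fin_models T. isomorphic M M'}"

definition iso_classes :: "'p rtheory \<Rightarrow> ('p, nat) rstruct set set" where
  "iso_classes T = iso_class T ` fin_models T"


section \<open>Limit objects and couplings\<close>

type_synonym 'p limit = "('p, nat) rstruct set \<Rightarrow> real"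

definition density :: "('p, 'v) rstruct \<Rightarrow> ('p, 'w) rstruct \<Rightarrow> real" where
  "density M N =
    real (card {U. U \<subseteq> verts N \<and> card U = card (verts M) \<and> isomorphic (induced N U) M})
      / real (card (verts N) choose card (verts M))"

text \<open>The set \<open>Hom\<^sup>+(A[T], R)\<close>.\<close>

definition limit_objects :: "'p rtheory \<Rightarrow> 'p limit set" where
  "limit_objects T = {\<phi> \<in> iso_classes T \<rightarrow>\<^sub>E {0..1}.
    \<exists>N :: nat \<Rightarrow> ('p, nat) rstruct.
      (\<forall>n. N n \<in> fin_models T) \<and> strict_mono (\<lambda>n. card (verts (N n))) \<and>
      (\<forall>M\<in>fin_models T. (\<lambda>n. density M (N n)) \<longlonglongrightarrow> \<phi> (iso_class T M))}"

text \<open>The value of \<open>\<phi>\<close> at the labelled model \<open>\<langle>K\<rangle>\<close>.\<close>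

definition labelled :: "'p rtheory \<Rightarrow> 'p limit \<Rightarrow> ('p, nat) rstruct \<Rightarrow> real" where
  "labelled T \<phi> K = real (card (Aut K)) / fact (card (verts K)) * \<phi> (iso_class T K)"

definition limit_reductL :: "'p rtheory \<Rightarrow> 'q rtheory \<Rightarrow> ('p + 'q) limit \<Rightarrow> 'p limit" where
  "limit_reductL T T' \<xi> = (\<lambda>C\<in>iso_classes T.
    \<Sum>D | D \<in> iso_classes (disj_union T T') \<and> (\<exists>M\<in>D. reductL M \<in> C). \<xi> D)"

definition limit_reductR :: "'p rtheory \<Rightarrow> 'q rtheory \<Rightarrow> ('p + 'q) limit \<Rightarrow> 'q limit" where
  "limit_reductR T T' \<xi> = (\<lambda>C\<in>iso_classes T'.
    \<Sum>D | D \<in> iso_classes (disj_union T T') \<and> (\<exists>M\<in>D. reductR M \<in> C). \<xi> D)"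

definition couplings ::
    "'p rtheory \<Rightarrow> 'p limit \<Rightarrow> 'q rtheory \<Rightarrow> 'q limit \<Rightarrow> ('p + 'q) limit set" where
  "couplings T \<phi> T' \<psi> = {\<xi> \<in> limit_objects (disj_union T T').
    limit_reductL T T' \<xi> = \<phi> \<and> limit_reductR T T' \<xi> = \<psi>}"

text \<open>The equation
  \<open>labelled (disj_union T T') (\<phi> \<otimes> \<psi>) M = labelled T \<phi> (reductL M) * labelled T' \<psi> (reductR M)\<close>,
  solved for the value at the class of \<open>M\<close>; it does not depend on the representative \<open>M\<close>.\<close>

definition indep_coupling ::
    "'p rtheory \<Rightarrow> 'p limit \<Rightarrow> 'q rtheory \<Rightarrow> 'q limit \<Rightarrow> ('p + 'q) limit" where
  "indep_coupling T \<phi> T' \<psi> = (\<lambda>C\<in>iso_classes (disj_union T T').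
    let M = (SOME M. M \<in> C) in
      fact (card (verts M)) / real (card (Aut M)) *
        (labelled T \<phi> (reductL M) * labelled T' \<psi> (reductR M)))"

definition uniquely_coupleable ::
    "'p rtheory \<Rightarrow> 'p limit \<Rightarrow> 'q rtheory \<Rightarrow> 'q limit \<Rightarrow> bool" where
  "uniquely_coupleable T \<phi> T' \<psi> \<longleftrightarrow>
    (\<forall>\<xi>\<in>couplings T \<phi> T' \<psi>. \<xi> = indep_coupling T \<phi> T' \<psi>)"


section \<open>Theons and rank\<close>

definition atomless :: "'x measure \<Rightarrow> bool" where
  "atomless \<Omega> \<longleftrightarrow> (\<forall>A\<in>sets \<Omega>. emeasure \<Omega> A > 0 \<longrightarrow>
    (\<exists>B\<in>sets \<Omega>. B \<subseteq> A \<and> 0 < emeasure \<Omega> B \<and> emeasure \<Omega> B < emeasure \<Omega> A))"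

definition fin_subsets :: "'v set \<Rightarrow> 'v set set" where
  "fin_subsets V = {A. A \<subseteq> V \<and> finite A \<and> A \<noteq> {}}"

text \<open>Measurability and almost sure statements refer to the completed product measure.
  Vertices are numbered from 0: \<open>[k]\<close> is \<open>{..<k}\<close>, and the countable vertex set is
  \<open>UNIV :: nat set\<close>.\<close>

definition exch_space :: "'v set \<Rightarrow> 'x measure \<Rightarrow> ('v set \<Rightarrow> 'x) measure" where
  "exch_space V \<Omega> = completion (Pi\<^sub>M (fin_subsets V) (\<lambda>_. \<Omega>))"

definition pullback :: "'u set \<Rightarrow> ('u \<Rightarrow> 'v) \<Rightarrow> ('v set \<Rightarrow> 'x) \<Rightarrow> 'u set \<Rightarrow> 'x" where
  "pullback U \<alpha> x = (\<lambda>A\<in>fin_subsets U. x (\<alpha> ` A))"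

definition sampled_struct ::
    "'p rtheory \<Rightarrow> ('p \<Rightarrow> (nat set \<Rightarrow> 'x) set) \<Rightarrow> (nat set \<Rightarrow> 'x) \<Rightarrow> ('p, nat) rstruct" where
  "sampled_struct T \<N> \<theta> = \<lparr>verts = UNIV, rels = (\<lambda>P. {xs. P \<in> preds T \<and>
    length xs = arity T P \<and> distinct xs \<and> pullback {..<arity T P} (\<lambda>i. xs ! i) \<theta> \<in> \<N> P})\<rparr>"

definition is_theon :: "'p rtheory \<Rightarrow> 'x measure \<Rightarrow> ('p \<Rightarrow> (nat set \<Rightarrow> 'x) set) \<Rightarrow> bool" where
  "is_theon T \<Omega> \<N> \<longleftrightarrow> prob_space \<Omega> \<and> complete_measure \<Omega> \<and> atomless \<Omega> \<and>
    (\<forall>P\<in>preds T. \<N> P \<in> sets (exch_space {..<arity T P} \<Omega>)) \<and>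
    (AE \<theta> in exch_space UNIV \<Omega>. is_model T (sampled_struct T \<N> \<theta>))"

definition theon_limit :: "'p rtheory \<Rightarrow> 'x measure \<Rightarrow> ('p \<Rightarrow> (nat set \<Rightarrow> 'x) set) \<Rightarrow> 'p limit" where
  "theon_limit T \<Omega> \<N> = (\<lambda>C\<in>iso_classes T.
    measure (exch_space UNIV \<Omega>) {\<theta> \<in> space (exch_space UNIV \<Omega>).
      \<exists>M\<in>C. isomorphic (induced (sampled_struct T \<N> \<theta>) {..<card (verts M)}) M})"

definition peon_rank_le :: "'x measure \<Rightarrow> nat \<Rightarrow> nat \<Rightarrow> (nat set \<Rightarrow> 'x) set \<Rightarrow> bool" where
  "peon_rank_le \<Omega> k r \<P> \<longleftrightarrow>
    (\<exists>\<H> \<subseteq> {A \<in> fin_subsets {..<k}. card A \<le> r} \<rightarrow>\<^sub>E space \<Omega>.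
      \<P> = {x \<in> space (exch_space {..<k} \<Omega>).
            restrict x {A \<in> fin_subsets {..<k}. card A \<le> r} \<in> \<H>})"

text \<open>A theon has maximal peon rank at most \<open>r\<close> iff all its peons have rank at most \<open>r\<close>.
  The underlying space ranges over all atomless complete probability measures carried by a
  subset of the reals; these include Lebesgue measure on the unit interval, over which every
  limit object is represented with the least possible rank.\<close>

definition limit_rank :: "'p rtheory \<Rightarrow> 'p limit \<Rightarrow> nat" where
  "limit_rank T \<phi> = (LEAST r. \<exists>(\<Omega> :: real measure) \<N>. is_theon T \<Omega> \<N> \<and>
    theon_limit T \<Omega> \<N> = \<phi> \<and> (\<forall>P\<in>preds T. peon_rank_le \<Omega> (arity T P) r (\<N> P)))"


section \<open>The properties UCouple and UInduce\<close>

text \<open>Languages are finite, so up to renaming their predicate symbols are natural numbers.\<close>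

definition UCouple :: "nat \<Rightarrow> 'p rtheory \<Rightarrow> 'p limit \<Rightarrow> bool" where
  "UCouple l T \<phi> \<longleftrightarrow>
    (\<forall>(T' :: nat rtheory) \<psi>. canonical_theory T' \<longrightarrow> \<psi> \<in> limit_objects T' \<longrightarrow>
      limit_rank T' \<psi> \<le> l \<longrightarrow> uniquely_coupleable T \<phi> T' \<psi>)"

definition complete_hypergraph :: "nat \<Rightarrow> (unit, 'v) rstruct \<Rightarrow> bool" where
  "complete_hypergraph l H \<longleftrightarrow>
    rels H () = {xs. length xs = l \<and> distinct xs \<and> set xs \<subseteq> verts H}"

definition UInduce :: "nat \<Rightarrow> 'p rtheory \<Rightarrow> 'p limit \<Rightarrow> bool" where
  "UInduce l T \<phi> \<longleftrightarrow>
    (\<forall>\<psi>\<in>limit_objects (hypergraph_theory l). \<forall>\<xi>\<in>couplings T \<phi> (hypergraph_theory l) \<psi>.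
      \<forall>M\<in>fin_models (disj_union T (hypergraph_theory l)). complete_hypergraph l (reductR M) \<longrightarrow>
        \<xi> (iso_class (disj_union T (hypergraph_theory l)) M) =
        indep_coupling T \<phi> (hypergraph_theory l) \<psi>
          (iso_class (disj_union T (hypergraph_theory l)) M))"

end

theory Submission
  imports Defs
begin

text \<open>Put \<open>d = l + 1\<close>, and on an initial segment of the naturals let a \<open>(d + 1)\<close>-set be an edge iff
  removing its maximum leaves a member of a pseudorandom system \<open>g\<close> of \<open>d\<close>-sets. The limit \<open>\<phi>\<close> of these
  hypergraphs remembers the order. A colouring by the first and second half is correlated with it,
  since a set of \<open>d\<close> points of the first half forms an edge with all of the second half or with none:
  \<open>UCouple[1]\<close> fails.

  An \<open>l\<close>-uniform hypergraph \<open>H\<close> cannot see \<open>g\<close>. Expand the indicator of ``the points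
  \<open>w\<^sub>1 < \<dots> < w\<^sub>m\<close> induce \<open>M\<close>'' in products of signs of \<open>g\<close>. Every other factor, whether a sign, an edge
  of \<open>H\<close> or a comparison, misses a coordinate of a given sign, so Cauchy--Schwarz bounds each
  nonconstant product by the box norm of \<open>g\<close>. What remains is a constant times the probability that
  \<open>H\<close> is complete on the points, an event that does not depend on their order.

  A coupling may use another sequence of hypergraphs converging to \<open>\<phi>\<close>. But random subsets of
  bounded size are distributed in the limit as those of the sequence above, and on each of them the
  bound above holds uniformly in \<open>H\<close>. So \<open>g\<close> is chosen with small box norm on most subsets of size
  \<open>4 ^ j\<close>, for all \<open>j\<close> at once.\<close>

section \<open>Averages over coordinates and the Gowers--Cauchy--Schwarz inequality\<close>

text \<open>Convergence to a limit object controls only statistics of subsets of bounded size,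
  whereas the hypergraph in a coupling lives on all points and is otherwise unrestricted. Hence the
  worst \<open>H\<close> is taken on each small subset separately: an \<open>H\<close> on all points
  has a trace on every subset and cannot do better there. The price is that \<open>g\<close> must be
  pseudorandom on typical subsets of every fixed size, with bounds independent of the total number
  \<open>4 ^ J\<close> of points.

  For a uniformly random \<open>g\<close> the expected box over \<open>n\<close> points is at most
  \<open>d * d / n\<close>. With \<open>n = 4 ^ j\<close> and weights \<open>2 ^ j\<close> these
  expectations form a geometric series, so a single \<open>g\<close> is good at all scales
  \<open>j \<le> J\<close>, with a loss of order \<open>2 ^ j\<close> at scale \<open>j\<close>.

  The parameters are chosen in the order: error \<epsilon>, scale \<open>j\<close>, and only then
  \<open>J\<close> tending to infinity.\<close>

definition avg :: "'v set \<Rightarrow> 'i \<Rightarrow> (('i \<Rightarrow> 'v) \<Rightarrow> real) \<Rightarrow> ('i \<Rightarrow> 'v) \<Rightarrow> real" where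
  "avg V j f w = (\<Sum>t\<in>V. f (w(j := t))) / real (card V)"

fun Av :: "'v set \<Rightarrow> 'i list \<Rightarrow> (('i \<Rightarrow> 'v) \<Rightarrow> real) \<Rightarrow> ('i \<Rightarrow> 'v) \<Rightarrow> real" where
  "Av V [] f = f"
| "Av V (j # js) f = avg V j (Av V js f)"

text \<open>The \<open>2 ^ length js\<close>-th power of the Gowers box norm of \<open>F\<close> in
  the coordinates \<open>js\<close>, with the other coordinates of \<open>w\<close> frozen. No root
  is taken, so the value is polynomial in \<open>F\<close> and can be averaged over a random
  \<open>F\<close>.\<close>

fun Box :: "'v set \<Rightarrow> 'i list \<Rightarrow> (('i \<Rightarrow> 'v) \<Rightarrow> real) \<Rightarrow> ('i \<Rightarrow> 'v) \<Rightarrow> real" where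
  "Box V [] F w = F w"
| "Box V (j # js) F w =
    (\<Sum>(s, t)\<in>V \<times> V. Box V js (\<lambda>w. F (w(j := s)) * F (w(j := t))) w) / real (card V) ^ 2"

lemma avg_mono: "(\<And>w. f w \<le> g w) \<Longrightarrow> avg V j f w \<le> avg V j g w"
  unfolding avg_def by (intro divide_right_mono sum_mono) auto

lemma Av_mono: "(\<And>w. f w \<le> g w) \<Longrightarrow> Av V js f w \<le> Av V js g w"
  by (induction js arbitrary: w) (auto intro: avg_mono)

lemma avg_const:
  assumes "finite V" "V \<noteq> {}"
  shows "avg V j (\<lambda>_. c) w = c"
  using assms by (simp add: avg_def)

lemma Av_const:
  assumes "finite V" "V \<noteq> {}"
  shows "Av V js (\<lambda>_. c) = (\<lambda>_. c)"
  by (induction js) (auto simp: avg_const[OF assms])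

lemma avg_sum: "avg V j (\<lambda>w. \<Sum>x\<in>X. f x w) w = (\<Sum>x\<in>X. avg V j (f x) w)"
  unfolding avg_def by (subst sum.swap) (simp add: sum_divide_distrib)

lemma Av_sum: "Av V js (\<lambda>w. \<Sum>x\<in>X. f x w) = (\<lambda>w. \<Sum>x\<in>X. Av V js (f x) w)"
  by (induction js) (auto simp: avg_sum)

lemma avg_cmult: "avg V j (\<lambda>w. c * f w) w = c * avg V j f w"
  unfolding avg_def by (simp add: sum_distrib_left)

lemma Av_cmult: "Av V js (\<lambda>w. c * f w) = (\<lambda>w. c * Av V js f w)"
  by (induction js) (auto simp: avg_cmult)

lemma avg_commute: "avg V i (avg V j f) = avg V j (avg V i f)"
proof (cases "i = j")
  case False
  then show ?thesis
    unfolding avg_def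
    by (intro ext) (simp only: sum_divide_distrib[symmetric] fun_upd_twist[OF False],
        subst sum.swap, rule refl)
qed simp

lemma Av_avg_commute: "Av V js (avg V j f) = avg V j (Av V js f)"
  by (induction js) (auto simp: avg_commute)

text \<open>Fubini: selected coordinates can be averaged innermost, with the remaining ones
  frozen.\<close>

lemma Av_partition: "Av V js f = Av V (filter (\<lambda>j. \<not> P j) js) (Av V (filter P js) f)"
  by (induction js) (auto simp: Av_avg_commute)

lemma Av_shift:
  "j \<notin> set js \<Longrightarrow> Av V js f (w(j := t)) = Av V js (\<lambda>w. f (w(j := t))) w"
proof (induction js arbitrary: w)
  case (Cons i js)
  then have "i \<noteq> j" "j \<notin> set js" by auto
  then show ?case
    unfolding Av.simps avg_def by (subst fun_upd_twist) (simp_all add: Cons.IH del: fun_upd_apply)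
qed simp

text \<open>The randomness of one coordinate is enough; averaging over the others preserves a
  constant bound.\<close>

lemma Av_le_const:
  assumes "finite V" "V \<noteq> {}" "j \<in> set js" "\<And>w. avg V j f w \<le> c"
  shows "Av V js f w \<le> c"
  using assms(3)
proof (induction js arbitrary: w)
  case (Cons i js)
  show ?case
  proof (cases "i = j")
    case True
    have "Av V (i # js) f w = Av V js (avg V j f) w"
      by (simp add: True Av_avg_commute)
    also have "\<dots> \<le> Av V js (\<lambda>_. c) w"
      using assms(4) by (rule Av_mono)
    finally show ?thesis by (simp add: Av_const assms)
  next
    case False
    with Cons have "avg V i (Av V js f) w \<le> avg V i (\<lambda>_. c) w"
      by (intro avg_mono) auto
    then show ?thesis by (simp add: avg_const assms)
  qed
qed simp

lemma sum_power2_le_card: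
  fixes f :: "'a \<Rightarrow> real"
  shows "(\<Sum>x\<in>X. f x)\<^sup>2 \<le> real (card X) * (\<Sum>x\<in>X. (f x)\<^sup>2)"
  using Cauchy_Schwarz_ineq_sum[of "\<lambda>_. 1" f X] by simp

lemma mean_power2_le:
  fixes f :: "'a \<Rightarrow> real"
  shows "((\<Sum>x\<in>X. f x) / real (card X))\<^sup>2 \<le> (\<Sum>x\<in>X. (f x)\<^sup>2) / real (card X)"
proof (cases "card X = 0")
  case False
  then have "real (card X) > 0" by simp
  then show ?thesis
    using sum_power2_le_card[of f X] by (simp add: power_divide field_simps power2_eq_square)
qed simp

lemma avg_power2_le: "(avg V j f w)\<^sup>2 \<le> avg V j (\<lambda>w. (f w)\<^sup>2) w"
  unfolding avg_def by (rule mean_power2_le)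

lemma Av_power2_le: "(Av V js f w)\<^sup>2 \<le> Av V js (\<lambda>w. (f w)\<^sup>2) w"
proof (induction js arbitrary: w)
  case (Cons j js)
  have "(Av V (j # js) f w)\<^sup>2 \<le> avg V j (\<lambda>w. (Av V js f w)\<^sup>2) w"
    by (simp add: avg_power2_le)
  also have "\<dots> \<le> avg V j (\<lambda>w. Av V js (\<lambda>w. (f w)\<^sup>2) w) w"
    by (intro avg_mono Cons)
  finally show ?case by simp
qed simp

text \<open>Jensen's inequality by repeated squaring. After the first squaring all terms are
  nonnegative, so \<open>f\<close> may change sign.\<close>

lemma mean_power_le:
  fixes f :: "'a \<Rightarrow> real"
  shows "((\<Sum>x\<in>X. f x) / real (card X)) ^ (2 ^ d) \<le> (\<Sum>x\<in>X. f x ^ (2 ^ d)) / real (card X)"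
proof (induction d arbitrary: f)
  case (Suc d)
  have "((\<Sum>x\<in>X. f x) / real (card X)) ^ (2 ^ Suc d) =
      (((\<Sum>x\<in>X. f x) / real (card X))\<^sup>2) ^ (2 ^ d)"
    by (simp add: power_mult[symmetric])
  also have "\<dots> \<le> ((\<Sum>x\<in>X. (f x)\<^sup>2) / real (card X)) ^ (2 ^ d)"
    by (intro power_mono mean_power2_le) auto
  also have "\<dots> \<le> (\<Sum>x\<in>X. ((f x)\<^sup>2) ^ (2 ^ d)) / real (card X)"
    by (rule Suc)
  finally show ?case by (simp add: power_mult[symmetric])
qed simp

text \<open>When the coordinate \<open>j\<close> is processed, Cauchy--Schwarz discards the factors
  with \<open>c k = j\<close>, which ignore \<open>j\<close>, and doubles \<open>j\<close> in
  everything else. After all coordinates no factor is left, and only the box of \<open>F\<close>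
  remains.\<close>

theorem Gowers_Cauchy_Schwarz:
  assumes "distinct js" "finite K"
    and "\<And>k. k \<in> K \<Longrightarrow> c k \<in> set js"
    and "\<And>k w. k \<in> K \<Longrightarrow> \<bar>u k w\<bar> \<le> 1"
    and "\<And>k w t. k \<in> K \<Longrightarrow> u k (w(c k := t)) = u k w"
  shows "Av V js (\<lambda>w. F w * (\<Prod>k\<in>K. u k w)) w ^ (2 ^ length js) \<le> Box V js F w"
  using assms
proof (induction js arbitrary: F K u w)
  case Nil
  then have "K = {}" by auto
  then show ?case by simp
next
  case (Cons j js)
  define A where "A = {k\<in>K. c k = j}"
  define B where "B = {k\<in>K. c k \<noteq> j}"
  have AB: "K = A \<union> B" "A \<inter> B = {}" "finite A" "finite B"
    using Cons.prems unfolding A_def B_def by auto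
  have j: "j \<notin> set js" "distinct js" using Cons.prems by auto
  define U where "U w = (\<Prod>k\<in>A. u k w)" for w
  define W where "W w = (\<Prod>k\<in>B. u k w)" for w
  \<comment> \<open>\<open>U\<close> ignores \<open>j\<close>, so it leaves the average over
    \<open>j\<close> and disappears after squaring because it is bounded by 1. \<open>W\<close>
    stays inside and is doubled.\<close>
  have U1: "\<bar>U w\<bar> \<le> 1" for w
    unfolding U_def abs_prod using Cons.prems(4) A_def by (intro prod_le_1) auto
  have Uj: "U (w(j := t)) = U w" for w t
    unfolding U_def using Cons.prems(5) A_def by (intro prod.cong) (auto simp del: fun_upd_apply)
  have prodK: "(\<Prod>k\<in>K. u k w) = U w * W w" for w
    unfolding U_def W_def AB(1) using AB by (subst prod.union_disjoint) auto
  define n where "n = real (card V)"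
  have "Av V (j # js) (\<lambda>w. F w * (\<Prod>k\<in>K. u k w)) = Av V js (avg V j (\<lambda>w. F w * (U w * W w)))"
    by (simp add: Av_avg_commute prodK)
  also have "avg V j (\<lambda>w. F w * (U w * W w)) = (\<lambda>w. U w * avg V j (\<lambda>w. F w * W w) w)"
    unfolding avg_def Uj by (simp add: sum_distrib_left mult_ac)
  finally have eq: "Av V (j # js) (\<lambda>w. F w * (\<Prod>k\<in>K. u k w)) w
      = Av V js (\<lambda>w. U w * avg V j (\<lambda>w. F w * W w) w) w" by simp
  \<comment> \<open>The square of an average over \<open>j\<close> is an average over pairs
    \<open>p\<close> of values at \<open>j\<close>, as in the recursion of \<open>Box\<close>. The
    doubled factors still ignore \<open>c k\<close>, which differs from \<open>j\<close>.\<close>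
  define F2 where "F2 p w = F (w(j := fst p)) * F (w(j := snd p))" for p w
  define v where "v p k w = u k (w(j := fst p)) * u k (w(j := snd p))" for p k w
  have "(Av V (j # js) (\<lambda>w. F w * (\<Prod>k\<in>K. u k w)) w)\<^sup>2
      \<le> Av V js (\<lambda>w. (U w * avg V j (\<lambda>w. F w * W w) w)\<^sup>2) w"
    unfolding eq by (rule Av_power2_le)
  also have "\<dots> \<le> Av V js (\<lambda>w. (avg V j (\<lambda>w. F w * W w) w)\<^sup>2) w"
  proof (rule Av_mono)
    fix w
    have "(U w)\<^sup>2 \<le> 1" using U1[of w] by (simp add: abs_square_le_1)
    then show "(U w * avg V j (\<lambda>w. F w * W w) w)\<^sup>2 \<le> (avg V j (\<lambda>w. F w * W w) w)\<^sup>2"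
      by (simp add: power_mult_distrib mult_left_le_one_le)
  qed
  also have "(\<lambda>w. (avg V j (\<lambda>w. F w * W w) w)\<^sup>2)
      = (\<lambda>w. (1 / n\<^sup>2) * (\<Sum>p\<in>V \<times> V. F2 p w * (\<Prod>k\<in>B. v p k w)))"
    unfolding avg_def F2_def v_def W_def n_def
    by (intro ext) (simp add: power_divide power2_eq_square sum_product sum.cartesian_product
        prod.distrib mult_ac case_prod_unfold)
  also have "Av V js \<dots> w = (\<Sum>p\<in>V \<times> V. Av V js (\<lambda>w. F2 p w * (\<Prod>k\<in>B. v p k w)) w) / n\<^sup>2"
    by (subst Av_cmult, subst Av_sum) simp
  finally have sq: "(Av V (j # js) (\<lambda>w. F w * (\<Prod>k\<in>K. u k w)) w)\<^sup>2
      \<le> (\<Sum>p\<in>V \<times> V. Av V js (\<lambda>w. F2 p w * (\<Prod>k\<in>B. v p k w)) w) / n\<^sup>2" .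
  have n2: "n\<^sup>2 = real (card (V \<times> V))"
    unfolding n_def by (simp add: card_cartesian_product power2_eq_square)
  have IH: "Av V js (\<lambda>w. F2 p w * (\<Prod>k\<in>B. v p k w)) w ^ (2 ^ length js) \<le> Box V js (F2 p) w" for p
  proof (rule Cons.IH)
    show "distinct js" "finite B" using j AB by auto
    fix k assume k: "k \<in> B"
    then have kK: "k \<in> K" "c k \<noteq> j" by (auto simp: B_def)
    show "c k \<in> set js" using Cons.prems(3) kK by auto
    show "\<bar>v p k w\<bar> \<le> 1" for w
      unfolding v_def abs_mult using Cons.prems(4)[OF kK(1)] by (intro mult_le_one) auto
    show "v p k (w(c k := t)) = v p k w" for w t
      unfolding v_def using Cons.prems(5)[OF kK(1)] kK(2)
      by (simp add: fun_upd_twist[OF kK(2)] del: fun_upd_apply)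
  qed
  have "Av V (j # js) (\<lambda>w. F w * (\<Prod>k\<in>K. u k w)) w ^ (2 ^ length (j # js))
      = ((Av V (j # js) (\<lambda>w. F w * (\<Prod>k\<in>K. u k w)) w)\<^sup>2) ^ (2 ^ length js)"
    by (simp add: power_mult[symmetric])
  also have "\<dots> \<le> ((\<Sum>p\<in>V \<times> V. Av V js (\<lambda>w. F2 p w * (\<Prod>k\<in>B. v p k w)) w)
      / real (card (V \<times> V))) ^ (2 ^ length js)"
    using sq unfolding n2 by (intro power_mono) auto
  also have "\<dots> \<le> (\<Sum>p\<in>V \<times> V. Av V js (\<lambda>w. F2 p w * (\<Prod>k\<in>B. v p k w)) w ^ (2 ^ length js))
      / real (card (V \<times> V))"
    by (rule mean_power_le)
  also have "\<dots> \<le> (\<Sum>p\<in>V \<times> V. Box V js (F2 p) w) / real (card (V \<times> V))"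
    by (intro divide_right_mono sum_mono IH) auto
  also have "\<dots> = Box V (j # js) F w"
    by (simp add: n2[symmetric] n_def F2_def[abs_def] case_prod_unfold)
  finally show ?case .
qed

text \<open>The preceding inequality without factors bounds the box below by a power whose exponent
  is even, as \<open>js\<close> is nonempty.\<close>

lemma Box_nonneg:
  assumes "js \<noteq> []" "distinct js"
  shows "Box V js F w \<ge> 0"
proof -
  have "Av V js F w ^ (2 ^ length js) \<ge> 0"
    using assms by (intro zero_le_even_power) (cases js, auto)
  also have "Av V js F w ^ (2 ^ length js) \<le> Box V js F w"
    using Gowers_Cauchy_Schwarz[OF assms(2), of "{}" "\<lambda>_. hd js" "\<lambda>_ _. 0" V F w] by simp
  finally show ?thesis .
qed

text \<open>Averaged coordinates may be renamed. This identifies the box in the coordinates of any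
  \<open>d\<close>-set with the one over \<open>[0..<d]\<close> in \<open>box\<close>.\<close>

lemma Box_map_cong:
  assumes "distinct js" "distinct is" "length js = length is"
  shows "Box V js (\<lambda>w. G (map w js)) w = Box V is (\<lambda>w. G (map w is)) w'"
  using assms
proof (induction js "is" arbitrary: G w w' rule: list_induct2')
  case (4 j js i "is")
  have "Box V js (\<lambda>w. G (s # map (w(j := s)) js) * G (t # map (w(j := t)) js)) w
      = Box V is (\<lambda>w. G (s # map (w(i := s)) is) * G (t # map (w(i := t)) is)) w'" for s t
  proof -
    have *: "map (w(a := s)) xs = map w xs" if "a \<notin> set xs" for w :: "_ \<Rightarrow> _" and a :: 'b and s xs
      using that by (intro map_cong) auto
    have **: "map (w(a := s)) xs = map w xs" if "a \<notin> set xs" for w :: "_ \<Rightarrow> _" and a :: 'c and s xs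
      using that by (intro map_cong) auto
    show ?thesis
      using 4(1)[of "\<lambda>x. G (s # x) * G (t # x)" w w'] 4(2-)
      by (simp add: * **)
  qed
  then show ?case by simp
qed auto

text \<open>The box as one average: a point of \<open>V \<times> V\<close> in every coordinate of \<open>js\<close>, and
  \<open>S\<close> selects the coordinates where the first component is used.\<close>

lemma Box_eq_Av:
  assumes "distinct js"
  shows "Box V js F w = Av (V \<times> V) js (\<lambda>y. \<Prod>S\<in>Pow (set js).
    F (\<lambda>i. if i \<in> S then fst (y i) else if i \<in> set js then snd (y i) else w i)) y0"
  using assms
proof (induction js arbitrary: F w y0)
  case (Cons j js)
  define mix where "mix T S y w = (\<lambda>i. if i \<in> S then fst (y i) else if i \<in> T then snd (y i) else w i)"
    for T S y and w :: "'a \<Rightarrow> 'b"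
  have j: "j \<notin> set js" "distinct js" using Cons.prems by auto
  \<comment> \<open>A subset with \<open>j\<close> reads the first component there, the same subset
    without \<open>j\<close> reads the second, so each factor for \<open>js\<close> splits into
    two.\<close>
  have P: "Pow (set (j # js)) = insert j ` Pow (set js) \<union> Pow (set js)"
    by (simp add: Pow_insert Un_commute)
  have dis: "insert j ` Pow (set js) \<inter> Pow (set js) = {}" using j by auto
  have inj: "inj_on (insert j) (Pow (set js))"
    using j by (intro inj_onI) (metis PowD insert_ident subsetD)
  have split: "(\<Prod>S\<in>Pow (set (j # js)). F (mix (set (j # js)) S (y(j := (s, t))) w))
     = (\<Prod>S\<in>Pow (set js). F ((mix (set js) S y w)(j := s)) * F ((mix (set js) S y w)(j := t)))" for s t y
  proof -
    have 1: "mix (set (j # js)) (insert j S) (y(j := (s, t))) w = (mix (set js) S y w)(j := s)" 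
       and 2: "mix (set (j # js)) S (y(j := (s, t))) w = (mix (set js) S y w)(j := t)" if "S \<in> Pow (set js)" for S
      using that j unfolding mix_def by (intro ext, auto)+
    show ?thesis
      unfolding P
      by (subst prod.union_disjoint) 
        (use dis in \<open>auto simp: prod.reindex[OF inj] prod.distrib 1[simplified] 2[simplified]
            simp del: fun_upd_apply intro!: prod.cong arg_cong2[where f="(*)"]\<close>)
  qed
  have split2: "(\<Prod>S\<in>Pow (set (j # js)). F (mix (set (j # js)) S (y(j := p)) w))
     = (\<Prod>S\<in>Pow (set js). F ((mix (set js) S y w)(j := fst p)) * F ((mix (set js) S y w)(j := snd p)))" for p y
    using split[of y "fst p" "snd p"] by simp
  have "Box V (j # js) F w = (\<Sum>(s, t)\<in>V \<times> V. Av (V \<times> V) js (\<lambda>y. \<Prod>S\<in>Pow (set js).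
      F ((mix (set js) S y w)(j := s)) * F ((mix (set js) S y w)(j := t))) y0) / real (card V) ^ 2"
    by (simp add: Cons.IH[OF j(2), of _ w y0] mix_def del: fun_upd_apply)
  also have "\<dots> = (\<Sum>p\<in>V \<times> V. Av (V \<times> V) js (\<lambda>y. \<Prod>S\<in>Pow (set (j # js)).
      F (mix (set (j # js)) S y w)) (y0(j := p))) / real (card (V \<times> V))"
    unfolding Av_shift[OF j(1)]
    by (simp only: case_prod_unfold split2) (simp add: card_cartesian_product power2_eq_square)
  finally show ?case by (simp only: Av.simps avg_def mix_def)
qed simp

text \<open>The comparison is needed only at points of \<open>V\<close>. The set \<open>I\<close>
  collects the coordinates that have already received a value in \<open>V\<close> during the
  induction.\<close>

lemma Av_mono_on:
  assumes "\<And>w. (\<And>i. i \<in> set js \<union> I \<Longrightarrow> w i \<in> V) \<Longrightarrow> f w \<le> g w" "\<And>i. i \<in> I \<Longrightarrow> w i \<in> V"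
  shows "Av V js f w \<le> Av V js g w"
  using assms
proof (induction js arbitrary: w I)
  case (Cons j js)
  have "Av V js f (w(j := t)) \<le> Av V js g (w(j := t))" if "t \<in> V" for t
    by (rule Cons.IH[of "insert j I"]) (use Cons.prems that in auto)
  then show ?case
    unfolding Av.simps avg_def by (intro divide_right_mono sum_mono) auto
qed simp

section \<open>Pseudorandom set systems\<close>

definition spin :: "nat set set \<Rightarrow> nat set \<Rightarrow> real" where
  "spin g B = (if B \<in> g then 1 else -1)"

text \<open>The order belongs to the function because of \<open>d = 2\<close>: the comparison of the
  two coordinates of a pair ignores neither of them, so it could not be one of the factors that
  Cauchy--Schwarz removes.\<close>

definition ordspin :: "nat set set \<Rightarrow> nat list \<Rightarrow> real" where
  "ordspin g xs = (if sorted_wrt (<) xs then spin g (set xs) else 0)"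

definition box :: "nat \<Rightarrow> nat set \<Rightarrow> nat set set \<Rightarrow> real" where
  "box d U g = Box U [0..<d] (\<lambda>w. ordspin g (map w [0..<d])) (\<lambda>_. 0)"

lemma abs_spin [simp]: "\<bar>spin g B\<bar> = 1"
  by (simp add: spin_def)

lemma box_nonneg: "d \<ge> 1 \<Longrightarrow> box d U g \<ge> 0"
  unfolding box_def by (rule Box_nonneg) auto

text \<open>Toggling \<open>a\<close> is an involution of \<open>Pow X\<close> that reverses the
  sign of every term.\<close>

lemma sum_Pow_toggle:
  fixes h :: "'a set \<Rightarrow> real"
  assumes "a \<in> X" "\<And>g. h (sym_diff g {a}) = - h g"
  shows "(\<Sum>g\<in>Pow X. h g) = 0"
proof -
  have "(\<Sum>g\<in>Pow X. h g) = (\<Sum>g\<in>Pow X. h (sym_diff g {a}))"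
  proof (rule sum.reindex_bij_witness[of _ "\<lambda>g. sym_diff g {a}" "\<lambda>g. sym_diff g {a}"])
    have *: "sym_diff (sym_diff g {a}) {a} = g" for g by auto
    show "sym_diff (sym_diff g {a}) {a} = g" "sym_diff (sym_diff g {a}) {a} = g" for g by (rule *)+
    show "h (sym_diff (sym_diff g {a}) {a}) = h g" for g by (simp only: *)
    show "sym_diff g {a} \<in> Pow X" "sym_diff g {a} \<in> Pow X" if "g \<in> Pow X" for g
      using that assms(1) by blast+
  qed
  also have "\<dots> = - (\<Sum>g\<in>Pow X. h g)"
    by (simp add: assms(2) sum_negf)
  finally show ?thesis by simp
qed

text \<open>Unless some \<open>snd (y i)\<close> equals some \<open>fst (y j)\<close>, the set of the \<open>fst (y j)\<close> occurs
  exactly once in the product, so toggling it in \<open>g\<close> changes the sign.\<close>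

lemma sum_prod_ordspin_le:
  fixes U :: "nat set" and y :: "nat \<Rightarrow> nat \<times> nat"
  assumes X: "finite X" "Pow U \<subseteq> X" and y: "\<And>i. i < d \<Longrightarrow> y i \<in> U \<times> U"
  defines "mix S \<equiv> (\<lambda>i. if i \<in> S then fst (y i) else if i \<in> set [0..<d] then snd (y i) else 0)"
  shows "(\<Sum>g\<in>Pow X. \<Prod>S\<in>Pow (set [0..<d]). ordspin g (map (mix S) [0..<d]))
     \<le> 2 ^ card X * (\<Sum>p\<in>{..<d} \<times> {..<d}. of_bool (snd (y (fst p)) = fst (y (snd p))))"
proof (cases "\<exists>i<d. \<exists>j<d. snd (y i) = fst (y j)")
  case True
  then obtain i j where ij: "i < d" "j < d" "snd (y i) = fst (y j)" by auto
  have "(1::real) = of_bool (snd (y (fst (i, j))) = fst (y (snd (i, j))))" using ij by simp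
  also have "\<dots> \<le> (\<Sum>p\<in>{..<d} \<times> {..<d}. of_bool (snd (y (fst p)) = fst (y (snd p))))"
    by (rule member_le_sum) (use ij in auto)
  finally have 1: "(1::real) \<le> (\<Sum>p\<in>{..<d} \<times> {..<d}. of_bool (snd (y (fst p)) = fst (y (snd p))))" .
  \<comment> \<open>When a coincidence occurs, the trivial bound 1 for every \<open>g\<close> is
    enough, since the count on the right is at least 1.\<close>
  have "(\<Sum>g\<in>Pow X. \<Prod>S\<in>Pow (set [0..<d]). ordspin g (map (mix S) [0..<d])) \<le> (\<Sum>g\<in>Pow X. 1)"
  proof (rule sum_mono)
    fix g
    have "\<bar>\<Prod>S\<in>Pow (set [0..<d]). ordspin g (map (mix S) [0..<d])\<bar> \<le> 1"
      unfolding abs_prod by (rule prod_le_1) (auto simp: ordspin_def)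
    then show "(\<Prod>S\<in>Pow (set [0..<d]). ordspin g (map (mix S) [0..<d])) \<le> 1" by simp
  qed
  also have "\<dots> = 2 ^ card X * 1" using X by (simp add: card_Pow)
  also have "\<dots> \<le> 2 ^ card X * (\<Sum>p\<in>{..<d} \<times> {..<d}. of_bool (snd (y (fst p)) = fst (y (snd p))))"
    by (rule mult_left_mono) (use 1 in auto)
  finally show ?thesis .
next
  case False
  define a where "a = (fst \<circ> y) ` {..<d}"
  have aX: "a \<in> X" using X y unfolding a_def by fastforce
  have set_mix: "set (map (mix S) [0..<d]) = a \<longleftrightarrow> S = {..<d}" if "S \<subseteq> {..<d}" for S
  proof
    assume eq: "set (map (mix S) [0..<d]) = a"
    have "i \<in> S" if "i < d" for i
    proof (rule ccontr)
      assume "i \<notin> S"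
      then have "mix S i = snd (y i)" using that by (simp add: mix_def)
      moreover have "mix S i \<in> a" using eq that by auto
      ultimately show False using False that unfolding a_def by auto
    qed
    with that show "S = {..<d}" by auto
  qed (auto simp: a_def mix_def)
  have flip: "(\<Prod>S\<in>Pow (set [0..<d]). ordspin (sym_diff g {a}) (map (mix S) [0..<d]))
      = - (\<Prod>S\<in>Pow (set [0..<d]). ordspin g (map (mix S) [0..<d]))" for g
  proof -
    have full: "ordspin (sym_diff g {a}) (map (mix {..<d}) [0..<d]) = - ordspin g (map (mix {..<d}) [0..<d])"
      using set_mix[of "{..<d}"] unfolding ordspin_def spin_def by auto
    have rest: "ordspin (sym_diff g {a}) (map (mix S) [0..<d]) = ordspin g (map (mix S) [0..<d])"
      if "S \<in> Pow {..<d} - {{..<d}}" for S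
      using set_mix[of S] that unfolding ordspin_def spin_def by auto
    have s: "set [0..<d] = {..<d}" by auto
    have "finite (Pow {..<d})" "{..<d} \<in> Pow {..<d}" by auto
    then show ?thesis
      unfolding s by (subst (1 2) prod.remove[of _ "{..<d}"]) (simp_all add: full rest)
  qed
  have "(\<Sum>g\<in>Pow X. \<Prod>S\<in>Pow (set [0..<d]). ordspin g (map (mix S) [0..<d])) = 0"
    by (rule sum_Pow_toggle[OF aX]) (rule flip)
  also have "0 \<le> 2 ^ card X * (\<Sum>p\<in>{..<d} \<times> {..<d}. of_bool (snd (y (fst p)) = fst (y (snd p))) :: real)"
    by (simp add: sum_nonneg)
  finally show ?thesis .
qed

text \<open>Once the first component at \<open>i\<close> is chosen, at most one second component is
  a match. For \<open>i = j\<close> the value to be hit is that first component itself.\<close>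

lemma avg_coincidence_le:
  fixes U :: "'a set"
  assumes U: "finite U" "U \<noteq> {}"
  shows "avg (U \<times> U) i (\<lambda>y. of_bool (snd (y i) = fst (y j))) w \<le> 1 / real (card U)"
proof -
  have "(\<Sum>t\<in>U \<times> U. of_bool (snd ((w(i := t)) i) = fst ((w(i := t)) j)))
      = (\<Sum>a\<in>U. \<Sum>b\<in>U. of_bool (b = (if i = j then a else fst (w j))) :: real)"
    unfolding sum.cartesian_product by (intro sum.cong) auto
  also have "\<dots> \<le> (\<Sum>a\<in>U. 1)"
    by (intro sum_mono) (use U in \<open>simp add: of_bool_def\<close>)
  finally have "(\<Sum>t\<in>U \<times> U. of_bool (snd ((w(i := t)) i) = fst ((w(i := t)) j))) \<le> real (card U)"
    by simp
  moreover have "real (card U) > 0" using U by (simp add: card_gt_0_iff)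
  ultimately show ?thesis
    unfolding avg_def card_cartesian_product by (simp add: field_simps)
qed

text \<open>The sum over \<open>g\<close> is moved inside the average over doubled points, where the
  toggling estimate applies. Each of the \<open>d * d\<close> possible coincidences has probability
  at most \<open>1 / card U\<close>.\<close>

lemma sum_box_le:
  assumes X: "finite X" "Pow U \<subseteq> X" and U: "finite U" "U \<noteq> {}"
  shows "(\<Sum>g\<in>Pow X. box d U g) \<le> 2 ^ card X * (real d)\<^sup>2 / real (card U)"
proof -
  obtain u where u: "u \<in> U" using U by auto
  let ?mix = "\<lambda>y S i. if i \<in> S then fst (y i) else if i \<in> set [0..<d] then snd (y i) else 0"
  let ?c = "\<lambda>p y. of_bool (snd (y (fst p)) = fst (y (snd p))) :: real"
  have UU: "finite (U \<times> U)" "U \<times> U \<noteq> {}" using U by auto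
  have "(\<Sum>g\<in>Pow X. box d U g) = Av (U \<times> U) [0..<d] (\<lambda>y. \<Sum>g\<in>Pow X.
      \<Prod>S\<in>Pow (set [0..<d]). ordspin g (map (?mix y S) [0..<d])) (\<lambda>_. (u, u))"
    unfolding box_def by (simp add: Box_eq_Av[where ?y0.0 = "\<lambda>_. (u, u)"] Av_sum)
  also have "\<dots> \<le> Av (U \<times> U) [0..<d] (\<lambda>y. 2 ^ card X * (\<Sum>p\<in>{..<d} \<times> {..<d}. ?c p y)) (\<lambda>_. (u, u))"
    by (rule Av_mono_on[where I = "{}"], rule sum_prod_ordspin_le[OF X]) auto
  also have "\<dots> = 2 ^ card X * (\<Sum>p\<in>{..<d} \<times> {..<d}. Av (U \<times> U) [0..<d] (?c p) (\<lambda>_. (u, u)))"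
    by (simp only: Av_cmult Av_sum)
  also have "\<dots> \<le> 2 ^ card X * (\<Sum>p\<in>{..<d} \<times> {..<d}. 1 / real (card U))"
  proof (intro mult_left_mono sum_mono)
    fix p assume "p \<in> {..<d} \<times> {..<d}"
    then show "Av (U \<times> U) [0..<d] (?c p) (\<lambda>_. (u, u)) \<le> 1 / real (card U)"
      by (intro Av_le_const[OF UU, of "fst p"] avg_coincidence_le U) auto
  qed auto
  also have "\<dots> = 2 ^ card X * (real d)\<^sup>2 / real (card U)"
    by (simp add: card_cartesian_product power2_eq_square)
  finally show ?thesis .
qed

text \<open>Otherwise every \<open>g\<close> fails at some scale, and the sum of the means weighted
  by \<open>2 ^ j\<close> exceeds \<open>2 * d\<^sup>2\<close> for every \<open>g\<close>. But the
  mean at scale \<open>j\<close>, averaged over \<open>g\<close>, is at most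
  \<open>d\<^sup>2 / 4 ^ j\<close>, so the weighted sum is on average at most
  \<open>d\<^sup>2\<close> times a geometric series below 2.\<close>

lemma exists_pseudorandom:
  assumes d: "d \<ge> 1"
  shows "\<exists>g. \<forall>j\<le>J. (\<Sum>U | U \<subseteq> {..<4 ^ J} \<and> card U = 4 ^ j. box d U g) / real (4 ^ J choose 4 ^ j)
    \<le> 2 * (real d)\<^sup>2 / 2 ^ j"
proof (rule ccontr)
  assume neg: "\<not> ?thesis"
  let ?\<U> = "\<lambda>j. {U. U \<subseteq> {..<4 ^ J :: nat} \<and> card U = 4 ^ j}"
  define m where "m j g = (\<Sum>U\<in>?\<U> j. box d U g) / real (4 ^ J choose 4 ^ j)" for j g
  have m0: "m j g \<ge> 0" for j g
    unfolding m_def using box_nonneg[OF d] by (simp add: sum_nonneg)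
  define X where "X = Pow {..<4 ^ J :: nat}"
  have big: "(\<Sum>j\<le>J. 2 ^ j * m j g) > 2 * (real d)\<^sup>2" for g
  proof -
    have "\<not> (\<forall>j\<le>J. m j g \<le> 2 * (real d)\<^sup>2 / 2 ^ j)"
      using neg unfolding m_def by blast
    then obtain j where j: "j \<le> J" "m j g > 2 * (real d)\<^sup>2 / 2 ^ j"
      by (auto simp: not_le)
    then have "2 * (real d)\<^sup>2 < 2 ^ j * m j g" by (simp add: field_simps)
    also have "\<dots> \<le> (\<Sum>j\<le>J. 2 ^ j * m j g)"
      by (rule member_le_sum) (use j m0 in auto)
    finally show ?thesis .
  qed
  have bnd: "(\<Sum>g\<in>Pow X. m j g) \<le> 2 ^ card X * ((real d)\<^sup>2 / 4 ^ j)" if "j \<le> J" for j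
  proof -
    have ch: "real (4 ^ J choose 4 ^ j) > 0"
      using that by (simp add: power_increasing)
    have "(\<Sum>g\<in>Pow X. m j g) = (\<Sum>U\<in>?\<U> j. \<Sum>g\<in>Pow X. box d U g) / real (4 ^ J choose 4 ^ j)"
      unfolding m_def sum_divide_distrib[symmetric] by (subst sum.swap) simp
    also have "\<dots> \<le> (\<Sum>U\<in>?\<U> j. 2 ^ card X * (real d)\<^sup>2 / 4 ^ j) / real (4 ^ J choose 4 ^ j)"
    proof (intro divide_right_mono sum_mono)
      fix U assume "U \<in> ?\<U> j"
      then have "finite U" "U \<noteq> {}" "Pow U \<subseteq> X" "card U = 4 ^ j"
        by (auto simp: X_def intro: finite_subset)
      then show "(\<Sum>g\<in>Pow X. box d U g) \<le> 2 ^ card X * (real d)\<^sup>2 / 4 ^ j"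
        using sum_box_le[of X U d] by (simp add: X_def)
    qed simp
    also have "\<dots> = 2 ^ card X * ((real d)\<^sup>2 / 4 ^ j)"
      using ch by (simp add: n_subsets)
    finally show ?thesis .
  qed
  have "(\<Sum>g\<in>Pow X. 2 * (real d)\<^sup>2) < (\<Sum>g\<in>Pow X. \<Sum>j\<le>J. 2 ^ j * m j g)"
    by (rule sum_strict_mono) (use big in \<open>auto simp: X_def\<close>)
  also have "\<dots> = (\<Sum>j\<le>J. 2 ^ j * (\<Sum>g\<in>Pow X. m j g))"
    by (subst sum.swap) (simp add: sum_distrib_left)
  also have "\<dots> \<le> (\<Sum>j\<le>J. 2 ^ j * (2 ^ card X * ((real d)\<^sup>2 / 4 ^ j)))"
    by (intro sum_mono mult_left_mono bnd) auto
  also have "\<dots> = 2 ^ card X * (real d)\<^sup>2 * (\<Sum>j\<le>J. (1 / 2) ^ j)"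
    unfolding sum_distrib_left
  proof (rule sum.cong)
    fix j :: nat
    have "(4::real) ^ j = 2 ^ j * 2 ^ j" by (simp add: power_mult_distrib[symmetric])
    then show "2 ^ j * (2 ^ card X * ((real d)\<^sup>2 / 4 ^ j)) = 2 ^ card X * (real d)\<^sup>2 * (1 / 2) ^ j"
      by (simp add: power_one_over field_simps)
  qed simp
  also have "\<dots> \<le> 2 ^ card X * (real d)\<^sup>2 * 2"
  proof (rule mult_left_mono)
    have "(\<Sum>j\<le>J. (1 / 2 :: real) ^ j) = 2 - (1 / 2) ^ J"
      by (induction J) auto
    then show "(\<Sum>j\<le>J. (1 / 2 :: real) ^ j) \<le> 2" by simp
  qed simp
  finally show False
    by (simp add: X_def card_Pow)
qed

section \<open>Finite models and their densities\<close>

lemma is_iso_id: "is_iso id M M"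
  by (simp add: is_iso_def)

lemma is_iso_comp:
  assumes "is_iso f A B" "is_iso g B C"
  shows "is_iso (g \<circ> f) A C"
  unfolding is_iso_def
proof (intro conjI allI impI)
  show "bij_betw (g \<circ> f) (verts A) (verts C)"
    using assms by (auto simp: is_iso_def intro: bij_betw_trans)
  fix P xs assume xs: "set xs \<subseteq> verts A"
  then have "set (map f xs) \<subseteq> verts B"
    using assms(1) by (auto simp: is_iso_def bij_betw_def)
  with xs assms have "xs \<in> rels A P \<longleftrightarrow> map g (map f xs) \<in> rels C P"
    by (simp add: is_iso_def)
  then show "xs \<in> rels A P \<longleftrightarrow> map (g \<circ> f) xs \<in> rels C P" by simp
qed

lemma is_iso_inv:
  assumes "is_iso f A B"
  shows "is_iso (inv_into (verts A) f) B A"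
  unfolding is_iso_def
proof (intro conjI allI impI)
  have bij: "bij_betw f (verts A) (verts B)" using assms by (simp add: is_iso_def)
  then show b2: "bij_betw (inv_into (verts A) f) (verts B) (verts A)"
    by (rule bij_betw_inv_into)
  fix P xs assume xs: "set xs \<subseteq> verts B"
  have 1: "set (map (inv_into (verts A) f) xs) \<subseteq> verts A"
    using b2 xs by (auto simp: bij_betw_def)
  have 2: "map f (map (inv_into (verts A) f) xs) = xs"
    using xs bij by (simp add: map_idI bij_betw_inv_into_right subset_iff)
  have "map (inv_into (verts A) f) xs \<in> rels A P \<longleftrightarrow> map f (map (inv_into (verts A) f) xs) \<in> rels B P"
    using assms 1 unfolding is_iso_def by blast
  then show "xs \<in> rels B P \<longleftrightarrow> map (inv_into (verts A) f) xs \<in> rels A P"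
    by (simp only: 2)
qed

lemma isomorphic_refl: "isomorphic M M"
  using is_iso_id unfolding isomorphic_def by blast

lemma isomorphic_trans: "isomorphic A B \<Longrightarrow> isomorphic B C \<Longrightarrow> isomorphic A C"
  using is_iso_comp unfolding isomorphic_def by blast

lemma isomorphic_sym: "isomorphic A B \<Longrightarrow> isomorphic B A"
  using is_iso_inv unfolding isomorphic_def by blast

lemma isomorphic_card: "isomorphic A B \<Longrightarrow> card (verts A) = card (verts B)"
  unfolding isomorphic_def is_iso_def using bij_betw_same_card by blast

lemma is_struct_induced: "is_struct T M \<Longrightarrow> U \<subseteq> verts M \<Longrightarrow> is_struct T (induced M U)"
  unfolding is_struct_def induced_def by auto

lemma sat_induced:
  "over_language L ar F \<Longrightarrow> range v \<subseteq> U \<Longrightarrow> sat (induced M U) v F = sat M v F"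
  by (induction F) (auto simp: induced_def)

lemma sat_iso:
  assumes "is_iso f A B" "range v \<subseteq> verts A"
  shows "sat B (f \<circ> v) F = sat A v F"
proof (induction F)
  case (Eq i j)
  have "inj_on f (verts A)" using assms by (auto simp: is_iso_def bij_betw_def)
  then show ?case using assms(2) by (auto dest: inj_onD)
next
  case (Rel P xs)
  have "set (map v xs) \<subseteq> verts A" using assms(2) by auto
  then show ?case using assms(1) unfolding is_iso_def by (simp add: o_def)
qed auto

lemma is_model_induced:
  assumes "universal_theory T" "is_model T M" "U \<subseteq> verts M"
  shows "is_model T (induced M U)"
  unfolding is_model_def
proof (intro conjI allI impI ballI)
  show "is_struct T (induced M U)"
    using assms is_struct_induced by (auto simp: is_model_def)
  fix v :: "nat \<Rightarrow> 'b" and F assume v: "range v \<subseteq> verts (induced M U)" and F: "F \<in> axs T"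
  then have "range v \<subseteq> U" by (simp add: induced_def)
  moreover have "over_language (preds T) (arity T) F"
    using assms(1) F by (auto simp: universal_theory_def)
  ultimately have "sat (induced M U) v F = sat M v F" by (rule sat_induced[rotated])
  then show "sat (induced M U) v F"
    using assms F \<open>range v \<subseteq> U\<close> unfolding is_model_def by blast
qed

lemma fin_models_induced:
  assumes "universal_theory T" "N \<in> fin_models T" "U \<subseteq> verts N"
  shows "induced N U \<in> fin_models T"
  using assms is_model_induced[OF assms(1), of N U]
  by (auto simp: fin_models_def induced_def intro: finite_subset)

text \<open>\<open>is_iso\<close> says nothing about tuples that leave the vertex set, hence the
  separate assumption that \<open>N\<close> is a structure.\<close>

lemma is_model_iso:
  assumes M: "is_model T M" and f: "is_iso f M N" and N: "is_struct T N"
  shows "is_model T N"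
  unfolding is_model_def
proof (intro conjI allI impI ballI N)
  fix v :: "nat \<Rightarrow> 'c" and F assume v: "range v \<subseteq> verts N" and F: "F \<in> axs T"
  let ?h = "inv_into (verts M) f"
  have h: "is_iso ?h N M" by (rule is_iso_inv[OF f])
  have "range (?h \<circ> v) \<subseteq> verts M"
    using h v by (auto simp: is_iso_def bij_betw_def image_subset_iff)
  then have "sat M (?h \<circ> v) F" using M F unfolding is_model_def by blast
  then show "sat N v F" using sat_iso[OF h v] by simp
qed

lemma iso_class_eq_iff:
  assumes "A \<in> fin_models T" "B \<in> fin_models T"
  shows "iso_class T A = iso_class T B \<longleftrightarrow> isomorphic A B"
proof
  assume "iso_class T A = iso_class T B"
  moreover have "B \<in> iso_class T B" using assms isomorphic_refl by (simp add: iso_class_def)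
  ultimately show "isomorphic A B" by (auto simp: iso_class_def)
next
  assume AB: "isomorphic A B"
  have "isomorphic A X \<longleftrightarrow> isomorphic B X" for X :: "('a, nat) rstruct"
    using isomorphic_trans[OF AB, of X] isomorphic_trans[OF isomorphic_sym[OF AB], of X] by blast
  then show "iso_class T A = iso_class T B"
    unfolding iso_class_def by simp
qed

lemma density_cong:
  assumes "isomorphic M M'"
  shows "density M N = density M' N"
proof -
  have "isomorphic X M \<longleftrightarrow> isomorphic X M'" for X :: "('a, 'd) rstruct"
    using isomorphic_trans[OF _ assms, of X] isomorphic_trans[OF _ isomorphic_sym[OF assms], of X] by blast
  then show ?thesis
    unfolding density_def by (simp add: isomorphic_card[OF assms])
qed

section \<open>Finiteness and countability of the set of isomorphism classes\<close>

definition models_on :: "'p rtheory \<Rightarrow> nat \<Rightarrow> ('p, nat) rstruct set" where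
  "models_on T m = {M \<in> fin_models T. verts M = {..<m}}"

text \<open>A structure is coded by its set of pairs of a predicate and a tuple, all taken from a
  finite set.\<close>

lemma finite_models_on:
  assumes "universal_theory T"
  shows "finite (models_on T m)"
proof -
  define X where "X = (SIGMA P:preds T. {xs. set xs \<subseteq> {..<m} \<and> length xs = arity T P})"
  have "finite X"
    using assms unfolding X_def universal_theory_def by (auto intro!: finite_lists_length_eq)
  define code where "code M = (SIGMA P:UNIV. rels M P)" for M :: "('a, nat) rstruct"
  have "inj_on code (models_on T m)"
  proof (rule inj_onI)
    fix A B :: "('a, nat) rstruct"
    assume *: "A \<in> models_on T m" "B \<in> models_on T m" "code A = code B"
    then have "rels A P = rels B P" for P unfolding code_def by blast
    then have "rels A = rels B" by (rule ext)
    then show "A = B" using * by (simp add: models_on_def)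
  qed
  moreover have "code ` models_on T m \<subseteq> Pow X"
    unfolding code_def X_def models_on_def fin_models_def is_model_def is_struct_def
    by (auto simp: subset_iff) 
  ultimately show ?thesis
    using \<open>finite X\<close> by (meson finite_Pow_iff finite_imageD finite_subset)
qed

definition transport :: "('v \<Rightarrow> 'w) \<Rightarrow> ('p, 'v) rstruct \<Rightarrow> ('p, 'w) rstruct" where
  "transport f M = \<lparr>verts = f ` verts M, rels = (\<lambda>P. map f ` rels M P)\<rparr>"

lemma transport_is_iso:
  assumes "is_struct T M" "inj_on f (verts M)"
  shows "is_iso f M (transport f M)" "is_struct T (transport f M)"
proof -
  have sub: "set xs \<subseteq> verts M" if "xs \<in> rels M P" for xs P
    using assms(1) that unfolding is_struct_def by blast
  show "is_iso f M (transport f M)"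
    unfolding is_iso_def
  proof (intro conjI allI impI)
    show "bij_betw f (verts M) (verts (transport f M))"
      using assms(2) by (simp add: transport_def bij_betw_def)
    fix P xs assume xs: "set xs \<subseteq> verts M"
    have "xs = ys" if "map f xs = map f ys" "ys \<in> rels M P" for ys
      using that xs sub[OF that(2)] inj_on_subset[OF assms(2), of "set xs \<union> set ys"]
      by (simp add: inj_on_map_eq_map)
    then show "xs \<in> rels M P \<longleftrightarrow> map f xs \<in> rels (transport f M) P"
      by (auto simp: transport_def)
  qed
  show "is_struct T (transport f M)"
    using assms(1) unfolding is_struct_def transport_def by fastforce
qed

lemma exists_models_on:
  assumes "M \<in> fin_models T"
  shows "\<exists>M'\<in>models_on T (card (verts M)). isomorphic M M'"
proof -
  have "finite (verts M)" "is_model T M" using assms by (auto simp: fin_models_def)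
  then obtain f where f: "bij_betw f (verts M) {..<card (verts M)}"
    using finite_same_card_bij[of "verts M" "{..<card (verts M)}"] by auto
  have iso: "is_iso f M (transport f M)" "is_struct T (transport f M)"
    using transport_is_iso[of T M f] \<open>is_model T M\<close> f by (auto simp: is_model_def bij_betw_def)
  then have "is_model T (transport f M)" using is_model_iso \<open>is_model T M\<close> by blast
  moreover have "verts (transport f M) = {..<card (verts M)}"
    using f by (simp add: transport_def bij_betw_def)
  ultimately show ?thesis
    using iso(1) unfolding models_on_def fin_models_def isomorphic_def by auto
qed

definition classes_of_size :: "'p rtheory \<Rightarrow> nat \<Rightarrow> ('p, nat) rstruct set set" where
  "classes_of_size T m = iso_class T ` {M \<in> fin_models T. card (verts M) = m}"

lemma finite_classes_of_size:
  assumes "universal_theory T"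
  shows "finite (classes_of_size T m)"
proof -
  have "classes_of_size T m \<subseteq> iso_class T ` models_on T m"
  proof
    fix C assume "C \<in> classes_of_size T m"
    then obtain M where M: "M \<in> fin_models T" "card (verts M) = m" "C = iso_class T M"
      by (auto simp: classes_of_size_def)
    then obtain M' where "M' \<in> models_on T m" "isomorphic M M'"
      using exists_models_on by blast
    moreover from this M have "C = iso_class T M'"
      by (simp add: iso_class_eq_iff models_on_def)
    ultimately show "C \<in> iso_class T ` models_on T m"
      using M(2) by auto
  qed
  then show ?thesis
    using finite_models_on[OF assms] by (meson finite_imageI finite_subset)
qed

lemma countable_iso_classes:
  assumes "universal_theory T"
  shows "countable (iso_classes T)"
proof -
  have "iso_classes T \<subseteq> (\<Union>m. classes_of_size T m)"
    by (auto simp: iso_classes_def classes_of_size_def)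
  moreover have "countable (\<Union>m. classes_of_size T m)"
    using finite_classes_of_size[OF assms] by (intro countable_UN countableI_type countable_finite)
  ultimately show ?thesis by (rule countable_subset)
qed

text \<open>The representative of an isomorphism class; the class of a finite model is never empty.\<close>

definition rep :: "('p, nat) rstruct set \<Rightarrow> ('p, nat) rstruct" where
  "rep C = (SOME M. M \<in> C)"

lemma rep_iso_class:
  assumes "M \<in> fin_models T"
  shows "rep (iso_class T M) \<in> fin_models T" "isomorphic M (rep (iso_class T M))"
    "iso_class T (rep (iso_class T M)) = iso_class T M"
proof -
  have "M \<in> iso_class T M" using assms isomorphic_refl by (simp add: iso_class_def)
  then have "rep (iso_class T M) \<in> iso_class T M" unfolding rep_def by (rule someI)
  then show 1: "rep (iso_class T M) \<in> fin_models T" "isomorphic M (rep (iso_class T M))"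
    by (auto simp: iso_class_def)
  then show "iso_class T (rep (iso_class T M)) = iso_class T M"
    using assms iso_class_eq_iff by blast
qed

section \<open>Means of isomorphism-invariant statistics, convergence and compactness\<close>

definition mean_induced :: "nat \<Rightarrow> (('p, nat) rstruct \<Rightarrow> real) \<Rightarrow> ('p, nat) rstruct \<Rightarrow> real" where
  "mean_induced m F N =
    (\<Sum>U | U \<subseteq> verts N \<and> card U = m. F (induced N U)) / real (card (verts N) choose m)"

lemma density_eq_mean_induced:
  "finite (verts N) \<Longrightarrow> density M N = mean_induced (card (verts M)) (\<lambda>X. of_bool (isomorphic X M)) N"
  unfolding density_def mean_induced_def
  by (auto simp: Int_def conj_assoc intro!: arg_cong2[where f="(/)"] arg_cong[where f=real] arg_cong[where f=card])

text \<open>An invariant statistic has one value on each isomorphism class, so grouping the subsets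
  by class gives a finite linear combination of densities.\<close>

lemma mean_induced_eq_sum_density:
  assumes T: "universal_theory T" and N: "N \<in> fin_models T"
    and F: "\<And>A B. A \<in> fin_models T \<Longrightarrow> B \<in> fin_models T \<Longrightarrow> isomorphic A B \<Longrightarrow> F A = F B"
  shows "mean_induced m F N = (\<Sum>C\<in>classes_of_size T m. F (rep C) * density (rep C) N)"
proof -
  have fin: "finite (verts N)" using N by (simp add: fin_models_def)
  define \<U> where "\<U> = {U. U \<subseteq> verts N \<and> card U = m}"
  have \<U>fin: "finite \<U>" unfolding \<U>_def using fin by simp
  have mod: "induced N U \<in> fin_models T" "card (verts (induced N U)) = m" if "U \<in> \<U>" for U
    using that fin_models_induced[OF T N] by (auto simp: \<U>_def induced_def)
  have "(\<Sum>U\<in>\<U>. F (induced N U))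
      = (\<Sum>C\<in>classes_of_size T m. \<Sum>U | U \<in> \<U> \<and> iso_class T (induced N U) = C. F (induced N U))"
    by (rule sum.group[symmetric])
      (use \<U>fin finite_classes_of_size[OF T] mod in \<open>auto simp: classes_of_size_def\<close>)
  also have "\<dots> = (\<Sum>C\<in>classes_of_size T m. F (rep C) *
      real (card {U. U \<subseteq> verts N \<and> card U = card (verts (rep C)) \<and> isomorphic (induced N U) (rep C)}))"
  proof (rule sum.cong)
    fix C assume "C \<in> classes_of_size T m"
    then obtain M where M: "M \<in> fin_models T" "card (verts M) = m" "C = iso_class T M"
      by (auto simp: classes_of_size_def)
    note r = rep_iso_class[OF M(1), folded M(3)]
    have iff: "iso_class T (induced N U) = C \<longleftrightarrow> isomorphic (induced N U) (rep C)" if "U \<in> \<U>" for U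
      using iso_class_eq_iff[OF mod(1)[OF that] r(1)] r(3) by simp
    have "(\<Sum>U | U \<in> \<U> \<and> iso_class T (induced N U) = C. F (induced N U))
        = real (card {U. U \<in> \<U> \<and> iso_class T (induced N U) = C}) * F (rep C)"
    proof -
      have "(\<Sum>U | U \<in> \<U> \<and> iso_class T (induced N U) = C. F (induced N U))
        = (\<Sum>U | U \<in> \<U> \<and> iso_class T (induced N U) = C. F (rep C))"
    proof (intro sum.cong refl)
      fix U assume "U \<in> {U. U \<in> \<U> \<and> iso_class T (induced N U) = C}"
      then have U: "U \<in> \<U>" "isomorphic (induced N U) (rep C)" using iff by auto
      show "F (induced N U) = F (rep C)" by (rule F[OF mod(1)[OF U(1)] r(1) U(2)])
    qed
    then show ?thesis by simp
    qed
    moreover have "{U. U \<in> \<U> \<and> iso_class T (induced N U) = C}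
        = {U. U \<subseteq> verts N \<and> card U = card (verts (rep C)) \<and> isomorphic (induced N U) (rep C)}"
      using iff isomorphic_card[OF r(2)] M(2) unfolding \<U>_def by auto
    ultimately show "(\<Sum>U | U \<in> \<U> \<and> iso_class T (induced N U) = C. F (induced N U)) = F (rep C) *
      real (card {U. U \<subseteq> verts N \<and> card U = card (verts (rep C)) \<and> isomorphic (induced N U) (rep C)})"
      by (simp only: mult.commute)
  qed simp
  finally have *: "(\<Sum>U\<in>\<U>. F (induced N U)) = \<dots>" .
  have "card (verts (rep C)) = m" if "C \<in> classes_of_size T m" for C
    using that rep_iso_class(2) isomorphic_card unfolding classes_of_size_def by fastforce
  then show ?thesis
    unfolding mean_induced_def \<U>_def[symmetric] * sum_divide_distrib density_def
    by (intro sum.cong) auto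
qed

text \<open>Growth of the sizes and extensionality of \<phi>, which \<open>limit_objects\<close>
  demands as well, are kept apart, so that convergence can be passed to reducts and subsequences on
  its own.\<close>

definition converges_to :: "'p rtheory \<Rightarrow> (nat \<Rightarrow> ('p, nat) rstruct) \<Rightarrow> 'p limit \<Rightarrow> bool" where
  "converges_to T N \<phi> \<longleftrightarrow> (\<forall>n. N n \<in> fin_models T) \<and>
    (\<forall>M\<in>fin_models T. (\<lambda>n. density M (N n)) \<longlonglongrightarrow> \<phi> (iso_class T M))"

text \<open>The sum over classes is finite, so the limit is determined by \<phi>, whichever sequence
  converges to it.\<close>

lemma mean_induced_tendsto:
  assumes T: "universal_theory T" and N: "converges_to T N \<phi>"
    and F: "\<And>A B. A \<in> fin_models T \<Longrightarrow> B \<in> fin_models T \<Longrightarrow> isomorphic A B \<Longrightarrow> F A = F B"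
  shows "(\<lambda>n. mean_induced m F (N n)) \<longlonglongrightarrow> (\<Sum>C\<in>classes_of_size T m. F (rep C) * \<phi> C)"
proof -
  have eq: "mean_induced m F (N n) = (\<Sum>C\<in>classes_of_size T m. F (rep C) * density (rep C) (N n))" for n
    using N by (intro mean_induced_eq_sum_density[OF T _ F]) (auto simp: converges_to_def)
  have "(\<lambda>n. density (rep C) (N n)) \<longlonglongrightarrow> \<phi> C" if C: "C \<in> classes_of_size T m" for C
  proof -
    obtain M where M: "M \<in> fin_models T" "C = iso_class T M"
      using C unfolding classes_of_size_def by blast
    then show ?thesis
      using N rep_iso_class(1,3)[OF M(1)] unfolding converges_to_def by auto
  qed
  then show ?thesis
    unfolding eq by (intro tendsto_sum tendsto_mult tendsto_const)
qed

lemma density_bounds: "finite (verts N) \<Longrightarrow> density M N \<in> {0..1}"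
proof -
  assume fin: "finite (verts N)"
  have "card {U. U \<subseteq> verts N \<and> card U = card (verts M) \<and> isomorphic (induced N U) M}
      \<le> card {U. U \<subseteq> verts N \<and> card U = card (verts M)}"
    using fin by (intro card_mono) auto
  then show ?thesis
    using fin unfolding density_def by (auto simp: n_subsets divide_le_eq_1)
qed

lemma limit_objectsI:
  assumes "converges_to T N \<phi>" "strict_mono (\<lambda>n. card (verts (N n)))" "\<phi> \<in> extensional (iso_classes T)"
  shows "\<phi> \<in> limit_objects T"
proof -
  have "\<phi> C \<in> {0..1}" if C: "C \<in> iso_classes T" for C
  proof -
    obtain M where M: "M \<in> fin_models T" "C = iso_class T M"
      using C by (auto simp: iso_classes_def)
    then have "(\<lambda>n. density M (N n)) \<longlonglongrightarrow> \<phi> C" using assms(1) by (simp add: converges_to_def)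
    moreover have "density M (N n) \<in> {0..1}" for n
      using assms(1) by (intro density_bounds) (simp add: converges_to_def fin_models_def)
    ultimately show ?thesis
      using closed_sequentially[OF closed_atLeastAtMost[of "0::real" 1], of "\<lambda>n. density M (N n)" "\<phi> C"]
      by blast
  qed
  then show ?thesis
    using assms unfolding limit_objects_def converges_to_def
    by (auto simp: PiE_def)
qed

lemma limit_objects_converges:
  assumes "\<phi> \<in> limit_objects T"
  obtains N where "converges_to T N \<phi>" "strict_mono (\<lambda>n. card (verts (N n)))"
  using assms unfolding limit_objects_def converges_to_def by blast

lemma converges_to_lim:
  assumes "\<And>n. N n \<in> fin_models T"
    and "\<And>M. M \<in> fin_models T \<Longrightarrow> convergent (\<lambda>n. density M (N n))"
  shows "converges_to T N (\<lambda>C\<in>iso_classes T. lim (\<lambda>n. density (rep C) (N n)))"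
  unfolding converges_to_def
proof (intro conjI allI ballI assms(1))
  fix M assume M: "M \<in> fin_models T"
  have "density (rep (iso_class T M)) (N n) = density M (N n)" for n
    by (rule density_cong[OF rep_iso_class(2)[OF M], symmetric])
  then show "(\<lambda>n. density M (N n)) \<longlonglongrightarrow>
      (\<lambda>C\<in>iso_classes T. lim (\<lambda>n. density (rep C) (N n))) (iso_class T M)"
    using assms(2)[OF M] M by (simp add: iso_classes_def convergent_LIMSEQ_iff)
qed

text \<open>There are countably many isomorphism classes, so the vectors of densities lie in a
  countable power of the unit interval, which is compact and metrizable, hence sequentially
  compact.\<close>

lemma convergent_subsequence:
  fixes T :: "'p rtheory"
  assumes T: "universal_theory T" and N: "\<And>n. N n \<in> fin_models T"
  obtains r :: "nat \<Rightarrow> nat" and \<phi> where "strict_mono r" "converges_to T (N \<circ> r) \<phi>"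
    "\<phi> \<in> extensional (iso_classes T)"
proof -
  define M where "M i = rep (from_nat_into (iso_classes T) i)" for i
  define x where "x n i = density (M i) (N n)" for n i
  have "compact (PiE UNIV (\<lambda>_ :: nat. {0..1 :: real}))"
    using compactin_PiE[of "\<lambda>_::nat. euclideanreal" UNIV "\<lambda>_. {0..1}"]
    unfolding euclidean_product_topology by simp
  then have "seq_compact (PiE UNIV (\<lambda>_ :: nat. {0..1 :: real}))"
    by (simp add: compact_eq_seq_compact_metric)
  moreover have "x n \<in> PiE UNIV (\<lambda>_ :: nat. {0..1 :: real})" for n
    using density_bounds[of "N n" "M _"] N[of n] unfolding x_def by (simp add: fin_models_def PiE_iff)
  ultimately obtain y r where r: "strict_mono r" "(x \<circ> r) \<longlonglongrightarrow> y"
    unfolding seq_compact_def by metis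
  have y: "(\<lambda>n. density (M i) (N (r n))) \<longlonglongrightarrow> y i" for i
    using continuous_on_tendsto_compose[OF continuous_on_product_coordinates[where i = i] r(2)]
    by (simp add: x_def o_def)
  have conv: "converges_to T (N \<circ> r) (\<lambda>C\<in>iso_classes T. lim (\<lambda>n. density (rep C) ((N \<circ> r) n)))"
  proof (rule converges_to_lim)
    show "(N \<circ> r) n \<in> fin_models T" for n using N by simp
    fix A assume A: "A \<in> fin_models T"
    then have "iso_class T A \<in> iso_classes T" by (simp add: iso_classes_def)
    then obtain i where "from_nat_into (iso_classes T) i = iso_class T A"
      using countable_iso_classes[OF T] from_nat_into_surj by metis
    then have "isomorphic A (M i)" using rep_iso_class(2)[OF A] by (simp add: M_def)
    then have "density A (N (r n)) = density (M i) (N (r n))" for n by (rule density_cong)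
    then show "convergent (\<lambda>n. density A ((N \<circ> r) n))"
      using y[of i] by (auto simp: convergent_def)
  qed
  show ?thesis
    by (rule that[OF r(1) conv]) simp
qed

section \<open>Hypergraphs, reducts and independent couplings\<close>

lemma sat_foldr_Disj: "sat M v (foldr Disj Fs Bot) \<longleftrightarrow> (\<exists>F\<in>set Fs. sat M v F)"
  by (induction Fs) auto

lemma sat_canonical_axiom:
  "sat M v (canonical_axiom P k) \<longleftrightarrow> (map v [0..<k] \<in> rels M P \<longrightarrow> distinct (map v [0..<k]))"
proof -
  have "sat M v (foldr Disj [Eq i j. j \<leftarrow> [0..<k], i \<leftarrow> [0..<j]] Bot) \<longleftrightarrow> (\<exists>j<k. \<exists>i<j. v i = v j)"
  proof -
    have eq: "set [Eq i j. j \<leftarrow> [0..<k], i \<leftarrow> [0..<j]] = (\<lambda>(i, j). Eq i j) ` {(i, j). i < j \<and> j < k}"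
      by auto
    have "sat M v (foldr Disj [Eq i j. j \<leftarrow> [0..<k], i \<leftarrow> [0..<j]] Bot)
        \<longleftrightarrow> (\<exists>p\<in>{(i, j). i < j \<and> j < k}. v (fst p) = v (snd p))"
      unfolding sat_foldr_Disj eq by (simp add: case_prod_unfold)
    then show ?thesis by fastforce
  qed
  also have "\<dots> \<longleftrightarrow> \<not> inj_on v {..<k}"
  proof
    show "\<not> inj_on v {..<k}" if "\<exists>j<k. \<exists>i<j. v i = v j"
      using that by (auto simp: inj_on_def)
    show "\<exists>j<k. \<exists>i<j. v i = v j" if "\<not> inj_on v {..<k}"
    proof (rule ccontr)
      assume none: "\<not> ?thesis"
      have "inj_on v {..<k}"
      proof (rule linorder_inj_onI)
        fix i j assume "i < j" "i \<in> {..<k}" "j \<in> {..<k}"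
        then show "v i \<noteq> v j" using none by blast
      qed auto
      then show False using that by simp
    qed
  qed
  also have "\<dots> \<longleftrightarrow> \<not> distinct (map v [0..<k])"
    by (simp add: distinct_map atLeast0LessThan)
  finally show ?thesis unfolding canonical_axiom_def by auto
qed

lemma over_language_canonical_axiom:
  assumes "P \<in> L" "ar P = k"
  shows "over_language L ar (canonical_axiom P k)"
proof -
  have "over_language L ar (foldr Disj Fs Bot)" if "\<And>F. F \<in> set Fs \<Longrightarrow> over_language L ar F" for Fs
    using that by (induction Fs) auto
  then show ?thesis
    using assms unfolding canonical_axiom_def by (force simp del: foldr_append)
qed

lemma universal_hypergraph_theory: "k \<ge> 1 \<Longrightarrow> universal_theory (hypergraph_theory k)"
  unfolding universal_theory_def hypergraph_theory_def
  by (auto simp: over_language_canonical_axiom)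

text \<open>Edges are distinct lists, so a list of the same length with the same entries is a
  rearrangement and is reached by one of the symmetry axioms. Edges may then be treated as
  sets.\<close>

lemma is_model_hypergraph_iff:
  assumes k: "k \<ge> 1"
  shows "is_model (hypergraph_theory k) M \<longleftrightarrow>
    (\<forall>xs\<in>rels M (). length xs = k \<and> distinct xs \<and> set xs \<subseteq> verts M \<and>
      (\<forall>ys. length ys = k \<longrightarrow> set ys = set xs \<longrightarrow> ys \<in> rels M ()))" (is "_ \<longleftrightarrow> ?R")
proof
  assume M: "is_model (hypergraph_theory k) M"
  show ?R
  proof (intro ballI conjI allI impI)
    fix xs assume xs: "xs \<in> rels M ()"
    with M show len: "length xs = k" and sub: "set xs \<subseteq> verts M"
      by (auto simp: is_model_def is_struct_def hypergraph_theory_def)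
    \<comment> \<open>An assignment must take all its values in \<open>verts M\<close>; the indices
      from \<open>k\<close> on are sent to the first entry of \<open>xs\<close>.\<close>
    define v where "v i = xs ! (if i < k then i else 0)" for i
    have vr: "range v \<subseteq> verts M"
    proof (clarify)
      fix i
      have "(if i < k then i else 0) < length xs" using len k by simp
      then show "v i \<in> verts M" unfolding v_def using nth_mem sub by blast
    qed
    have vm: "map v [0..<k] = xs"
      using len by (intro nth_equalityI) (auto simp: v_def)
    have ax: "sat M v F" if "F \<in> axs (hypergraph_theory k)" for F
      using M vr that unfolding is_model_def by blast
    have "sat M v (canonical_axiom () k)" by (rule ax) (simp add: hypergraph_theory_def)
    then show dist: "distinct xs" using xs vm unfolding sat_canonical_axiom by metis
    fix ys assume ys: "length ys = k" "set ys = set xs"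
    have "card (set ys) = length ys" using ys len distinct_card[OF dist] by simp
    then have "distinct ys" by (rule card_distinct)
    then have "mset ys = mset xs" using dist ys by (simp add: set_eq_iff_mset_eq_distinct)
    then obtain \<sigma> where \<sigma>: "\<sigma> permutes {..<k}" "permute_list \<sigma> xs = ys"
      using mset_eq_permutation[of ys xs] len by auto
    have "sat M v (Imp (Rel () [0..<k]) (Rel () (map \<sigma> [0..<k])))"
      by (rule ax) (use \<sigma>(1) in \<open>auto simp: hypergraph_theory_def\<close>)
    moreover have "map v (map \<sigma> [0..<k]) = ys"
    proof -
      have "v (\<sigma> i) = xs ! \<sigma> i" if "i < k" for i
        using that permutes_in_image[OF \<sigma>(1), of i] by (simp add: v_def)
      then have "map v (map \<sigma> [0..<k]) = map (\<lambda>i. xs ! \<sigma> i) [0..<length xs]"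
        using len by simp
      then show ?thesis using \<sigma>(2) by (simp only: permute_list_def)
    qed
    ultimately show "ys \<in> rels M ()" using xs vm by (simp only: sat.simps)
  qed
next
  assume R: ?R
  show "is_model (hypergraph_theory k) M"
    unfolding is_model_def
  proof (intro conjI allI impI ballI)
    show "is_struct (hypergraph_theory k) M"
      using R unfolding is_struct_def hypergraph_theory_def by (auto simp: unit_all_eq1)
    fix v :: "nat \<Rightarrow> 'a" and F assume F: "F \<in> axs (hypergraph_theory k)"
    have perm: "map v (map \<sigma> [0..<k]) \<in> rels M ()" if "\<sigma> permutes {..<k}" "map v [0..<k] \<in> rels M ()" for \<sigma>
    proof -
      have "set (map v (map \<sigma> [0..<k])) = set (map v [0..<k])"
        using permutes_image[OF that(1)] by (simp add: image_image[symmetric] atLeast0LessThan)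
      moreover have "length (map v (map \<sigma> [0..<k])) = k" by simp
      moreover have "\<forall>ys. length ys = k \<longrightarrow> set ys = set (map v [0..<k]) \<longrightarrow> ys \<in> rels M ()"
        using bspec[OF R that(2)] by (elim conjE)
      ultimately show ?thesis by (elim allE impE)
    qed
    have "sat M v (canonical_axiom () k)"
      unfolding sat_canonical_axiom using R by blast
    moreover have "sat M v (Imp (Rel () [0..<k]) (Rel () (map \<sigma> [0..<k])))" if "\<sigma> permutes {..<k}" for \<sigma>
      unfolding sat.simps by (intro impI perm[OF that])
    ultimately show "sat M v F"
      using F unfolding hypergraph_theory_def by auto
  qed
qed

section \<open>Disjoint unions of theories and reducts of limits\<close>

lemma sat_reductL: "sat M v (map_fm Inl F) = sat (reductL M) v F"
  by (induction F) (auto simp: reductL_def)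

lemma sat_reductR: "sat M v (map_fm Inr F) = sat (reductR M) v F"
  by (induction F) (auto simp: reductR_def)

lemma is_model_disj_union:
  "is_model (disj_union T T') M \<longleftrightarrow> is_model T (reductL M) \<and> is_model T' (reductR M)"
proof -
  have "is_struct (disj_union T T') M \<longleftrightarrow> is_struct T (reductL M) \<and> is_struct T' (reductR M)"
    unfolding is_struct_def disj_union_def reductL_def reductR_def
    by (auto simp: split_sum_all subset_iff)
  moreover have "verts (reductL M) = verts M" "verts (reductR M) = verts M"
    by (simp_all add: reductL_def reductR_def)
  ultimately show ?thesis
    unfolding is_model_def by (auto simp: disj_union_def sat_reductL sat_reductR ball_Un)
qed

lemma over_language_map_fm:
  "over_language L' ar' F \<Longrightarrow> (\<And>P. P \<in> L' \<Longrightarrow> h P \<in> L \<and> ar (h P) = ar' P) \<Longrightarrow> over_language L ar (map_fm h F)"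
  by (induction F) auto

lemma universal_disj_union:
  assumes "universal_theory T" "universal_theory T'"
  shows "universal_theory (disj_union T T')"
  using assms unfolding universal_theory_def disj_union_def
  by (auto intro!: over_language_map_fm[of "preds T" "arity T"] over_language_map_fm[of "preds T'" "arity T'"])

lemma reduct_simps [simp]:
  "verts (reductL M) = verts M" "verts (reductR M) = verts M" "verts (induced N U) = U"
  "reductL (induced M U) = induced (reductL M) U" "reductR (induced M U) = induced (reductR M) U"
  by (simp_all add: reductL_def reductR_def induced_def)

lemma is_iso_reduct: "is_iso f A B \<longleftrightarrow> is_iso f (reductL A) (reductL B) \<and> is_iso f (reductR A) (reductR B)"
  unfolding is_iso_def by (auto simp: reductL_def reductR_def split_sum_all)

lemma isomorphic_reduct:
  assumes "isomorphic A B"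
  shows "isomorphic (reductL A) (reductL B)" "isomorphic (reductR A) (reductR B)"
  using assms is_iso_reduct unfolding isomorphic_def by blast+

lemma fin_models_reduct:
  assumes "M \<in> fin_models (disj_union T T')"
  shows "reductL M \<in> fin_models T" "reductR M \<in> fin_models T'"
  using assms by (auto simp: fin_models_def is_model_disj_union)

text \<open>An abstract reduct map \<open>red\<close> serves both sides. The density of
  \<open>M\<close> in a reduct is the mean of an invariant statistic of the full structure, namely
  whether its reduct is isomorphic to \<open>M\<close>.\<close>

lemma converges_to_reduct:
  fixes red :: "('q, nat) rstruct \<Rightarrow> ('p, nat) rstruct"
  assumes T: "universal_theory T" and T0: "universal_theory T0" and N: "converges_to T N \<xi>"
    and mod: "\<And>A. A \<in> fin_models T \<Longrightarrow> red A \<in> fin_models T0"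
    and vs: "\<And>A. verts (red A) = verts A"
    and ind: "\<And>A U. red (induced A U) = induced (red A) U"
    and iso: "\<And>A B. isomorphic A B \<Longrightarrow> isomorphic (red A) (red B)"
  shows "converges_to T0 (\<lambda>n. red (N n))
    (\<lambda>C\<in>iso_classes T0. \<Sum>D | D \<in> iso_classes T \<and> (\<exists>M\<in>D. red M \<in> C). \<xi> D)"
  unfolding converges_to_def
proof (intro conjI allI ballI)
  have Nmod: "N n \<in> fin_models T" for n using N by (simp add: converges_to_def)
  then show "red (N n) \<in> fin_models T0" for n using mod by blast
  fix M assume M: "M \<in> fin_models T0"
  define F :: "('q, nat) rstruct \<Rightarrow> real" where "F X = of_bool (isomorphic (red X) M)" for X
  have F: "F A = F B" if "isomorphic A B" for A B
  proof -
    note r = iso[OF that]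
    have "isomorphic (red A) M \<longleftrightarrow> isomorphic (red B) M"
      using isomorphic_trans[OF r, of M] isomorphic_trans[OF isomorphic_sym[OF r], of M] by blast
    then show ?thesis by (simp add: F_def)
  qed
  have eq: "density M (red (N n)) = mean_induced (card (verts M)) F (N n)" for n
    using Nmod[of n]
    by (subst density_eq_mean_induced) (simp_all add: fin_models_def vs mean_induced_def F_def ind)
  \<comment> \<open>A class whose reduct is that of \<open>M\<close> has the size of
    \<open>M\<close>, so the sum that defines the reduct of the limit is finite.\<close>
  have set_eq: "{D. D \<in> iso_classes T \<and> (\<exists>A\<in>D. red A \<in> iso_class T0 M)}
    = {D \<in> classes_of_size T (card (verts M)). isomorphic (red (rep D)) M}" (is "?L = ?R")
  proof (intro equalityI subsetI)
    fix D assume "D \<in> ?L"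
    then obtain A B where A: "A \<in> fin_models T" "D = iso_class T A" and B: "B \<in> D" "red B \<in> iso_class T0 M"
      by (auto simp: iso_classes_def)
    then have AB: "isomorphic A B" "isomorphic M (red B)" "B \<in> fin_models T" by (auto simp: iso_class_def)
    then have "card (verts A) = card (verts M)" using isomorphic_card vs by metis
    moreover have "isomorphic (rep D) B"
      using isomorphic_trans[OF isomorphic_sym[OF rep_iso_class(2)[OF A(1)]] AB(1)] A(2) by simp
    then have "isomorphic (red (rep D)) M"
      using isomorphic_trans[OF iso isomorphic_sym[OF AB(2)]] by blast
    ultimately show "D \<in> ?R" using A by (auto simp: classes_of_size_def)
  next
    fix D assume D: "D \<in> ?R"
    then obtain A where A: "A \<in> fin_models T" "D = iso_class T A" by (auto simp: classes_of_size_def)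
    note r = rep_iso_class[OF A(1), folded A(2)]
    have "rep D \<in> D" using r A by (simp add: iso_class_def)
    moreover have "red (rep D) \<in> iso_class T0 M"
      using mod[OF r(1)] D isomorphic_sym by (auto simp: iso_class_def)
    ultimately show "D \<in> ?L" using A by (auto simp: iso_classes_def)
  qed
  have "(\<Sum>D | D \<in> iso_classes T \<and> (\<exists>A\<in>D. red A \<in> iso_class T0 M). \<xi> D)
      = (\<Sum>D\<in>classes_of_size T (card (verts M)). F (rep D) * \<xi> D)"
    unfolding set_eq F_def by (rule sum.mono_neutral_cong_left) (auto simp: finite_classes_of_size[OF T])
  moreover have "(\<lambda>n. density M (red (N n))) \<longlonglongrightarrow> (\<Sum>D\<in>classes_of_size T (card (verts M)). F (rep D) * \<xi> D)"
    unfolding eq by (rule mean_induced_tendsto[OF T N F])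
  ultimately show "(\<lambda>n. density M (red (N n))) \<longlonglongrightarrow> (\<lambda>C\<in>iso_classes T0.
      \<Sum>D | D \<in> iso_classes T \<and> (\<exists>M\<in>D. red M \<in> C). \<xi> D) (iso_class T0 M)"
    using M by (simp add: iso_classes_def)
qed

lemma converges_to_reductL:
  assumes "universal_theory T" "universal_theory T'" "converges_to (disj_union T T') N \<xi>"
  shows "converges_to T (\<lambda>n. reductL (N n)) (limit_reductL T T' \<xi>)"
  unfolding limit_reductL_def
  by (rule converges_to_reduct[OF universal_disj_union])
    (use assms isomorphic_reduct fin_models_reduct in auto)

lemma converges_to_reductR:
  assumes "universal_theory T" "universal_theory T'" "converges_to (disj_union T T') N \<xi>"
  shows "converges_to T' (\<lambda>n. reductR (N n)) (limit_reductR T T' \<xi>)"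
  unfolding limit_reductR_def
  by (rule converges_to_reduct[OF universal_disj_union])
    (use assms isomorphic_reduct fin_models_reduct in auto)

lemma converges_to_unique:
  assumes "converges_to T N \<phi>" "converges_to T N \<psi>"
    "\<phi> \<in> extensional (iso_classes T)" "\<psi> \<in> extensional (iso_classes T)"
  shows "\<phi> = \<psi>"
proof
  fix C show "\<phi> C = \<psi> C"
  proof (cases "C \<in> iso_classes T")
    case True
    then obtain M where M: "M \<in> fin_models T" "C = iso_class T M" by (auto simp: iso_classes_def)
    then show ?thesis
      using assms(1,2) LIMSEQ_unique[of "\<lambda>n. density M (N n)"] unfolding converges_to_def by blast
  next
    case False
    then show ?thesis using assms(3,4) by (simp add: extensional_def)
  qed
qed

section \<open>Independent couplings and automorphism counts\<close>

lemma card_Aut_pos: "finite (verts M) \<Longrightarrow> card (Aut M) > 0"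
proof -
  assume "finite (verts M)"
  then have "finite (Aut M)"
    using finite_permutations[of "verts M"] by (auto simp: Aut_def intro: finite_subset[rotated])
  moreover have "id \<in> Aut M" by (simp add: Aut_def is_iso_id permutes_id)
  ultimately show ?thesis by (auto simp: card_gt_0_iff)
qed

text \<open>\<open>indep_coupling\<close> is evaluated at a chosen representative \<open>A\<close>.
  The limit values are moved back to \<open>M\<close>, whereas the automorphism counts stay at
  \<open>A\<close>, where they are only compared with each other.\<close>

lemma indep_coupling_iso_class:
  assumes M: "M \<in> fin_models (disj_union T T')"
  obtains A where "A \<in> fin_models (disj_union T T')" "isomorphic M A"
    "indep_coupling T \<phi> T' \<psi> (iso_class (disj_union T T') M) =
      real (card (Aut (reductL A))) * real (card (Aut (reductR A)))
        / (real (card (Aut A)) * fact (card (verts A)))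
        * (\<phi> (iso_class T (reductL M)) * \<psi> (iso_class T' (reductR M)))"
proof -
  let ?C = "iso_class (disj_union T T') M"
  let ?A = "rep ?C"
  note r = rep_iso_class[OF M]
  have "iso_class T (reductL ?A) = iso_class T (reductL M)" "iso_class T' (reductR ?A) = iso_class T' (reductR M)"
    using isomorphic_reduct[OF r(2)] fin_models_reduct[OF M] fin_models_reduct[OF r(1)]
    by (simp_all add: iso_class_eq_iff isomorphic_sym)
  moreover have "?C \<in> iso_classes (disj_union T T')" using M by (simp add: iso_classes_def)
  ultimately have "indep_coupling T \<phi> T' \<psi> ?C = fact (card (verts ?A)) / real (card (Aut ?A)) *
    (real (card (Aut (reductL ?A))) / fact (card (verts ?A)) * \<phi> (iso_class T (reductL M)) *
     (real (card (Aut (reductR ?A))) / fact (card (verts ?A)) * \<psi> (iso_class T' (reductR M))))"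
    unfolding indep_coupling_def rep_def[symmetric] labelled_def Let_def by simp
  then show ?thesis using that[OF r(1,2)] by (simp add: field_simps)
qed

lemma indep_coupling_pos:
  assumes M: "M \<in> fin_models (disj_union T T')"
    and "\<phi> (iso_class T (reductL M)) > 0" "\<psi> (iso_class T' (reductR M)) > 0"
  shows "indep_coupling T \<phi> T' \<psi> (iso_class (disj_union T T') M) > 0"
proof -
  obtain A where A: "A \<in> fin_models (disj_union T T')"
    "indep_coupling T \<phi> T' \<psi> (iso_class (disj_union T T') M) =
      real (card (Aut (reductL A))) * real (card (Aut (reductR A)))
        / (real (card (Aut A)) * fact (card (verts A)))
        * (\<phi> (iso_class T (reductL M)) * \<psi> (iso_class T' (reductR M)))"
    using indep_coupling_iso_class[OF M] by metis
  then have "finite (verts A)" by (simp add: fin_models_def)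
  then have "card (Aut A) > 0" "card (Aut (reductL A)) > 0" "card (Aut (reductR A)) > 0"
    by (auto intro: card_Aut_pos)
  then show ?thesis unfolding A(2) using assms(2,3) by simp
qed

lemma complete_hypergraph_cong:
  assumes "isomorphic H H'" "complete_hypergraph l H"
    and H': "is_model (hypergraph_theory l) H'" "l \<ge> 1"
  shows "complete_hypergraph l H'"
proof -
  obtain f where f: "is_iso f H' H" using isomorphic_sym[OF assms(1)] by (auto simp: isomorphic_def)
  have "xs \<in> rels H' ()" if xs: "length xs = l" "distinct xs" "set xs \<subseteq> verts H'" for xs
  proof -
    have "set (map f xs) \<subseteq> verts H" "inj_on f (set xs)"
      using f xs(3) by (auto simp: is_iso_def bij_betw_def intro: inj_on_subset)
    then have "map f xs \<in> rels H ()"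
      using assms(2) xs by (simp add: complete_hypergraph_def distinct_map)
    then show ?thesis using f xs(3) unfolding is_iso_def by blast
  qed
  then show ?thesis
    using H' unfolding complete_hypergraph_def is_model_hypergraph_iff[OF H'(2)] by blast
qed

text \<open>Every permutation of the vertices preserves a complete hypergraph. So the right reduct
  has a factorial number of automorphisms, those of the whole structure are those of the left
  reduct, and the prefactor cancels to 1.\<close>

lemma indep_coupling_complete:
  assumes M: "M \<in> fin_models (disj_union T (hypergraph_theory l))" and l: "l \<ge> 1"
    and comp: "complete_hypergraph l (reductR M)"
  shows "indep_coupling T \<phi> (hypergraph_theory l) \<psi> (iso_class (disj_union T (hypergraph_theory l)) M)
    = \<phi> (iso_class T (reductL M)) * \<psi> (iso_class (hypergraph_theory l) (reductR M))"
proof -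
  obtain A where A: "A \<in> fin_models (disj_union T (hypergraph_theory l))" "isomorphic M A"
    "indep_coupling T \<phi> (hypergraph_theory l) \<psi> (iso_class (disj_union T (hypergraph_theory l)) M) =
      real (card (Aut (reductL A))) * real (card (Aut (reductR A)))
        / (real (card (Aut A)) * fact (card (verts A)))
        * (\<phi> (iso_class T (reductL M)) * \<psi> (iso_class (hypergraph_theory l) (reductR M)))"
    using indep_coupling_iso_class[OF M] by metis
  have fin: "finite (verts A)" using A(1) by (simp add: fin_models_def)
  have "complete_hypergraph l (reductR A)"
    using complete_hypergraph_cong[OF isomorphic_reduct(2)[OF A(2)] comp _ l] fin_models_reduct(2)[OF A(1)]
    by (simp add: fin_models_def)
  then have iso: "is_iso f (reductR A) (reductR A)" if "f permutes verts A" for f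
    using that permutes_inj_on[OF that] permutes_image[OF that]
    unfolding is_iso_def complete_hypergraph_def
    by (auto simp: bij_betw_def distinct_map permutes_in_image subset_iff intro: permutes_inj_on)
  then have "Aut (reductR A) = {f. f permutes verts A}" by (auto simp: Aut_def)
  then have "card (Aut (reductR A)) = fact (card (verts A))"
    using card_permutations[OF refl fin] by simp
  moreover have "Aut A = Aut (reductL A)"
    using iso unfolding Aut_def is_iso_reduct[of _ A] by auto
  ultimately show ?thesis
    unfolding A(3) using card_Aut_pos[OF fin] by simp
qed

section \<open>The pseudorandom hypergraph and its correlations\<close>

definition RG :: "nat \<Rightarrow> nat set set \<Rightarrow> nat set \<Rightarrow> (unit, nat) rstruct" where
  "RG k g V = \<lparr>verts = V, rels = (\<lambda>_. {xs. length xs = k \<and> distinct xs \<and> set xs \<subseteq> V \<and>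
    set xs - {Max (set xs)} \<in> g})\<rparr>"

lemma verts_RG [simp]: "verts (RG k g V) = V"
  by (simp add: RG_def)

lemma induced_RG: "U \<subseteq> V \<Longrightarrow> induced (RG k g V) U = RG k g U"
  by (auto simp: RG_def induced_def)

lemma RG_fin_models:
  assumes "k \<ge> 1" "finite V"
  shows "RG k g V \<in> fin_models (hypergraph_theory k)"
proof -
  have "distinct ys" if "length ys = k" "set ys = set xs" "distinct xs" "length xs = k" for xs ys :: "nat list"
    using that distinct_card[of xs] card_distinct[of ys] by simp
  then show ?thesis
    using assms(2) unfolding fin_models_def
    by (auto simp: is_model_hypergraph_iff[OF assms(1)] RG_def)
qed

section \<open>Ordered tuples, Walsh characters and the correlation bound\<close>

lemma Av_append: "Av V (xs @ ys) f = Av V xs (Av V ys f)"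
  by (induction xs) auto

lemma Av_eq_sum_lists:
  assumes "finite V" "V \<noteq> {}"
  shows "real (card V) ^ m * Av V [0..<m] f w =
    (\<Sum>xs | set xs \<subseteq> V \<and> length xs = m. f (\<lambda>i. if i < m then xs ! i else w i))"
proof (induction m arbitrary: f)
  case 0
  have "{xs. set xs \<subseteq> V \<and> length xs = 0} = {[]}" by auto
  then show ?case by simp
next
  case (Suc m)
  have n: "real (card V) \<noteq> 0" using assms by simp
  let ?L = "\<lambda>m. {xs. set xs \<subseteq> V \<and> length xs = m}"
  have "real (card V) ^ Suc m * Av V [0..<Suc m] f w
      = real (card V) * (real (card V) ^ m * Av V [0..<m] (avg V m f) w)"
    by (simp add: Av_append)
  also have "\<dots> = (\<Sum>xs\<in>?L m. \<Sum>t\<in>V. f ((\<lambda>i. if i < m then xs ! i else w i)(m := t)))"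
    unfolding Suc avg_def sum_distrib_left using n by simp
  also have "\<dots> = (\<Sum>p\<in>?L m \<times> V. f (\<lambda>i. if i < Suc m then (fst p @ [snd p]) ! i else w i))"
    unfolding sum.cartesian_product
    by (intro sum.cong refl) (auto simp: nth_append less_Suc_eq intro!: arg_cong[where f = f])
  also have "\<dots> = (\<Sum>xs\<in>?L (Suc m). f (\<lambda>i. if i < Suc m then xs ! i else w i))"
  proof (rule sum.reindex_bij_witness[of _ "\<lambda>xs. (butlast xs, last xs)" "\<lambda>p. fst p @ [snd p]"])
    fix xs assume xs: "xs \<in> ?L (Suc m)"
    then have ne: "xs \<noteq> []" by auto
    then show "fst (butlast xs, last xs) @ [snd (butlast xs, last xs)] = xs" by simp
    show "(butlast xs, last xs) \<in> ?L m \<times> V"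
      using xs ne last_in_set[OF ne] by (auto dest: in_set_butlastD)
  qed auto
  finally show ?case .
qed

lemma sorted_wrt_map_iff:
  fixes js :: "nat list" and w :: "nat \<Rightarrow> nat"
  assumes "sorted_wrt (<) js"
  shows "sorted_wrt (<) (map w js) \<longleftrightarrow> (\<forall>i\<in>set js. \<forall>j\<in>set js. i < j \<longrightarrow> w i < w j)"
  using assms by (induction js) fastforce+

text \<open>Every \<open>m\<close>-subset has exactly one increasing enumeration. The average then
  runs over all tuples, so coordinates can be handled one at a time.\<close>

lemma sum_subsets_eq_Av:
  fixes V :: "nat set"
  assumes "finite V" "V \<noteq> {}"
  shows "(\<Sum>W | W \<subseteq> V \<and> card W = m. \<Psi> W) = real (card V) ^ m *
    Av V [0..<m] (\<lambda>w. of_bool (sorted_wrt (<) (map w [0..<m])) * \<Psi> (w ` {..<m})) (\<lambda>_. 0)"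
proof -
  let ?L = "{xs. set xs \<subseteq> V \<and> length xs = m}"
  have m: "map (\<lambda>i. if i < m then xs ! i else 0) [0..<m] = xs" if "length xs = m" for xs :: "nat list"
    using that by (intro nth_equalityI) auto
  have m': "(\<lambda>i. if i < m then xs ! i else 0) ` {..<m} = set xs" if "length xs = m" for xs :: "nat list"
    using arg_cong[OF m[OF that], of set] by (simp add: atLeast0LessThan)
  have fin: "finite ?L" using finite_lists_length_eq[OF assms(1)] by simp
  have "real (card V) ^ m * Av V [0..<m] (\<lambda>w. of_bool (sorted_wrt (<) (map w [0..<m])) * \<Psi> (w ` {..<m})) (\<lambda>_. 0)
      = (\<Sum>xs\<in>?L. of_bool (sorted_wrt (<) xs) * \<Psi> (set xs))"
    unfolding Av_eq_sum_lists[OF assms]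
  proof (intro sum.cong refl)
    fix xs assume "xs \<in> ?L"
    then have "length xs = m" by simp
    then show "of_bool (sorted_wrt (<) (map (\<lambda>i. if i < m then xs ! i else 0) [0..<m])) *
        \<Psi> ((\<lambda>i. if i < m then xs ! i else 0) ` {..<m}) = of_bool (sorted_wrt (<) xs) * \<Psi> (set xs)"
      by (simp only: m m')
  qed
  also have "\<dots> = (\<Sum>xs\<in>{xs\<in>?L. sorted_wrt (<) xs}. \<Psi> (set xs))"
    using fin by (intro sum.mono_neutral_cong_right) auto
  also have "\<dots> = (\<Sum>W | W \<subseteq> V \<and> card W = m. \<Psi> W)"
  proof (rule sum.reindex_bij_witness[of _ sorted_list_of_set set])
    fix xs assume "xs \<in> {xs \<in> ?L. sorted_wrt (<) xs}"
    then have xs: "sorted xs" "distinct xs" "set xs \<subseteq> V" "length xs = m" by (auto simp: strict_sorted_iff)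
    then show "sorted_list_of_set (set xs) = xs"
      by (simp add: sorted_list_of_set.idem_if_sorted_distinct)
    show "set xs \<in> {W. W \<subseteq> V \<and> card W = m}" using xs distinct_card by auto
  next
    fix W assume "W \<in> {W. W \<subseteq> V \<and> card W = m}"
    then have W: "W \<subseteq> V" "card W = m" "finite W" using assms(1) finite_subset by auto
    then show "set (sorted_list_of_set W) = W" by simp
    show "sorted_list_of_set W \<in> {xs \<in> ?L. sorted_wrt (<) xs}" using W by simp
  qed simp
  finally show ?thesis by simp
qed

text \<open>Fourier inversion on the cube of subsets of \<open>D\<close>, whose characters are the
  products over \<open>T\<close>.\<close>

lemma Walsh_expansion:
  fixes F :: "'a set \<Rightarrow> real"
  assumes D: "finite D" and P: "P \<subseteq> D"
  defines "\<sigma> \<equiv> (\<lambda>Q B. if B \<in> Q then 1 else -1 :: real)"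
  shows "F P = (\<Sum>T\<in>Pow D. (\<Sum>Q\<in>Pow D. F Q * (\<Prod>B\<in>T. \<sigma> Q B)) / 2 ^ card D * (\<Prod>B\<in>T. \<sigma> P B))"
proof -
  have orth: "(\<Sum>T\<in>Pow D. \<Prod>B\<in>T. \<sigma> Q B * \<sigma> P B) = (if Q = P then 2 ^ card D else 0)" if Q: "Q \<subseteq> D" for Q
  proof -
    \<comment> \<open>The sum over all \<open>T\<close> factorises; if \<open>Q\<close> and
      \<open>P\<close> differ at some \<open>B\<close>, the factor of that \<open>B\<close>
      vanishes.\<close>
    have "(\<Sum>T\<in>Pow D. \<Prod>B\<in>T. \<sigma> Q B * \<sigma> P B) = (\<Prod>B\<in>D. \<sigma> Q B * \<sigma> P B + 1)"
      by (simp add: prod_add[OF D])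
    also have "\<dots> = (if Q = P then 2 ^ card D else 0)"
    proof (cases "Q = P")
      case True
      have "(\<Prod>B\<in>D. \<sigma> Q B * \<sigma> P B + 1) = (\<Prod>B\<in>D. 2)" by (intro prod.cong) (auto simp: \<sigma>_def True)
      then show ?thesis using True by simp
    next
      case False
      then obtain B where "B \<in> D" "B \<in> Q \<longleftrightarrow> B \<notin> P" using Q P by blast
      then have "\<exists>B\<in>D. \<sigma> Q B * \<sigma> P B + 1 = 0" by (intro bexI[of _ B]) (auto simp: \<sigma>_def)
      then show ?thesis using D False by (simp add: prod_zero)
    qed
    finally show ?thesis .
  qed
  have "(\<Sum>T\<in>Pow D. (\<Sum>Q\<in>Pow D. F Q * (\<Prod>B\<in>T. \<sigma> Q B)) / 2 ^ card D * (\<Prod>B\<in>T. \<sigma> P B))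
      = (\<Sum>T\<in>Pow D. \<Sum>Q\<in>Pow D. F Q / 2 ^ card D * (\<Prod>B\<in>T. \<sigma> Q B * \<sigma> P B))"
    by (simp add: sum_divide_distrib sum_distrib_left sum_distrib_right prod.distrib mult_ac)
  also have "\<dots> = (\<Sum>Q\<in>Pow D. F Q / 2 ^ card D * (\<Sum>T\<in>Pow D. \<Prod>B\<in>T. \<sigma> Q B * \<sigma> P B))"
    by (subst sum.swap) (simp add: sum_distrib_left)
  also have "\<dots> = (\<Sum>Q\<in>Pow D. if Q = P then F Q else 0)"
    by (intro sum.cong refl) (auto simp: orth)
  also have "\<dots> = F P" using D P by (simp add: sum.delta)
  finally show ?thesis by simp
qed

text \<open>Either \<open>s\<close> is at most \<epsilon>, or multiplying it by a power of
  \<epsilon> gives at most \<open>s ^ p\<close>. Unlike a root, the resulting bound is linear in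
  \<beta>, so it can be averaged over the subsets \<open>U\<close>.\<close>

lemma le_eps_plus_power:
  fixes s \<epsilon> \<beta> :: real
  assumes "\<epsilon> > 0" "s ^ p \<le> \<beta>" "s \<ge> 0" "p \<ge> 1" 
  shows "s \<le> \<epsilon> + \<beta> / \<epsilon> ^ (p - 1)"
proof (cases "s \<le> \<epsilon>")
  case True
  have "0 \<le> \<beta>" using assms(2,3) zero_le_power[of s p] by linarith
  then show ?thesis using True assms(1) by (simp add: add_increasing2)
next
  case False
  have "s * \<epsilon> ^ (p - 1) \<le> s * s ^ (p - 1)"
    using False assms by (intro mult_left_mono power_mono) auto
  also have "\<dots> = s ^ p" using assms(4) by (metis One_nat_def Suc_pred' power_Suc zero_less_one less_le_trans)
  finally have "s * \<epsilon> ^ (p - 1) \<le> \<beta>" using assms(2) by simp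
  then have "s \<le> \<beta> / \<epsilon> ^ (p - 1)" using assms(1) by (simp add: pos_le_divide_eq)
  then show ?thesis using assms(1) by simp
qed

lemma prod_of_bool: "finite A \<Longrightarrow> (\<Prod>x\<in>A. of_bool (P x) :: real) = of_bool (\<forall>x\<in>A. P x)"
  by (induction A rule: finite_induct) auto

text \<open>The factors are indexed by the set \<open>S\<close> of coordinates on which they depend and by their kind:
  a spin, an edge of \<open>H\<close>, an order comparison. Since no \<open>S\<close> contains \<open>B\<^sub>0\<close>, the factor misses a
  coordinate of \<open>B\<^sub>0\<close>, so only the spin of \<open>B\<^sub>0\<close> itself survives Cauchy--Schwarz. Comparisons
  inside \<open>B\<^sub>0\<close> are part of \<open>ordspin\<close>.\<close>

lemma ordered_correlation_le:
  fixes T H :: "nat set set"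
  assumes U: "finite U" "U \<noteq> {}" and d: "d \<ge> 2" "l < d" and \<epsilon>: "\<epsilon> > 0"
    and T: "T \<subseteq> {B. B \<subseteq> {..<m} \<and> card B = d}" "T \<noteq> {}"
  shows "\<bar>Av U [0..<m] (\<lambda>w. of_bool (sorted_wrt (<) (map w [0..<m])) * ((\<Prod>B\<in>T. spin g (w ` B)) *
      of_bool (\<forall>A. A \<subseteq> {..<m} \<longrightarrow> card A = l \<longrightarrow> w ` A \<in> H))) w0\<bar>
    \<le> \<epsilon> + box d U g / \<epsilon> ^ (2 ^ d - 1)" (is "\<bar>Av U _ ?f w0\<bar> \<le> ?\<delta>")
proof -
  obtain B0 where B0: "B0 \<in> T" using T by auto
  then have B0': "B0 \<subseteq> {..<m}" "card B0 = d" "finite B0" using T finite_subset[of B0 "{..<m}"] by auto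
  define js where "js = filter (\<lambda>i. i \<in> B0) [0..<m]"
  have js: "set js = B0" "distinct js" "sorted_wrt (<) js"
    using B0' by (auto simp: js_def sorted_wrt_filter)
  have len: "length js = d" using distinct_card[OF js(2)] js(1) B0' by simp
  define F where "F w = ordspin g (map w js)" for w
  define \<P> where "\<P> = {S. S \<subseteq> {..<m} \<and> card S = 2 \<and> \<not> S \<subseteq> B0}"
  define \<A> where "\<A> = {A. A \<subseteq> {..<m} \<and> card A = l}"
  \<comment> \<open>The tags keep factors of different kinds apart even if they read the same
    coordinates, as spins and comparisons do for \<open>d = 2\<close>.\<close>
  define K where "K = (T - {B0}) \<times> {0::nat} \<union> (\<A> \<times> {1} \<union> \<P> \<times> {2})"
  define u where "u x w = (if snd x = 0 then spin g (w ` fst x)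
    else if snd x = 1 then of_bool (w ` fst x \<in> H)
    else of_bool (\<forall>i\<in>fst x. \<forall>j\<in>fst x. i < j \<longrightarrow> w i < w j))" for x :: "nat set \<times> nat" and w :: "nat \<Rightarrow> nat"
  have finT: "finite T" using T(1) by (rule finite_subset) auto
  have fin: "finite \<P>" "finite \<A>" "finite (T - {B0})"
    using finT by (auto simp: \<P>_def \<A>_def)
  have finK: "finite K" using fin by (simp add: K_def)
  \<comment> \<open>Other spins have the size of \<open>B0\<close> but differ from it, and edges are
    too small. A pair containing \<open>B0\<close> would be equal to it, as \<open>d\<close> is at
    least 2, and \<P> excludes pairs inside \<open>B0\<close>.\<close>
  have notsub: "\<not> B0 \<subseteq> fst x" if "x \<in> K" for x
  proof
    assume sub: "B0 \<subseteq> fst x"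
    have cases: "fst x \<in> T - {B0} \<or> fst x \<in> \<A> \<or> fst x \<in> \<P>" using that by (auto simp: K_def)
    then have fx: "fst x \<subseteq> {..<m}" using T(1) unfolding \<A>_def \<P>_def by blast
    then have finx: "finite (fst x)" by (rule finite_subset) simp
    then have le: "d \<le> card (fst x)" using card_mono[OF finx sub] B0' by simp
    from cases show False
    proof (elim disjE)
      assume *: "fst x \<in> T - {B0}"
      then have "card (fst x) = card B0" using T(1) B0' by auto
      then have "B0 = fst x" using card_subset_eq[OF finx sub] by simp
      then show False using * by simp
    next
      assume "fst x \<in> \<A>" then show False using le d by (simp add: \<A>_def)
    next
      assume *: "fst x \<in> \<P>"
      then have "card (fst x) = card B0" using le d B0' by (simp add: \<P>_def)
      then have "B0 = fst x" using card_subset_eq[OF finx sub] by simp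
      then show False using * by (simp add: \<P>_def)
    qed
  qed
  define c where "c x = (SOME i. i \<in> B0 - fst x)" for x :: "nat set \<times> nat"
  have c: "c x \<in> B0" "c x \<notin> fst x" if "x \<in> K" for x
    using someI_ex[of "\<lambda>i. i \<in> B0 - fst x"] notsub[OF that] unfolding c_def by auto
  have f_eq: "?f w = F w * (\<Prod>x\<in>K. u x w)" for w
  proof -
    have "(\<Prod>x\<in>K. u x w) = (\<Prod>x\<in>(T - {B0}) \<times> {0}. u x w) * ((\<Prod>x\<in>\<A> \<times> {1}. u x w) * (\<Prod>x\<in>\<P> \<times> {2}. u x w))"
    proof -
      have "((T - {B0}) \<times> {0::nat}) \<inter> (\<A> \<times> {1} \<union> \<P> \<times> {2}) = {}" "(\<A> \<times> {1::nat}) \<inter> (\<P> \<times> {2}) = {}"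
        by auto
      then show ?thesis
        unfolding K_def using fin by (simp add: prod.union_disjoint)
    qed
    also have "(\<Prod>x\<in>(T - {B0}) \<times> {0}. u x w) = (\<Prod>B\<in>T - {B0}. spin g (w ` B))"
      by (simp add: prod.cartesian_product' u_def)
    also have "(\<Prod>x\<in>\<A> \<times> {1}. u x w) = of_bool (\<forall>A\<in>\<A>. w ` A \<in> H)"
      by (simp add: prod.cartesian_product' u_def prod_of_bool fin)
    also have "(\<Prod>x\<in>\<P> \<times> {2}. u x w) = of_bool (\<forall>S\<in>\<P>. \<forall>i\<in>S. \<forall>j\<in>S. i < j \<longrightarrow> w i < w j)"
      by (simp add: prod.cartesian_product' u_def prod_of_bool fin)
    finally have prodK: "(\<Prod>x\<in>K. u x w) = (\<Prod>B\<in>T - {B0}. spin g (w ` B)) *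
      (of_bool (\<forall>A\<in>\<A>. w ` A \<in> H) * of_bool (\<forall>S\<in>\<P>. \<forall>i\<in>S. \<forall>j\<in>S. i < j \<longrightarrow> w i < w j))" .
    have FB: "F w = of_bool (\<forall>i\<in>B0. \<forall>j\<in>B0. i < j \<longrightarrow> w i < w j) * spin g (w ` B0)"
      by (simp add: F_def ordspin_def sorted_wrt_map_iff[OF js(3)] js(1))
    \<comment> \<open>The comparisons are split into those inside \<open>B0\<close>, which
      \<open>F\<close> already contains, and those indexed by \<P>.\<close>
    have incr: "sorted_wrt (<) (map w [0..<m]) \<longleftrightarrow> (\<forall>i\<in>B0. \<forall>j\<in>B0. i < j \<longrightarrow> w i < w j) \<and>
        (\<forall>S\<in>\<P>. \<forall>i\<in>S. \<forall>j\<in>S. i < j \<longrightarrow> w i < w j)" (is "?a \<longleftrightarrow> ?b \<and> ?c")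
    proof -
      have a: "?a \<longleftrightarrow> (\<forall>i<m. \<forall>j<m. i < j \<longrightarrow> w i < w j)"
        by (subst sorted_wrt_map_iff) auto
      show ?thesis
      proof (intro iffI)
        assume ?a
        then have lt: "w i < w j" if "i < j" "j < m" for i j
          unfolding a using that less_trans[OF that] by simp
        have ?b using lt B0'(1) by auto
        moreover have ?c
        proof (intro ballI impI)
          fix S i j assume "S \<in> \<P>" "j \<in> S" "i < j"
          then show "w i < w j" using lt[of i j] by (auto simp: \<P>_def)
        qed
        ultimately show "?b \<and> ?c" ..
      next
        assume bc: "?b \<and> ?c"
        have "w i < w j" if "i < j" "j < m" for i j
        proof (cases "{i, j} \<subseteq> B0")
          case False
          then have "{i, j} \<in> \<P>" using that by (simp add: \<P>_def)
          from bspec[OF conjunct2[OF bc] this] show ?thesis using that(1) by simp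
        next
          case True
          then show ?thesis using bc that(1) by simp
        qed
        then show ?a unfolding a by simp
      qed
    qed
    have T_eq: "(\<Prod>B\<in>T. spin g (w ` B)) = spin g (w ` B0) * (\<Prod>B\<in>T - {B0}. spin g (w ` B))"
      using finT B0 by (rule prod.remove)
    show ?thesis
      unfolding prodK FB incr T_eq \<A>_def by (simp add: of_bool_conj mult_ac)
  qed
  have u1: "\<bar>u x w\<bar> \<le> 1" for x w by (simp add: u_def)
  have indep: "u x (w(c x := t)) = u x w" if "x \<in> K" for x w t
  proof -
    have "(w(c x := t)) i = w i" if "i \<in> fst x" for i using c(2)[OF \<open>x \<in> K\<close>] that by auto
    then have "(w(c x := t)) ` fst x = w ` fst x" 
      "(\<forall>i\<in>fst x. \<forall>j\<in>fst x. i < j \<longrightarrow> (w(c x := t)) i < (w(c x := t)) j) \<longleftrightarrow>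
       (\<forall>i\<in>fst x. \<forall>j\<in>fst x. i < j \<longrightarrow> w i < w j)" by (auto simp del: fun_upd_apply intro: image_cong)
    then show ?thesis unfolding u_def by simp
  qed
  have Box: "Box U js F w = box d U g" for w
    unfolding F_def box_def by (rule Box_map_cong) (use js len in auto)
  have inner: "\<bar>Av U js ?f w\<bar> \<le> ?\<delta>" for w
  proof (rule le_eps_plus_power[OF \<epsilon>])
    have "Av U js ?f w ^ (2 ^ d) \<le> box d U g"
      using Gowers_Cauchy_Schwarz[of js K c u U F w] js(1,2) finK c(1) u1 indep len
      by (simp add: f_eq Box del: fun_upd_apply)
    moreover have "even (2 ^ d :: nat)" using d by simp
    ultimately show "\<bar>Av U js ?f w\<bar> ^ (2 ^ d) \<le> box d U g" by (simp add: power_even_abs)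
  qed auto
  have eq: "Av U [0..<m] ?f w0 = Av U (filter (\<lambda>i. i \<notin> B0) [0..<m]) (Av U js ?f) w0"
    unfolding js_def by (subst Av_partition[where P = "\<lambda>i. i \<in> B0"]) simp
  have "Av U (filter (\<lambda>i. i \<notin> B0) [0..<m]) (Av U js ?f) w0 \<le> Av U (filter (\<lambda>i. i \<notin> B0) [0..<m]) (\<lambda>_. ?\<delta>) w0"
    by (rule Av_mono) (use inner abs_le_D1 in blast)
  moreover have "Av U (filter (\<lambda>i. i \<notin> B0) [0..<m]) (\<lambda>_. - ?\<delta>) w0 \<le> Av U (filter (\<lambda>i. i \<notin> B0) [0..<m]) (Av U js ?f) w0"
    by (rule Av_mono) (use inner in \<open>simp add: abs_le_iff minus_le_iff\<close>)
  ultimately show ?thesis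
    unfolding eq Av_const[OF U] by (simp add: abs_le_iff)
qed

section \<open>Correlation with complete subhypergraphs\<close>

definition dsets :: "nat \<Rightarrow> nat \<Rightarrow> nat set set" where
  "dsets m d = {B. B \<subseteq> {..<m} \<and> card B = d}"

lemma finite_dsets [simp]: "finite (dsets m d)"
  by (simp add: dsets_def)

text \<open>The probability that \<open>RG\<close> over a uniformly random set system, restricted to \<open>card (verts M)\<close>
  points, is isomorphic to \<open>M\<close>.\<close>

definition pat_prob :: "nat \<Rightarrow> (unit, nat) rstruct \<Rightarrow> real" where
  "pat_prob d M = (\<Sum>P\<in>Pow (dsets (card (verts M)) d).
    of_bool (isomorphic (RG (Suc d) P {..<card (verts M)}) M)) / 2 ^ card (dsets (card (verts M)) d)"

text \<open>An increasing map commutes with taking the maximum. Removing the maximum of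
  \<open>d + 1\<close> points leaves \<open>d\<close> of them, so only the pulled-back
  \<open>d\<close>-sets are consulted.\<close>

lemma RG_is_iso_image:
  assumes w: "\<And>i j. i < j \<Longrightarrow> j < m \<Longrightarrow> w i < w j"
  shows "is_iso w (RG (Suc d) {B \<in> dsets m d. w ` B \<in> g} {..<m}) (RG (Suc d) g (w ` {..<m}))"
proof -
  have inj: "inj_on w {..<m}"
    by (rule linorder_inj_onI) (use w in \<open>force+\<close>)
  have "xs \<in> rels (RG (Suc d) {B \<in> dsets m d. w ` B \<in> g} {..<m}) P \<longleftrightarrow>
      map w xs \<in> rels (RG (Suc d) g (w ` {..<m})) P" if xs: "set xs \<subseteq> {..<m}" for xs P
  proof -
    have inj': "inj_on w (set xs)" using inj xs by (rule inj_on_subset)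
    have "set xs - {Max (set xs)} \<in> {B \<in> dsets m d. w ` B \<in> g}
        \<longleftrightarrow> set (map w xs) - {Max (set (map w xs))} \<in> g" if len: "length xs = Suc d" "distinct xs"
    proof -
      have ne: "set xs \<noteq> {}" using len by auto
      have M: "Max (set xs) \<in> set xs" using ne by simp
      have "Max (w ` set xs) = w (Max (set xs))"
      proof (rule Max_eqI)
        fix y assume "y \<in> w ` set xs"
        then obtain x where x: "x \<in> set xs" "y = w x" by auto
        have "Max (set xs) < m" using M xs by auto
        moreover have "x < Max (set xs) \<or> x = Max (set xs)" using Max_ge[OF _ x(1)] by auto
        ultimately show "y \<le> w (Max (set xs))"
          using w[of x "Max (set xs)"] x(2) by auto
      qed (use M in auto)
      then have "set (map w xs) - {Max (set (map w xs))} = w ` (set xs - {Max (set xs)})"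
        using M inj' by (auto dest: inj_onD)
      moreover have "card (set xs - {Max (set xs)}) = d"
        using M len distinct_card[of xs] by simp
      moreover have "set xs - {Max (set xs)} \<subseteq> {..<m}" using xs by auto
      ultimately show ?thesis by (simp add: dsets_def)
    qed
    moreover have "distinct (map w xs) \<longleftrightarrow> distinct xs"
      using inj' by (simp add: distinct_map)
    moreover have "set (map w xs) \<subseteq> w ` {..<m}" using xs by auto
    ultimately show ?thesis using xs unfolding RG_def by (auto simp del: set_map)
  qed
  then show ?thesis unfolding is_iso_def using inj by (simp add: bij_betw_def)
qed

text \<open>With \<open>c\<close> the expected frequency of \<open>M\<close>, this is an
  unnormalized covariance of inducing \<open>M\<close> and of \<open>H\<close> being complete.
  \<open>H\<close> is a plain family of sets, so that it can later range over a finite power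
  set.\<close>

definition hsum :: "nat \<Rightarrow> ('p, nat) rstruct \<Rightarrow> real \<Rightarrow> ('p, nat) rstruct \<Rightarrow> nat set set \<Rightarrow> real" where
  "hsum l M c R H = (\<Sum>W | W \<subseteq> verts R \<and> card W = card (verts M).
    (of_bool (isomorphic (induced R W) M) - c) * of_bool (\<forall>A. A \<subseteq> W \<longrightarrow> card A = l \<longrightarrow> A \<in> H))"

text \<open>On an increasing tuple the induced hypergraph depends only on the pulled-back system of
  \<open>d\<close>-sets. In the Walsh expansion of the indicator of \<open>M\<close> the constant
  coefficient is \<open>pat_prob\<close>, which the centring cancels. Each remaining character is a
  product of spins over a nonempty \<open>T\<close>, with a coefficient of modulus at most
  1.\<close>

lemma hsum_RG_le:
  assumes U: "finite U" "U \<noteq> {}" and d: "d \<ge> 2" "l < d" and \<epsilon>: "\<epsilon> > 0"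
  shows "\<bar>hsum l M (pat_prob d M) (RG (Suc d) g U) H\<bar> \<le> real (card U) ^ card (verts M) *
    (2 ^ card (dsets (card (verts M)) d) * (\<epsilon> + box d U g / \<epsilon> ^ (2 ^ d - 1)))"
proof -
  define m where "m = card (verts M)"
  define D where "D = dsets m d"
  define \<delta> where "\<delta> = \<epsilon> + box d U g / \<epsilon> ^ (2 ^ d - 1)"
  define F where "F Q = (of_bool (isomorphic (RG (Suc d) Q {..<m}) M) :: real)" for Q
  define \<sigma> where "\<sigma> Q B = (if B \<in> Q then 1 else -1 :: real)" for Q and B :: "nat set"
  define coef where "coef T = (\<Sum>Q\<in>Pow D. F Q * (\<Prod>B\<in>T. \<sigma> Q B)) / 2 ^ card D" for T
  define \<Psi> where "\<Psi> W = (of_bool (isomorphic (RG (Suc d) g W) M) - pat_prob d M) *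
    of_bool (\<forall>A. A \<subseteq> W \<longrightarrow> card A = l \<longrightarrow> A \<in> H)" for W
  define f where "f T w = of_bool (sorted_wrt (<) (map w [0..<m])) * ((\<Prod>B\<in>T. spin g (w ` B)) *
      of_bool (\<forall>A. A \<subseteq> {..<m} \<longrightarrow> card A = l \<longrightarrow> w ` A \<in> H))" for T and w :: "nat \<Rightarrow> nat"
  have finD: "finite D" by (simp add: D_def)
  have coef0: "coef {} = pat_prob d M" by (simp add: coef_def pat_prob_def F_def D_def m_def)
  have coef1: "\<bar>coef T\<bar> \<le> 1" for T
  proof -
    have "\<bar>F Q * (\<Prod>B\<in>T. \<sigma> Q B)\<bar> \<le> 1" for Q
      unfolding abs_mult abs_prod by (intro mult_le_one prod_le_1) (auto simp: F_def \<sigma>_def intro: prod_nonneg)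
    then have "\<bar>\<Sum>Q\<in>Pow D. F Q * (\<Prod>B\<in>T. \<sigma> Q B)\<bar> \<le> (\<Sum>Q\<in>Pow D. 1)"
      by (intro order_trans[OF sum_abs] sum_mono)
    then show ?thesis using finD by (simp add: coef_def card_Pow)
  qed
  have pointwise: "of_bool (sorted_wrt (<) (map w [0..<m])) * \<Psi> (w ` {..<m})
      = (\<Sum>T\<in>Pow D - {{}}. coef T * f T w)" for w
  proof (cases "sorted_wrt (<) (map w [0..<m])")
    case True
    then have lt: "w i < w j" if "i < j" "j < m" for i j
      using that by (subst (asm) sorted_wrt_map_iff) auto
    have inj: "inj_on w {..<m}"
      by (rule linorder_inj_onI) (use lt in \<open>force+\<close>)
    define P where "P = {B \<in> D. w ` B \<in> g}"
    have iso: "isomorphic (RG (Suc d) P {..<m}) (RG (Suc d) g (w ` {..<m}))"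
      using RG_is_iso_image[of m w d g, OF lt] unfolding P_def D_def isomorphic_def by blast
    have "isomorphic (RG (Suc d) g (w ` {..<m})) M \<longleftrightarrow> isomorphic (RG (Suc d) P {..<m}) M"
      using isomorphic_trans[OF iso, of M] isomorphic_trans[OF isomorphic_sym[OF iso], of M] by blast
    then have 1: "of_bool (isomorphic (RG (Suc d) g (w ` {..<m})) M) = F P" by (simp add: F_def)
    have "F P = (\<Sum>T\<in>Pow D. coef T * (\<Prod>B\<in>T. \<sigma> P B))"
      unfolding coef_def \<sigma>_def by (rule Walsh_expansion[OF finD]) (auto simp: P_def)
    also have "\<dots> = coef {} + (\<Sum>T\<in>Pow D - {{}}. coef T * (\<Prod>B\<in>T. \<sigma> P B))"
      using finD by (subst sum.remove[of _ "{}"]) auto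
    also have "(\<Sum>T\<in>Pow D - {{}}. coef T * (\<Prod>B\<in>T. \<sigma> P B))
        = (\<Sum>T\<in>Pow D - {{}}. coef T * (\<Prod>B\<in>T. spin g (w ` B)))"
      by (intro sum.cong arg_cong2[where f = "(*)"] prod.cong) (auto simp: \<sigma>_def spin_def P_def)
    finally have 2: "F P - pat_prob d M = (\<Sum>T\<in>Pow D - {{}}. coef T * (\<Prod>B\<in>T. spin g (w ` B)))"
      by (simp add: coef0)
    \<comment> \<open>Expressed in the coordinates, completeness of \<open>H\<close> becomes a
      product of factors that read only \<open>l\<close> coordinates each.\<close>
    have 3: "(\<forall>A. A \<subseteq> w ` {..<m} \<longrightarrow> card A = l \<longrightarrow> A \<in> H) \<longleftrightarrow>
        (\<forall>A. A \<subseteq> {..<m} \<longrightarrow> card A = l \<longrightarrow> w ` A \<in> H)"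
      using card_image[OF inj_on_subset[OF inj]] by (auto simp: subset_image_iff image_mono)
    show ?thesis
      unfolding \<Psi>_def 1 2 3 f_def using True by (simp add: sum_distrib_right mult_ac)
  qed (simp add: f_def)
  have ind: "induced (RG (Suc d) g U) W = RG (Suc d) g W" if "W \<subseteq> U" for W
    by (rule induced_RG[OF that])
  have "hsum l M (pat_prob d M) (RG (Suc d) g U) H = (\<Sum>W | W \<subseteq> U \<and> card W = m. \<Psi> W)"
    unfolding hsum_def \<Psi>_def m_def by (intro sum.cong) (auto simp: ind)
  also have "\<dots> = real (card U) ^ m * (\<Sum>T\<in>Pow D - {{}}. coef T * Av U [0..<m] (f T) (\<lambda>_. 0))"
    unfolding sum_subsets_eq_Av[OF U] pointwise by (simp only: Av_sum Av_cmult)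
  finally have eq: "hsum l M (pat_prob d M) (RG (Suc d) g U) H
      = real (card U) ^ m * (\<Sum>T\<in>Pow D - {{}}. coef T * Av U [0..<m] (f T) (\<lambda>_. 0))" .
  have term_le: "\<bar>coef T * Av U [0..<m] (f T) (\<lambda>_. 0)\<bar> \<le> \<delta>" if T: "T \<in> Pow D - {{}}" for T
  proof -
    have "\<bar>Av U [0..<m] (f T) (\<lambda>_. 0)\<bar> \<le> \<delta>"
      unfolding f_def \<delta>_def
      by (rule ordered_correlation_le[OF U d \<epsilon>]) (use T in \<open>auto simp: D_def dsets_def\<close>)
    then have "\<bar>coef T\<bar> * \<bar>Av U [0..<m] (f T) (\<lambda>_. 0)\<bar> \<le> 1 * \<delta>"
      using coef1 by (intro mult_mono) auto
    then show ?thesis by (simp add: abs_mult)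
  qed
  have \<delta>0: "\<delta> \<ge> 0" unfolding \<delta>_def using \<epsilon> d box_nonneg[of d U g] by simp
  have "\<bar>\<Sum>T\<in>Pow D - {{}}. coef T * Av U [0..<m] (f T) (\<lambda>_. 0)\<bar> \<le> (\<Sum>T\<in>Pow D - {{}}. \<delta>)"
    by (intro order_trans[OF sum_abs] sum_mono term_le)
  also have "\<dots> \<le> (\<Sum>T\<in>Pow D. \<delta>)"
    by (intro sum_mono2) (use finD \<delta>0 in auto)
  also have "\<dots> = 2 ^ card D * \<delta>" using finD by (simp add: card_Pow)
  finally have "\<bar>\<Sum>T\<in>Pow D - {{}}. coef T * Av U [0..<m] (f T) (\<lambda>_. 0)\<bar> \<le> 2 ^ card D * \<delta>" .
  then show ?thesis
    unfolding eq m_def[symmetric] D_def[symmetric] \<delta>_def[symmetric] abs_mult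
    by (simp add: mult_left_mono)
qed

text \<open>Being invariant under isomorphism, \<open>eta\<close> has a mean over induced substructures that depends, in
  the limit, only on the limit object. This carries the estimate for the pseudorandom hypergraphs
  over to every sequence with the same limit.\<close>

definition eta :: "nat \<Rightarrow> ('p, nat) rstruct \<Rightarrow> real \<Rightarrow> ('p, nat) rstruct \<Rightarrow> real" where
  "eta l M c R = Max ((\<lambda>H. \<bar>hsum l M c R H\<bar>) ` Pow (Pow (verts R)))
    / real (card (verts R) choose card (verts M))"

lemma hsum_le_eta:
  assumes "finite (verts R)" "H \<subseteq> Pow (verts R)"
  shows "\<bar>hsum l M c R H\<bar> / real (card (verts R) choose card (verts M)) \<le> eta l M c R"
  unfolding eta_def using assms by (intro divide_right_mono Max_ge) auto

lemma etaI:
  assumes "finite (verts R)" "\<And>H. H \<subseteq> Pow (verts R) \<Longrightarrow>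
    \<bar>hsum l M c R H\<bar> / real (card (verts R) choose card (verts M)) \<le> b"
  shows "eta l M c R \<le> b"
proof -
  have "Max ((\<lambda>H. \<bar>hsum l M c R H\<bar>) ` Pow (Pow (verts R))) \<in> (\<lambda>H. \<bar>hsum l M c R H\<bar>) ` Pow (Pow (verts R))"
    using assms(1) by (intro Max_in) auto
  then show ?thesis using assms(2) unfolding eta_def by auto
qed

lemma is_iso_induced:
  assumes f: "is_iso f A B" and W: "W \<subseteq> verts A"
  shows "is_iso f (induced A W) (induced B (f ` W))"
proof -
  have "inj_on f W" using f W by (auto simp: is_iso_def bij_betw_def intro: inj_on_subset)
  moreover have "xs \<in> rels A P \<longleftrightarrow> map f xs \<in> rels B P" if "set xs \<subseteq> W" for xs P
    using f W that unfolding is_iso_def by (meson subset_trans)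
  ultimately show ?thesis
    unfolding is_iso_def by (auto simp: induced_def bij_betw_def)
qed

lemma hsum_iso:
  assumes f: "is_iso f A B" and fin: "finite (verts A)" and H: "H \<subseteq> Pow (verts A)"
  shows "hsum l M c A H = hsum l M c B ((`) f ` H)"
proof -
  have inj: "inj_on f (verts A)" and img: "f ` verts A = verts B"
    using f by (auto simp: is_iso_def bij_betw_def)
  have injP: "inj_on ((`) f) (Pow (verts A))" using inj by (rule inj_on_image_Pow)
  let ?S = "\<lambda>V. {W. W \<subseteq> V \<and> card W = card (verts M)}"
  have "hsum l M c B ((`) f ` H) = (\<Sum>W\<in>?S (verts A).
      (of_bool (isomorphic (induced B (f ` W)) M) - c) *
      of_bool (\<forall>A. A \<subseteq> f ` W \<longrightarrow> card A = l \<longrightarrow> A \<in> (`) f ` H))"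
    unfolding hsum_def
  proof (rule sum.reindex_bij_betw[symmetric])
    show "bij_betw ((`) f) (?S (verts A)) (?S (verts B))"
      unfolding bij_betw_def
    proof
      show "inj_on ((`) f) (?S (verts A))" by (rule inj_on_subset[OF injP]) auto
      show "(`) f ` ?S (verts A) = ?S (verts B)"
        unfolding img[symmetric] using card_image[OF inj_on_subset[OF inj]]
        by (auto simp: subset_image_iff image_iff)
    qed
  qed
  also have "\<dots> = hsum l M c A H"
    unfolding hsum_def
  proof (intro sum.cong refl)
    fix W assume "W \<in> ?S (verts A)"
    then have W: "W \<subseteq> verts A" by simp
    have iso: "isomorphic (induced A W) (induced B (f ` W))"
      using is_iso_induced[OF f W] unfolding isomorphic_def by blast
    have 1: "isomorphic (induced B (f ` W)) M \<longleftrightarrow> isomorphic (induced A W) M"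
      using isomorphic_trans[OF iso, of M] isomorphic_trans[OF isomorphic_sym[OF iso], of M] by blast
    have mem: "f ` X \<in> (`) f ` H \<longleftrightarrow> X \<in> H" "card (f ` X) = card X" if "X \<subseteq> W" for X
      using inj_on_image_mem_iff[OF injP, of X H] H W that card_image[OF inj_on_subset[OF inj, of X]] by auto
    have 2: "(\<forall>A. A \<subseteq> f ` W \<longrightarrow> card A = l \<longrightarrow> A \<in> (`) f ` H) \<longleftrightarrow> (\<forall>A. A \<subseteq> W \<longrightarrow> card A = l \<longrightarrow> A \<in> H)"
      (is "?l \<longleftrightarrow> ?r")
    proof
      assume ?l
      then show ?r using mem by (metis image_mono)
    next
      assume r: ?r
      show ?l
      proof (intro allI impI)
        fix Y assume "Y \<subseteq> f ` W" "card Y = l"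
        then obtain X where "X \<subseteq> W" "Y = f ` X" by (auto simp: subset_image_iff)
        then show "Y \<in> (`) f ` H" using r mem \<open>card Y = l\<close> by metis
      qed
    qed
    show "(of_bool (isomorphic (induced B (f ` W)) M) - c) *
        of_bool (\<forall>A. A \<subseteq> f ` W \<longrightarrow> card A = l \<longrightarrow> A \<in> (`) f ` H)
      = (of_bool (isomorphic (induced A W) M) - c) * of_bool (\<forall>A. A \<subseteq> W \<longrightarrow> card A = l \<longrightarrow> A \<in> H)"
      unfolding 1 2 ..
  qed
  finally show ?thesis by simp
qed

text \<open>The image of \<open>H\<close> under \<open>f\<close> is a competitor in the maximum for
  \<open>B\<close>. The inverse isomorphism gives the reverse inequality.\<close>

lemma eta_iso_le:
  assumes "is_iso f A B" "finite (verts A)"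
  shows "eta l M c A \<le> eta l M c B"
proof (rule etaI[OF assms(2)])
  fix H assume H: "H \<subseteq> Pow (verts A)"
  have b: "bij_betw f (verts A) (verts B)" using assms(1) by (simp add: is_iso_def)
  have "(`) f ` H \<subseteq> Pow (verts B)" "finite (verts B)" "card (verts B) = card (verts A)"
    using b H assms(2) bij_betw_same_card[OF b] bij_betw_finite[OF b] by (auto simp: bij_betw_def)
  then show "\<bar>hsum l M c A H\<bar> / real (card (verts A) choose card (verts M)) \<le> eta l M c B"
    using hsum_le_eta[of B "(`) f ` H" l M c] hsum_iso[OF assms H, of l M c] by simp
qed

lemma eta_cong:
  assumes "isomorphic A B" "finite (verts A)" "finite (verts B)"
  shows "eta l M c A = eta l M c B"
proof -
  obtain f h where "is_iso f A B" "is_iso h B A"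
    using assms(1) isomorphic_sym[OF assms(1)] by (auto simp: isomorphic_def)
  then show ?thesis using eta_iso_le assms(2,3) by (intro antisym) blast+
qed

text \<open>Double counting: the binomial coefficient is the number of ways to extend an
  \<open>m\<close>-subset to an \<open>n\<close>-subset.\<close>

lemma sum_subsets_of_subsets:
  fixes \<Psi> :: "'a set \<Rightarrow> real"
  assumes V: "finite V" and mn: "m \<le> n"
  shows "(\<Sum>U | U \<subseteq> V \<and> card U = n. \<Sum>W | W \<subseteq> U \<and> card W = m. \<Psi> W)
    = real ((card V - m) choose (n - m)) * (\<Sum>W | W \<subseteq> V \<and> card W = m. \<Psi> W)"
proof -
  let ?S = "\<lambda>n. {U. U \<subseteq> V \<and> card U = n}"
  have fin: "finite (?S n)" for n using V by simp
  have inner: "(\<Sum>W | W \<subseteq> U \<and> card W = m. \<Psi> W) = (\<Sum>W\<in>?S m. if W \<subseteq> U then \<Psi> W else 0)" if "U \<in> ?S n" for U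
    using that by (intro sum.mono_neutral_cong_left) (use V in auto)
  have count: "card {U \<in> ?S n. W \<subseteq> U} = (card V - m) choose (n - m)" if W: "W \<in> ?S m" for W
  proof -
    have finW: "finite W" using W V finite_subset by auto
    have "bij_betw (\<lambda>X. W \<union> X) {X. X \<subseteq> V - W \<and> card X = n - m} {U \<in> ?S n. W \<subseteq> U}"
    proof (rule bij_betwI[where g = "\<lambda>U. U - W"])
      show "(\<lambda>X. W \<union> X) \<in> {X. X \<subseteq> V - W \<and> card X = n - m} \<rightarrow> {U \<in> ?S n. W \<subseteq> U}"
      proof
        fix X assume X: "X \<in> {X. X \<subseteq> V - W \<and> card X = n - m}"
        then have "card (W \<union> X) = card W + card X"
          using finW V by (intro card_Un_disjoint) (auto intro: finite_subset)
        then show "W \<union> X \<in> {U \<in> ?S n. W \<subseteq> U}" using X W mn by auto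
      qed
      show "(\<lambda>U. U - W) \<in> {U \<in> ?S n. W \<subseteq> U} \<rightarrow> {X. X \<subseteq> V - W \<and> card X = n - m}"
        using W finW by (auto simp: card_Diff_subset)
    qed auto
    then have "card {U \<in> ?S n. W \<subseteq> U} = card {X. X \<subseteq> V - W \<and> card X = n - m}"
      by (rule bij_betw_same_card[symmetric])
    also have "\<dots> = (card V - m) choose (n - m)"
      using V W finW by (simp add: n_subsets card_Diff_subset)
    finally show ?thesis .
  qed
  have "(\<Sum>U\<in>?S n. \<Sum>W | W \<subseteq> U \<and> card W = m. \<Psi> W) = (\<Sum>U\<in>?S n. \<Sum>W\<in>?S m. if W \<subseteq> U then \<Psi> W else 0)"
    by (intro sum.cong refl inner)
  also have "\<dots> = (\<Sum>W\<in>?S m. \<Sum>U\<in>?S n. if W \<subseteq> U then \<Psi> W else 0)" by (rule sum.swap)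
  also have "\<dots> = (\<Sum>W\<in>?S m. real ((card V - m) choose (n - m)) * \<Psi> W)"
  proof (intro sum.cong refl)
    fix W assume W: "W \<in> ?S m"
    have "(\<Sum>U\<in>?S n. if W \<subseteq> U then \<Psi> W else 0) = (\<Sum>U\<in>{U \<in> ?S n. W \<subseteq> U}. \<Psi> W)"
      using fin by (intro sum.mono_neutral_cong_right) auto
    then show "(\<Sum>U\<in>?S n. if W \<subseteq> U then \<Psi> W else 0) = real ((card V - m) choose (n - m)) * \<Psi> W"
      by (simp only: sum_constant count[OF W])
  qed
  finally show ?thesis by (simp add: sum_distrib_left)
qed

text \<open>Averaging over the \<open>n\<close>-subsets \<open>U\<close> counts every
  \<open>W\<close> equally often, and on each \<open>U\<close> the trace
  \<open>H \<inter> Pow U\<close> is a competitor in the maximum. An arbitrary global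
  \<open>H\<close> is thereby controlled by a statistic of \<open>n\<close>-point subsets.\<close>

lemma hsum_le_mean_eta:
  assumes R: "finite (verts R)" and mn: "card (verts M) \<le> n" "n \<le> card (verts R)"
  shows "\<bar>hsum l M c R H\<bar> / real (card (verts R) choose card (verts M)) \<le> mean_induced n (eta l M c) R"
proof -
  define N where "N = card (verts R)"
  define m where "m = card (verts M)"
  define \<Psi> where "\<Psi> W = (of_bool (isomorphic (induced R W) M) - c) *
    of_bool (\<forall>A. A \<subseteq> W \<longrightarrow> card A = l \<longrightarrow> A \<in> H)" for W
  let ?S = "{U. U \<subseteq> verts R \<and> card U = n}"
  have sub: "hsum l M c (induced R U) (H \<inter> Pow U) = (\<Sum>W | W \<subseteq> U \<and> card W = m. \<Psi> W)" for U
  proof -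
    have "induced (induced R U) W = induced R W" if "W \<subseteq> U" for W
      using that by (auto simp: induced_def)
    moreover have "(\<forall>A. A \<subseteq> W \<longrightarrow> card A = l \<longrightarrow> A \<in> H \<inter> Pow U) \<longleftrightarrow> (\<forall>A. A \<subseteq> W \<longrightarrow> card A = l \<longrightarrow> A \<in> H)"
      if "W \<subseteq> U" for W using that by blast
    ultimately show ?thesis
      unfolding hsum_def \<Psi>_def m_def by (intro sum.cong) auto
  qed
  have pos: "real (N choose m) > 0" "real (N choose n) > 0" "real (n choose m) > 0"
    "real ((N - m) choose (n - m)) > 0"
    using mn by (simp_all add: N_def m_def)
  have "real ((N - m) choose (n - m)) * \<bar>hsum l M c R H\<bar>
      = \<bar>real ((N - m) choose (n - m)) * (\<Sum>W | W \<subseteq> verts R \<and> card W = m. \<Psi> W)\<bar>"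
    unfolding hsum_def \<Psi>_def m_def by (simp add: abs_mult)
  also have "\<dots> = \<bar>\<Sum>U\<in>?S. hsum l M c (induced R U) (H \<inter> Pow U)\<bar>"
    unfolding sub using sum_subsets_of_subsets[OF R, of m n \<Psi>] mn(1) by (simp add: N_def m_def)
  also have "\<dots> \<le> (\<Sum>U\<in>?S. real (n choose m) * eta l M c (induced R U))"
  proof (intro order_trans[OF sum_abs] sum_mono)
    fix U assume "U \<in> ?S"
    then have "finite (verts (induced R U))" "card (verts (induced R U)) = n"
      using R finite_subset by auto
    then show "\<bar>hsum l M c (induced R U) (H \<inter> Pow U)\<bar> \<le> real (n choose m) * eta l M c (induced R U)"
      using hsum_le_eta[of "induced R U" "H \<inter> Pow U" l M c] pos(3)
      by (simp add: m_def pos_divide_le_eq mult.commute)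
  qed
  also have "\<dots> = real (n choose m) * (real (N choose n) * mean_induced n (eta l M c) R)"
    using pos(2) unfolding mean_induced_def sum_distrib_left[symmetric] by (simp add: N_def)
  also have "\<dots> = real ((N choose n) * (n choose m)) * mean_induced n (eta l M c) R" by simp
  \<comment> \<open>Chains of an \<open>m\<close>-set inside an \<open>n\<close>-set are counted in
    both orders; this cancels the multiplicity with which each \<open>m\<close>-set was
    summed.\<close>
  also have "(N choose n) * (n choose m) = (N choose m) * ((N - m) choose (n - m))"
    using mn by (simp add: choose_mult N_def m_def)
  finally have "real ((N - m) choose (n - m)) * \<bar>hsum l M c R H\<bar>
      \<le> real ((N - m) choose (n - m)) * (real (N choose m) * mean_induced n (eta l M c) R)"
    by (simp add: mult_ac)
  then have "\<bar>hsum l M c R H\<bar> \<le> real (N choose m) * mean_induced n (eta l M c) R"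
    using pos(4) by simp
  then show ?thesis
    using pos(1) by (simp add: N_def m_def pos_divide_le_eq mult.commute)
qed

text \<open>With \<open>m = card (verts M)\<close>, the factor \<open>m ^ m\<close> is the price of
  passing from ordered tuples to subsets: \<open>n ^ m \<le> m ^ m * (n choose m)\<close>.\<close>

lemma eta_RG_le:
  assumes U: "finite U" "U \<noteq> {}" "card (verts M) \<le> card U" and d: "d \<ge> 2" "l < d" and \<epsilon>: "\<epsilon> > 0"
  shows "eta l M (pat_prob d M) (RG (Suc d) g U) \<le> real (card (verts M)) ^ card (verts M) *
    2 ^ card (dsets (card (verts M)) d) * (\<epsilon> + box d U g / \<epsilon> ^ (2 ^ d - 1))"
proof (rule etaI)
  let ?m = "card (verts M)" and ?n = "card U"
  let ?X = "2 ^ card (dsets ?m d) * (\<epsilon> + box d U g / \<epsilon> ^ (2 ^ d - 1))"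
  fix H
  have X0: "?X \<ge> 0" using \<epsilon> d box_nonneg[of d U g] by simp
  have ch: "real (?n choose ?m) > 0" using U by simp
  have "(real ?n / real ?m) ^ ?m \<le> real (?n choose ?m)"
    by (rule binomial_ge_n_over_k_pow_k[OF U(3)])
  then have "real ?n ^ ?m \<le> real ?m ^ ?m * real (?n choose ?m)"
    by (cases "?m = 0") (simp_all add: power_divide pos_divide_le_eq mult.commute)
  then have "real ?n ^ ?m * ?X \<le> real ?m ^ ?m * real (?n choose ?m) * ?X"
    using X0 by (rule mult_right_mono)
  then have "\<bar>hsum l M (pat_prob d M) (RG (Suc d) g U) H\<bar> \<le> real ?m ^ ?m * real (?n choose ?m) * ?X"
    using hsum_RG_le[OF U(1,2) d \<epsilon>, of M g H] by linarith
  then show "\<bar>hsum l M (pat_prob d M) (RG (Suc d) g U) H\<bar> / real (card (verts (RG (Suc d) g U)) choose ?m)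
      \<le> real ?m ^ ?m * 2 ^ card (dsets ?m d) * (\<epsilon> + box d U g / \<epsilon> ^ (2 ^ d - 1))"
    using ch by (simp add: pos_divide_le_eq mult_ac)
qed (use U in simp)

section \<open>The limit object\<close>

definition pseudorandom :: "nat \<Rightarrow> nat \<Rightarrow> nat set set" where
  "pseudorandom d J = (SOME g. \<forall>j\<le>J.
    (\<Sum>U | U \<subseteq> {..<4 ^ J} \<and> card U = 4 ^ j. box d U g) / real (4 ^ J choose 4 ^ j) \<le> 2 * (real d)\<^sup>2 / 2 ^ j)"

definition RGseq :: "nat \<Rightarrow> nat \<Rightarrow> (unit, nat) rstruct" where
  "RGseq d J = RG (Suc d) (pseudorandom d J) {..<4 ^ J}"

lemma mean_box_pseudorandom:
  assumes "d \<ge> 1" "j \<le> J"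
  shows "(\<Sum>U | U \<subseteq> {..<4 ^ J} \<and> card U = 4 ^ j. box d U (pseudorandom d J)) / real (4 ^ J choose 4 ^ j)
    \<le> 2 * (real d)\<^sup>2 / 2 ^ j"
  using someI_ex[OF exists_pseudorandom[OF assms(1)], of J] assms(2)
  unfolding pseudorandom_def[symmetric] by blast

lemma verts_RGseq [simp]: "verts (RGseq d J) = {..<4 ^ J}"
  by (simp add: RGseq_def)

lemma RGseq_fin_models: "RGseq d J \<in> fin_models (hypergraph_theory (Suc d))"
  unfolding RGseq_def by (rule RG_fin_models) auto

text \<open>The bound for a single \<open>U\<close> is linear in its box, so it survives averaging
  over \<open>U\<close>, and the mean box at size \<open>4 ^ j\<close> is bounded independently of
  \<open>J\<close>.\<close>

lemma mean_eta_RGseq_le: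
  assumes d: "d \<ge> 2" "l < d" and \<epsilon>: "\<epsilon> > 0" and j: "j \<le> J" "card (verts M) \<le> 4 ^ j"
  shows "mean_induced (4 ^ j) (eta l M (pat_prob d M)) (RGseq d J)
    \<le> real (card (verts M)) ^ card (verts M) * 2 ^ card (dsets (card (verts M)) d)
      * (\<epsilon> + 2 * (real d)\<^sup>2 / 2 ^ j / \<epsilon> ^ (2 ^ d - 1))"
proof -
  define K where "K = real (card (verts M)) ^ card (verts M) * 2 ^ card (dsets (card (verts M)) d)"
  let ?S = "{U. U \<subseteq> {..<4 ^ J :: nat} \<and> card U = 4 ^ j}"
  let ?g = "pseudorandom d J"
  let ?p = "\<epsilon> ^ (2 ^ d - 1)"
  have ch: "real (4 ^ J choose 4 ^ j) > 0" using j by (simp add: power_increasing)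
  have cardS: "real (card ?S) = real (4 ^ J choose 4 ^ j)" by (simp add: n_subsets)
  have "mean_induced (4 ^ j) (eta l M (pat_prob d M)) (RGseq d J)
      = (\<Sum>U\<in>?S. eta l M (pat_prob d M) (RG (Suc d) ?g U)) / real (4 ^ J choose 4 ^ j)"
    unfolding mean_induced_def by (auto simp: RGseq_def induced_RG intro!: arg_cong2[where f = "(/)"] sum.cong)
  also have "\<dots> \<le> (\<Sum>U\<in>?S. K * (\<epsilon> + box d U ?g / ?p)) / real (4 ^ J choose 4 ^ j)"
  proof (intro divide_right_mono sum_mono)
    fix U assume "U \<in> ?S"
    then have "finite U" "U \<noteq> {}" "card U = 4 ^ j" by (auto intro: finite_subset)
    then show "eta l M (pat_prob d M) (RG (Suc d) ?g U) \<le> K * (\<epsilon> + box d U ?g / ?p)"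
      unfolding K_def using eta_RG_le[OF _ _ _ d \<epsilon>, of U M ?g] j(2) by simp
  qed simp
  also have "\<dots> = K * (\<epsilon> + (\<Sum>U\<in>?S. box d U ?g) / real (4 ^ J choose 4 ^ j) / ?p)"
  proof -
    have "K * (x * \<epsilon> + b / p) / x = K * (\<epsilon> + b / x / p)" if "x > 0" for x b p :: real
      using that by (simp add: add_divide_distrib distrib_left mult_ac)
    from this[OF ch] show ?thesis
      unfolding sum_distrib_left[symmetric] sum.distrib sum_divide_distrib[symmetric] sum_constant cardS .
  qed
  also have "\<dots> \<le> K * (\<epsilon> + 2 * (real d)\<^sup>2 / 2 ^ j / ?p)"
    using mean_box_pseudorandom[of d j J] d j \<epsilon>
    by (intro mult_left_mono add_left_mono divide_right_mono) (auto simp: K_def)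
  finally show ?thesis unfolding K_def .
qed

text \<open>\<epsilon> makes the first term small and then stays fixed, while large \<open>j\<close>
  makes the second one small.\<close>

lemma mean_eta_bound_eventually_less:
  fixes K a e :: real
  assumes "e > 0" "K \<ge> 0"
  shows "\<exists>\<epsilon>>0. \<forall>\<^sub>F j in sequentially. K * (\<epsilon> + a / 2 ^ j / \<epsilon> ^ p) < e"
proof -
  \<comment> \<open>\<open>K + 1\<close> instead of \<open>K\<close> keeps the denominator
    positive.\<close>
  define \<epsilon> where "\<epsilon> = e / (2 * (K + 1))"
  have \<epsilon>: "\<epsilon> > 0" "K * \<epsilon> < e"
    using assms unfolding \<epsilon>_def by (simp_all add: field_simps add_nonneg_pos)
  have "(\<lambda>j. (1 / 2 :: real) ^ j) \<longlonglongrightarrow> 0" by (rule LIMSEQ_power_zero) simp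
  then have "(\<lambda>j. K * (\<epsilon> + a * (1 / 2) ^ j / \<epsilon> ^ p)) \<longlonglongrightarrow> K * (\<epsilon> + a * 0 / \<epsilon> ^ p)"
    using \<epsilon> by (intro tendsto_intros) auto
  then have "\<forall>\<^sub>F j in sequentially. K * (\<epsilon> + a * (1 / 2) ^ j / \<epsilon> ^ p) < e"
    using \<epsilon>(2) by (intro order_tendstoD(2)) auto
  then show ?thesis using \<epsilon>(1) by (intro exI[of _ \<epsilon>]) (simp add: power_one_over)
qed

lemma eventually_le_power4: "\<forall>\<^sub>F j in sequentially. m \<le> (4 :: nat) ^ j"
  using eventually_ge_at_top[of m]
proof eventually_elim
  case (elim j)
  have "j < 4 ^ j" by (rule less_exp[THEN less_le_trans]) (simp add: power_mono)
  then show ?case using elim by linarith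
qed

text \<open>If \<open>H\<close> consists of all subsets, completeness always holds, and the
  normalized \<open>hsum\<close> is the density minus \<open>pat_prob\<close>. The edge size 1 is
  below \<open>d\<close>, and with \<open>j = J\<close> the only subset averaged over is the whole
  vertex set.\<close>

lemma density_RGseq_tendsto:
  assumes d: "d \<ge> 2"
  shows "(\<lambda>J. density M (RGseq d J)) \<longlonglongrightarrow> pat_prob d M"
proof (rule LIMSEQ_I)
  fix e :: real assume "e > 0"
  let ?m = "card (verts M)"
  define K where "K = real ?m ^ ?m * 2 ^ card (dsets ?m d)"
  obtain \<epsilon> where \<epsilon>: "\<epsilon> > 0" "\<forall>\<^sub>F j in sequentially. K * (\<epsilon> + 2 * (real d)\<^sup>2 / 2 ^ j / \<epsilon> ^ (2 ^ d - 1)) < e"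
    using mean_eta_bound_eventually_less[OF \<open>e > 0\<close>, of K] by (auto simp: K_def)
  have "\<forall>\<^sub>F J in sequentially. norm (density M (RGseq d J) - pat_prob d M) < e"
    using \<epsilon>(2) eventually_le_power4[of ?m]
  proof eventually_elim
    case (elim J)
    have "\<bar>hsum 1 M (pat_prob d M) (RGseq d J) (Pow {..<4 ^ J})\<bar> / real (4 ^ J choose ?m)
        \<le> mean_induced (4 ^ J) (eta 1 M (pat_prob d M)) (RGseq d J)"
      using hsum_le_mean_eta[of "RGseq d J" M "4 ^ J" 1 "pat_prob d M" "Pow {..<4 ^ J}"] elim by simp
    also have "\<dots> \<le> K * (\<epsilon> + 2 * (real d)\<^sup>2 / 2 ^ J / \<epsilon> ^ (2 ^ d - 1))"
      unfolding K_def using mean_eta_RGseq_le[OF d _ \<epsilon>(1), of 1 J J M] d elim by simp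
    also have "\<dots> < e" by (rule elim)
    finally have less: "\<bar>hsum 1 M (pat_prob d M) (RGseq d J) (Pow {..<4 ^ J}) / real (4 ^ J choose ?m)\<bar> < e"
      by simp
    have all: "(\<Sum>U | U \<subseteq> {..<4 ^ J :: nat} \<and> card U = ?m.
        F U * of_bool (\<forall>A. A \<subseteq> U \<longrightarrow> card A = 1 \<longrightarrow> A \<in> Pow {..<4 ^ J})) = (\<Sum>U | U \<subseteq> {..<4 ^ J :: nat} \<and> card U = ?m. F U)"
      for F :: "nat set \<Rightarrow> real"
      by (intro sum.cong refl) auto
    have "hsum 1 M (pat_prob d M) (RGseq d J) (Pow {..<4 ^ J}) / real (4 ^ J choose ?m)
        = density M (RGseq d J) - pat_prob d M"
      unfolding hsum_def verts_RGseq all density_eq_mean_induced[of "RGseq d J" M, simplified]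
        mean_induced_def sum_subtractf diff_divide_distrib
      using elim(2) by (simp add: n_subsets)
    then show ?case using less by simp
  qed
  then show "\<exists>no. \<forall>n\<ge>no. norm (density M (RGseq d n) - pat_prob d M) < e"
    by (simp add: eventually_sequentially)
qed

lemma exists_RGseq_limit:
  assumes d: "d \<ge> 2"
  obtains \<phi> where "\<phi> \<in> limit_objects (hypergraph_theory (Suc d))" "converges_to (hypergraph_theory (Suc d)) (RGseq d) \<phi>"
proof -
  let ?T = "hypergraph_theory (Suc d)"
  define \<phi> where "\<phi> = (\<lambda>C\<in>iso_classes ?T. lim (\<lambda>n. density (rep C) (RGseq d n)))"
  have conv: "converges_to ?T (RGseq d) \<phi>"
    unfolding \<phi>_def
    using density_RGseq_tendsto[OF d] by (intro converges_to_lim RGseq_fin_models) (auto simp: convergent_def)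
  moreover have "strict_mono (\<lambda>n. card (verts (RGseq d n)))"
    by (simp add: strict_mono_def power_strict_increasing)
  ultimately have "\<phi> \<in> limit_objects ?T"
    by (rule limit_objectsI) (simp add: \<phi>_def)
  with conv show ?thesis using that by blast
qed

section \<open>Complete hypergraphs in coupled models\<close>

lemma complete_hypergraph_induced_iff:
  assumes H: "is_model (hypergraph_theory l) H" and l: "l \<ge> 1" and W: "W \<subseteq> verts H" "finite W"
  shows "complete_hypergraph l (induced H W) \<longleftrightarrow> (\<forall>A. A \<subseteq> W \<longrightarrow> card A = l \<longrightarrow> A \<in> set ` rels H ())"
proof
  assume comp: "complete_hypergraph l (induced H W)"
  show "\<forall>A. A \<subseteq> W \<longrightarrow> card A = l \<longrightarrow> A \<in> set ` rels H ()"
  proof (intro allI impI)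
    fix A assume A: "A \<subseteq> W" "card A = l"
    then have "finite A" using W finite_subset by blast
    then obtain xs where xs: "set xs = A" "distinct xs" using finite_distinct_list by blast
    then have "xs \<in> rels (induced H W) ()"
      using comp A distinct_card[of xs] by (simp add: complete_hypergraph_def)
    then show "A \<in> set ` rels H ()" using xs by (auto simp: induced_def)
  qed
next
  assume all: "\<forall>A. A \<subseteq> W \<longrightarrow> card A = l \<longrightarrow> A \<in> set ` rels H ()"
  note H' = H[unfolded is_model_hypergraph_iff[OF l]]
  have "xs \<in> rels H ()" if xs: "length xs = l" "distinct xs" "set xs \<subseteq> W" for xs
  proof -
    have "set xs \<in> set ` rels H ()" using all xs distinct_card[of xs] by simp
    then obtain ys where "ys \<in> rels H ()" "set ys = set xs" by auto
    then show ?thesis using H' xs(1) by metis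
  qed
  moreover have "length xs = l \<and> distinct xs" if "xs \<in> rels H ()" for xs
    using H' that by blast
  ultimately show "complete_hypergraph l (induced H W)"
    unfolding complete_hypergraph_def by (auto simp: induced_def)
qed

lemma isomorphic_complete_iff:
  assumes "complete_hypergraph l B" "card (verts A) = card (verts B)" "finite (verts A)" "finite (verts B)"
    "is_model (hypergraph_theory l) A" "l \<ge> 1"
  shows "isomorphic A B \<longleftrightarrow> complete_hypergraph l A"
proof
  assume "isomorphic A B"
  then show "complete_hypergraph l A"
    using complete_hypergraph_cong[OF isomorphic_sym assms(1,5,6)] by blast
next
  assume A: "complete_hypergraph l A"
  obtain f where f: "bij_betw f (verts A) (verts B)"
    using finite_same_card_bij assms(2-4) by blast
  have "xs \<in> rels A () \<longleftrightarrow> map f xs \<in> rels B ()" if "set xs \<subseteq> verts A" for xs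
  proof -
    have "f ` set xs \<subseteq> verts B" "inj_on f (set xs)"
      using that f by (auto simp: bij_betw_def intro: inj_on_subset)
    then show ?thesis
      using that A assms(1) by (simp add: complete_hypergraph_def distinct_map)
  qed
  then show "isomorphic A B"
    using f unfolding isomorphic_def is_iso_def by (auto simp: unit_all_eq1)
qed

text \<open>Any bijection preserves completeness, so an isomorphism of the left reducts is one of
  the whole structures.\<close>

lemma isomorphic_disj_union_complete_iff:
  assumes M: "complete_hypergraph l (reductR M)" and X: "complete_hypergraph l (reductR X)"
  shows "isomorphic X M \<longleftrightarrow> isomorphic (reductL X) (reductL M)"
proof
  show "isomorphic (reductL X) (reductL M)" if "isomorphic X M"
    using isomorphic_reduct(1)[OF that] .
next
  assume "isomorphic (reductL X) (reductL M)"
  then obtain f where f: "is_iso f (reductL X) (reductL M)" by (auto simp: isomorphic_def)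
  then have b: "bij_betw f (verts X) (verts M)" by (simp add: is_iso_def)
  have "xs \<in> rels (reductR X) () \<longleftrightarrow> map f xs \<in> rels (reductR M) ()" if "set xs \<subseteq> verts X" for xs
  proof -
    have "f ` set xs \<subseteq> verts M" "inj_on f (set xs)"
      using that b by (auto simp: bij_betw_def intro: inj_on_subset)
    then show ?thesis
      using that M X by (simp add: complete_hypergraph_def distinct_map)
  qed
  then have "is_iso f (reductR X) (reductR M)"
    using b unfolding is_iso_def by (auto simp: unit_all_eq1)
  then show "isomorphic X M"
    using f is_iso_reduct unfolding isomorphic_def by blast
qed

text \<open>A set \<open>W\<close> induces \<open>M\<close> iff its left reduct is right and all its
  \<open>l\<close>-subsets are edges; the second condition alone gives the density of the right
  reduct. The difference is therefore an \<open>hsum\<close> for the edge system of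
  \<open>N\<close>.\<close>

lemma density_complete_diff:
  fixes M N :: "('p + unit, nat) rstruct"
  assumes l: "l \<ge> 1" and N: "N \<in> fin_models (disj_union T (hypergraph_theory l))"
    and M: "M \<in> fin_models (disj_union T (hypergraph_theory l))" "complete_hypergraph l (reductR M)"
    and card: "card (verts M) \<le> card (verts N)"
  shows "density M N - c * density (reductR M) (reductR N)
    = hsum l (reductL M) c (reductL N) (set ` rels (reductR N) ()) / real (card (verts N) choose card (verts M))"
proof -
  let ?H = "set ` rels (reductR N) ()"
  have fin: "finite (verts N)" "finite (verts M)" using M N by (simp_all add: fin_models_def)
  have mN: "is_model (hypergraph_theory l) (reductR N)"
    using fin_models_reduct(2)[OF N] by (simp add: fin_models_def)
  let ?c = "\<lambda>W. \<forall>A. A \<subseteq> W \<longrightarrow> card A = l \<longrightarrow> A \<in> ?H"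
  let ?S = "{W. W \<subseteq> verts N \<and> card W = card (verts M)}"
  have comp: "complete_hypergraph l (induced (reductR N) W) \<longleftrightarrow> ?c W" if "W \<in> ?S" for W
    using that fin by (intro complete_hypergraph_induced_iff[OF mN l]) (auto intro: finite_subset)
  have R: "isomorphic (induced (reductR N) W) (reductR M) \<longleftrightarrow> ?c W" if W: "W \<in> ?S" for W
  proof -
    have "induced (reductR N) W \<in> fin_models (hypergraph_theory l)"
      using W by (intro fin_models_induced[OF universal_hypergraph_theory[OF l] fin_models_reduct(2)[OF N]]) simp
    then show ?thesis
      using W fin comp[OF W] isomorphic_complete_iff[OF M(2), of "induced (reductR N) W"] l
      by (simp add: fin_models_def)
  qed
  have L: "isomorphic (induced N W) M \<longleftrightarrow> isomorphic (induced (reductL N) W) (reductL M) \<and> ?c W"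
    if W: "W \<in> ?S" for W
  proof
    assume iso: "isomorphic (induced N W) M"
    show "isomorphic (induced (reductL N) W) (reductL M) \<and> ?c W"
      using isomorphic_reduct[OF iso] R[OF W] by simp
  next
    assume *: "isomorphic (induced (reductL N) W) (reductL M) \<and> ?c W"
    then have "complete_hypergraph l (reductR (induced N W))" using comp[OF W] by simp
    from isomorphic_disj_union_complete_iff[OF M(2) this] * show "isomorphic (induced N W) M" by simp
  qed
  have "density M N = (\<Sum>W\<in>?S. of_bool (isomorphic (induced (reductL N) W) (reductL M)) * of_bool (?c W))
      / real (card (verts N) choose card (verts M))"
    unfolding density_eq_mean_induced[OF fin(1)] mean_induced_def
    by (intro arg_cong2[where f = "(/)"] sum.cong refl) (simp only: L of_bool_conj)
  moreover have "density (reductR M) (reductR N) = (\<Sum>W\<in>?S. of_bool (?c W))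
      / real (card (verts N) choose card (verts M))"
    using fin(1) by (subst density_eq_mean_induced, simp, unfold mean_induced_def reduct_simps,
      intro arg_cong2[where f = "(/)"] sum.cong refl) (simp only: R)
  ultimately show ?thesis
    unfolding hsum_def
    by (simp only: left_diff_distrib sum_subtractf diff_divide_distrib sum_distrib_left[symmetric] reduct_simps)
       (simp only: times_divide_eq_right)
qed

theorem UInduce_RGseq_limit:
  assumes d: "d \<ge> 2" "l \<ge> 1" "l < d" and \<phi>: "\<phi> \<in> limit_objects (hypergraph_theory (Suc d))"
    "converges_to (hypergraph_theory (Suc d)) (RGseq d) \<phi>"
  shows "UInduce l (hypergraph_theory (Suc d)) \<phi>"
  unfolding UInduce_def
proof (intro ballI impI)
  let ?T = "hypergraph_theory (Suc d)" and ?H = "hypergraph_theory l"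
  let ?TH = "disj_union ?T ?H"
  fix \<psi> \<xi> M
  assume \<xi>: "\<xi> \<in> couplings ?T \<phi> ?H \<psi>" and M: "M \<in> fin_models ?TH" and comp: "complete_hypergraph l (reductR M)"
  have uT: "universal_theory ?T" and uH: "universal_theory ?H"
    using d by (simp_all add: universal_hypergraph_theory)
  have "\<xi> \<in> limit_objects ?TH" and red: "limit_reductL ?T ?H \<xi> = \<phi>" "limit_reductR ?T ?H \<xi> = \<psi>"
    using \<xi> by (simp_all add: couplings_def)
  then obtain N where N: "converges_to ?TH N \<xi>" "strict_mono (\<lambda>n. card (verts (N n)))"
    using limit_objects_converges by blast
  have NL: "converges_to ?T (\<lambda>n. reductL (N n)) \<phi>" and NR: "converges_to ?H (\<lambda>n. reductR (N n)) \<psi>"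
    using converges_to_reductL[OF uT uH N(1)] converges_to_reductR[OF uT uH N(1)] red by simp_all
  have Nmod: "N n \<in> fin_models ?TH" for n using N(1) by (simp add: converges_to_def)
  have modL: "reductL M \<in> fin_models ?T" and modR: "reductR M \<in> fin_models ?H"
    using fin_models_reduct[OF M] by simp_all
  define c where "c = pat_prob d (reductL M)"
  \<comment> \<open>The defect of independence at \<open>M\<close>, once \<phi> is replaced by its
    value \<open>c\<close> at the left reduct.\<close>
  define \<Delta> where "\<Delta> = \<xi> (iso_class ?TH M) - c * \<psi> (iso_class ?H (reductR M))"
  have \<phi>c: "\<phi> (iso_class ?T (reductL M)) = c"
    using \<phi>(2) modL density_RGseq_tendsto[OF d(1), of "reductL M"] LIMSEQ_unique
    unfolding converges_to_def c_def by blast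
  define L where "L j = (\<Sum>C\<in>classes_of_size ?T (4 ^ j). eta l (reductL M) c (rep C) * \<phi> C)" for j :: nat
  have eta_cong': "eta l (reductL M) c A = eta l (reductL M) c B"
    if "A \<in> fin_models ?T" "B \<in> fin_models ?T" "isomorphic A B" for A B
    using that by (intro eta_cong) (auto simp: fin_models_def)
  \<comment> \<open>Both sequences have the same limit \<open>L j\<close>, because the left reducts
    of \<open>N\<close> also converge to \<phi> and \<open>eta\<close> is invariant. Estimates for
    the pseudorandom sequence thereby transfer to \<open>N\<close>.\<close>
  have L1: "(\<lambda>n. mean_induced (4 ^ j) (eta l (reductL M) c) (reductL (N n))) \<longlonglongrightarrow> L j"
    and L2: "(\<lambda>J. mean_induced (4 ^ j) (eta l (reductL M) c) (RGseq d J)) \<longlonglongrightarrow> L j" for j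
    unfolding L_def
    by (rule mean_induced_tendsto[OF uT NL eta_cong'], assumption+)
      (rule mean_induced_tendsto[OF uT \<phi>(2) eta_cong'], assumption+)
  \<comment> \<open>The edges of \<open>N n\<close> are one choice of \<open>H\<close>, so the
    defect is bounded by the mean of \<open>eta\<close> over subsets of size \<open>4 ^ j\<close>,
    as soon as \<open>N n\<close> has that many points.\<close>
  have \<Delta>_le: "\<bar>\<Delta>\<bar> \<le> L j" if j: "card (verts M) \<le> 4 ^ j" for j
  proof (rule LIMSEQ_le[OF _ L1])
    show "(\<lambda>n. \<bar>density M (N n) - c * density (reductR M) (reductR (N n))\<bar>) \<longlonglongrightarrow> \<bar>\<Delta>\<bar>"
      using N(1) NR M modR unfolding \<Delta>_def converges_to_def by (intro tendsto_intros) auto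
    have "\<bar>density M (N n) - c * density (reductR M) (reductR (N n))\<bar>
        \<le> mean_induced (4 ^ j) (eta l (reductL M) c) (reductL (N n))" if n: "n \<ge> 4 ^ j" for n
    proof -
      have "n \<le> card (verts (N n))" by (rule seq_suble[OF N(2)])
      then have le: "4 ^ j \<le> card (verts (N n))" using n by simp
      show ?thesis
        using hsum_le_mean_eta[of "reductL (N n)" "reductL M" "4 ^ j" l c "set ` rels (reductR (N n)) ()"]
          density_complete_diff[OF d(2) Nmod[of n] M comp, of c] le j Nmod[of n]
        by (simp add: fin_models_def)
    qed
    then show "\<exists>k. \<forall>n\<ge>k. \<bar>density M (N n) - c * density (reductR M) (reductR (N n))\<bar>
        \<le> mean_induced (4 ^ j) (eta l (reductL M) c) (reductL (N n))" by blast
  qed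
  have "\<bar>\<Delta>\<bar> \<le> 0"
  proof (rule field_le_epsilon)
    fix e :: real assume "e > 0"
    define m where "m = card (verts M)"
    define K where "K = real m ^ m * 2 ^ card (dsets m d)"
    obtain \<epsilon> where \<epsilon>: "\<epsilon> > 0" "\<forall>\<^sub>F j in sequentially. K * (\<epsilon> + 2 * (real d)\<^sup>2 / 2 ^ j / \<epsilon> ^ (2 ^ d - 1)) < e"
      using mean_eta_bound_eventually_less[OF \<open>e > 0\<close>, of K] by (auto simp: K_def)
    have "\<forall>\<^sub>F j in sequentially. K * (\<epsilon> + 2 * (real d)\<^sup>2 / 2 ^ j / \<epsilon> ^ (2 ^ d - 1)) < e \<and> m \<le> 4 ^ j"
      using \<epsilon>(2) eventually_le_power4 by eventually_elim simp
    then obtain j where j: "K * (\<epsilon> + 2 * (real d)\<^sup>2 / 2 ^ j / \<epsilon> ^ (2 ^ d - 1)) < e" "m \<le> 4 ^ j"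
      by (auto simp: eventually_sequentially)
    \<comment> \<open>Along the pseudorandom sequence \<open>j\<close> is fixed and \<open>J\<close>
      grows; the bound does not contain \<open>J\<close>.\<close>
    have "L j \<le> K * (\<epsilon> + 2 * (real d)\<^sup>2 / 2 ^ j / \<epsilon> ^ (2 ^ d - 1))"
    proof (rule LIMSEQ_le_const2[OF L2], intro exI allI impI)
      fix J assume "J \<ge> j"
      then show "mean_induced (4 ^ j) (eta l (reductL M) c) (RGseq d J)
          \<le> K * (\<epsilon> + 2 * (real d)\<^sup>2 / 2 ^ j / \<epsilon> ^ (2 ^ d - 1))"
        using mean_eta_RGseq_le[OF d(1,3) \<epsilon>(1), of j J "reductL M"] j(2)
        by (simp add: K_def m_def c_def)
    qed
    then show "\<bar>\<Delta>\<bar> \<le> 0 + e" using \<Delta>_le[of j] j by (simp add: m_def)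
  qed
  then have "\<xi> (iso_class ?TH M) = \<phi> (iso_class ?T (reductL M)) * \<psi> (iso_class ?H (reductR M))"
    by (simp add: \<Delta>_def \<phi>c)
  then show "\<xi> (iso_class ?TH M) = indep_coupling ?T \<phi> ?H \<psi> (iso_class ?TH M)"
    using indep_coupling_complete[OF M d(2) comp, of \<phi> \<psi>] by simp
qed

section \<open>Fair two-colourings\<close>

text \<open>The predicate symbols are natural numbers because \<open>UCouple\<close> ranges over
  theories of type \<open>nat rtheory\<close>; 0 stands for red.\<close>

definition colour_theory :: "nat rtheory" where
  "colour_theory = \<lparr>preds = {0}, arity = (\<lambda>_. 1), axs = {canonical_axiom 0 1}\<rparr>"

definition colouring :: "'v set \<Rightarrow> 'v set \<Rightarrow> (nat, 'v) rstruct" where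
  "colouring V R = \<lparr>verts = V, rels = (\<lambda>P. if P = 0 then (\<lambda>v. [v]) ` (R \<inter> V) else {})\<rparr>"

definition red :: "(nat, 'v) rstruct \<Rightarrow> 'v set" where
  "red M = {v. [v] \<in> rels M 0}"

lemma verts_colouring [simp]: "verts (colouring V R) = V"
  by (simp add: colouring_def)

lemma red_colouring [simp]: "red (colouring V R) = R \<inter> V"
  by (auto simp: red_def colouring_def)

lemma canonical_colour_theory: "canonical_theory colour_theory" "universal_theory colour_theory"
  unfolding canonical_theory_def universal_theory_def colour_theory_def
  by (auto simp: over_language_canonical_axiom)

lemma is_model_colour_iff:
  "is_model colour_theory M \<longleftrightarrow> red M \<subseteq> verts M \<and> rels M = (\<lambda>P. if P = 0 then (\<lambda>v. [v]) ` red M else {})"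
proof
  assume "is_model colour_theory M"
  then have *: "rels M P \<subseteq> {xs. P = 0 \<and> length xs = 1 \<and> set xs \<subseteq> verts M}" for P
    by (simp add: is_model_def is_struct_def colour_theory_def)
  have "rels M 0 = (\<lambda>v. [v]) ` red M"
    using *[of 0] by (auto simp: red_def length_Suc_conv image_iff subset_iff)
  moreover have "rels M P = {}" if "P \<noteq> 0" for P using *[of P] that by auto
  moreover have "red M \<subseteq> verts M" using *[of 0] by (auto simp: red_def)
  ultimately show "red M \<subseteq> verts M \<and> rels M = (\<lambda>P. if P = 0 then (\<lambda>v. [v]) ` red M else {})"
    by (simp add: fun_eq_iff)
next
  assume *: "red M \<subseteq> verts M \<and> rels M = (\<lambda>P. if P = 0 then (\<lambda>v. [v]) ` red M else {})"
  then have "is_struct colour_theory M"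
    by (auto simp: is_struct_def colour_theory_def)
  moreover have "sat M v (canonical_axiom 0 1)" for v
    unfolding sat_canonical_axiom by simp
  ultimately show "is_model colour_theory M" by (simp add: is_model_def colour_theory_def)
qed

lemma colouring_fin_models: "finite V \<Longrightarrow> colouring V R \<in> fin_models colour_theory"
  unfolding fin_models_def mem_Collect_eq is_model_colour_iff red_colouring by (simp add: colouring_def)

lemma red_induced: "red (induced M U) = red M \<inter> U"
  by (auto simp: red_def induced_def)

lemma isomorphic_colour_iff:
  assumes A: "is_model colour_theory A" "finite (verts A)" and B: "is_model colour_theory B" "finite (verts B)"
  shows "isomorphic A B \<longleftrightarrow> card (verts A) = card (verts B) \<and> card (red A) = card (red B)"
proof
  have sub: "red A \<subseteq> verts A" "red B \<subseteq> verts B" using A B by (auto simp: is_model_colour_iff)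
  assume "isomorphic A B"
  then obtain f where f: "is_iso f A B" by (auto simp: isomorphic_def)
  then have b: "bij_betw f (verts A) (verts B)" by (simp add: is_iso_def)
  have mem: "v \<in> red A \<longleftrightarrow> f v \<in> red B" if "v \<in> verts A" for v
  proof -
    have "set [v] \<subseteq> verts A" using that by simp
    then have "[v] \<in> rels A 0 \<longleftrightarrow> map f [v] \<in> rels B 0" using f unfolding is_iso_def by blast
    then show ?thesis by (simp add: red_def)
  qed
  have "f ` red A = red B"
    using mem sub b by (force simp: bij_betw_def)
  then have "bij_betw f (red A) (red B)"
    using b sub by (auto simp: bij_betw_def intro: inj_on_subset)
  then show "card (verts A) = card (verts B) \<and> card (red A) = card (red B)"
    using b by (simp add: bij_betw_same_card)
next
  have sub: "red A \<subseteq> verts A" "red B \<subseteq> verts B" using A B by (auto simp: is_model_colour_iff)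
  assume c: "card (verts A) = card (verts B) \<and> card (red A) = card (red B)"
  have fin: "finite (red A)" "finite (red B)" using sub A B finite_subset by blast+
  obtain f where f: "bij_betw f (red A) (red B)"
    using finite_same_card_bij[OF fin] c by blast
  have "card (verts A - red A) = card (verts B - red B)"
    using c sub fin by (simp add: card_Diff_subset)
  then obtain g where g: "bij_betw g (verts A - red A) (verts B - red B)"
    using finite_same_card_bij[of "verts A - red A" "verts B - red B"] A B by auto
  define h where "h v = (if v \<in> red A then f v else g v)" for v
  have h1: "bij_betw h (red A) (red B)" 
    using f by (rule bij_betw_cong[THEN iffD1, rotated]) (simp add: h_def)
  have h2: "bij_betw h (verts A - red A) (verts B - red B)"
    using g by (rule bij_betw_cong[THEN iffD1, rotated]) (simp add: h_def)
  have "bij_betw h (red A \<union> (verts A - red A)) (red B \<union> (verts B - red B))"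
    using h1 h2 by (rule bij_betw_combine) auto
  moreover have "red A \<union> (verts A - red A) = verts A" "red B \<union> (verts B - red B) = verts B"
    using sub by auto
  ultimately have h: "bij_betw h (verts A) (verts B)" by simp
  have mem: "v \<in> red A \<longleftrightarrow> h v \<in> red B" if "v \<in> verts A" for v
  proof (cases "v \<in> red A")
    case True
    then show ?thesis using bij_betwE[OF h1] by simp
  next
    case False
    then show ?thesis using bij_betwE[OF h2] that by simp
  qed
  have "xs \<in> rels A P \<longleftrightarrow> map h xs \<in> rels B P" if xs: "set xs \<subseteq> verts A" for P xs
  proof -
    have rA: "rels A = (\<lambda>P. if P = 0 then (\<lambda>v. [v]) ` red A else {})"
      and rB: "rels B = (\<lambda>P. if P = 0 then (\<lambda>v. [v]) ` red B else {})"
      using A(1) B(1) unfolding is_model_colour_iff by blast+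
    have "xs \<in> (\<lambda>v. [v]) ` red A \<longleftrightarrow> map h xs \<in> (\<lambda>v. [v]) ` red B"
    proof
      assume "xs \<in> (\<lambda>v. [v]) ` red A"
      then obtain v where "v \<in> red A" "xs = [v]" by auto
      then show "map h xs \<in> (\<lambda>v. [v]) ` red B" using mem sub by auto
    next
      assume "map h xs \<in> (\<lambda>v. [v]) ` red B"
      then obtain v where "xs = [v]" "h v \<in> red B" by auto
      then show "xs \<in> (\<lambda>v. [v]) ` red A" using mem xs by auto
    qed
    then show ?thesis unfolding rA rB by simp
  qed
  then show "isomorphic A B" using h unfolding isomorphic_def is_iso_def by blast
qed

section \<open>Limit densities of the colouring by halves\<close>

lemma card_subsets_meeting:
  assumes V: "finite V" "R \<subseteq> V" and r: "r \<le> m"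
  shows "card {U. U \<subseteq> V \<and> card U = m \<and> card (R \<inter> U) = r} = (card R choose r) * ((card V - card R) choose (m - r))"
proof -
  have fin: "finite R" "finite (V - R)" using V finite_subset by auto
  let ?A = "{A. A \<subseteq> R \<and> card A = r}" and ?B = "{B. B \<subseteq> V - R \<and> card B = m - r}"
  have "bij_betw (\<lambda>(A, B). A \<union> B) (?A \<times> ?B) {U. U \<subseteq> V \<and> card U = m \<and> card (R \<inter> U) = r}"
  proof (rule bij_betwI[where g = "\<lambda>U. (R \<inter> U, U - R)"])
    show "(\<lambda>(A, B). A \<union> B) \<in> ?A \<times> ?B \<rightarrow> {U. U \<subseteq> V \<and> card U = m \<and> card (R \<inter> U) = r}"
    proof
      fix p assume "p \<in> ?A \<times> ?B"
      then obtain A B where p: "p = (A, B)" "A \<subseteq> R" "card A = r" "B \<subseteq> V - R" "card B = m - r" by auto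
      then have "card (A \<union> B) = card A + card B"
        using fin by (intro card_Un_disjoint) (auto intro: finite_subset)
      moreover have "R \<inter> (A \<union> B) = A" using p by auto
      ultimately show "(\<lambda>(A, B). A \<union> B) p \<in> {U. U \<subseteq> V \<and> card U = m \<and> card (R \<inter> U) = r}"
        using p r V by auto
    qed
    show "(\<lambda>U. (R \<inter> U, U - R)) \<in> {U. U \<subseteq> V \<and> card U = m \<and> card (R \<inter> U) = r} \<rightarrow> ?A \<times> ?B"
    proof
      fix U assume U: "U \<in> {U. U \<subseteq> V \<and> card U = m \<and> card (R \<inter> U) = r}"
      then have "card (U - R) = m - r"
        using card_Diff_subset_Int[of U R] fin by (simp add: Int_commute)
      then show "(R \<inter> U, U - R) \<in> ?A \<times> ?B" using U by auto
    qed
  qed auto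
  then have "card {U. U \<subseteq> V \<and> card U = m \<and> card (R \<inter> U) = r} = card (?A \<times> ?B)"
    by (rule bij_betw_same_card[symmetric])
  also have "\<dots> = (card R choose r) * ((card V - card R) choose (m - r))"
    using fin V by (simp add: card_cartesian_product n_subsets card_Diff_subset)
  finally show ?thesis .
qed

lemma choose_asymptotic: "(\<lambda>n. real (n choose r) / real n ^ r) \<longlonglongrightarrow> 1 / fact r"
proof -
  have eq: "real (n choose r) / real n ^ r = (\<Prod>i<r. (real n - real i) / real n) / fact r" for n
    by (simp add: binomial_gbinomial gbinomial_prod_rev atLeast0LessThan prod_dividef)
  have "(\<lambda>n. (real n - real i) / real n) \<longlonglongrightarrow> 1" for i
  proof (rule Lim_transform_eventually)
    show "(\<lambda>n. 1 - real i * (1 / real n)) \<longlonglongrightarrow> 1"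
      using tendsto_diff[OF tendsto_const[of 1] tendsto_mult[OF tendsto_const[of "real i"] lim_1_over_n]] by simp
    show "\<forall>\<^sub>F n in sequentially. 1 - real i * (1 / real n) = (real n - real i) / real n"
      using eventually_gt_at_top[of 0] by eventually_elim (simp add: field_simps)
  qed
  then have "(\<lambda>n. (\<Prod>i<r. (real n - real i) / real n) / fact r) \<longlonglongrightarrow> (\<Prod>i<r. 1) / fact r"
    by (intro tendsto_divide tendsto_prod tendsto_const) auto
  then show ?thesis unfolding eq by simp
qed

text \<open>A binomial coefficient is asymptotically a power over a factorial. The powers of
  \<open>h J\<close> cancel and leave a binomial distribution: sampling without replacement turns
  into fair coin tosses.\<close>

lemma hypergeometric_tendsto:
  assumes h: "filterlim h at_top sequentially"
  shows "(\<lambda>J. real ((h J choose r) * (h J choose s)) / real (2 * h J choose (r + s)))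
    \<longlonglongrightarrow> real (r + s choose r) / 2 ^ (r + s)"
proof -
  define a where "a r n = real (n choose r) / real n ^ r" for r n :: nat
  have a: "(\<lambda>J. a r (f J)) \<longlonglongrightarrow> 1 / fact r" if "filterlim f at_top sequentially" for r and f :: "nat \<Rightarrow> nat"
    using filterlim_compose[OF choose_asymptotic[of r] that] by (simp add: a_def)
  have h2: "filterlim (\<lambda>J. 2 * h J) at_top sequentially"
    by (rule filterlim_at_top_mono[OF h]) simp
  have "(\<lambda>J. a r (h J) * a s (h J) / (a (r + s) (2 * h J) * 2 ^ (r + s)))
      \<longlonglongrightarrow> 1 / fact r * (1 / fact s) / (1 / fact (r + s) * 2 ^ (r + s))"
    by (intro tendsto_intros a h h2) auto
  moreover have "1 / fact r * (1 / fact s) / (1 / fact (r + s) * 2 ^ (r + s)) = real (r + s choose r) / 2 ^ (r + s)"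
    by (simp add: binomial_fact)
  moreover have "\<forall>\<^sub>F J in sequentially. a r (h J) * a s (h J) / (a (r + s) (2 * h J) * 2 ^ (r + s))
      = real ((h J choose r) * (h J choose s)) / real (2 * h J choose (r + s))"
    using filterlim_at_top[THEN iffD1, OF h, rule_format, of 1]
  proof eventually_elim
    case (elim J)
    have "a (r + s) (2 * h J) * 2 ^ (r + s) = real (2 * h J choose (r + s)) / real (h J) ^ (r + s)"
      by (simp add: a_def power_mult_distrib)
    then show ?case using elim by (simp add: a_def power_add)
  qed
  ultimately show ?thesis by (simp add: Lim_transform_eventually)
qed

definition halfcol :: "nat \<Rightarrow> (nat, nat) rstruct" where
  "halfcol J = colouring {..<4 ^ J} {..<4 ^ J div 2}"

lemma density_halfcol_tendsto:
  assumes M: "M \<in> fin_models colour_theory"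
  shows "(\<lambda>J. density M (halfcol J)) \<longlonglongrightarrow> real (card (verts M) choose card (red M)) / 2 ^ card (verts M)"
proof -
  define m where "m = card (verts M)"
  define r where "r = card (red M)"
  have M': "is_model colour_theory M" "finite (verts M)" using M by (auto simp: fin_models_def)
  have rm: "r \<le> m" unfolding r_def m_def using M' by (intro card_mono) (auto simp: is_model_colour_iff)
  define h where "h J = (4 ^ J div 2 :: nat)" for J :: nat
  have "filterlim h at_top sequentially"
  proof (rule filterlim_at_top_mono[OF filterlim_ident])
    show "\<forall>\<^sub>F J in sequentially. J \<le> h J"
      using eventually_gt_at_top[of 0]
    proof eventually_elim
      case (elim J)
      have "2 * J < 4 ^ J" by (induction J) auto
      then show ?case by (simp add: h_def)
    qed
  qed
  from hypergeometric_tendsto[OF this, of r "m - r"]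
  have lim: "(\<lambda>J. real ((h J choose r) * (h J choose (m - r))) / real (2 * h J choose m)) \<longlonglongrightarrow> real (m choose r) / 2 ^ m"
    using rm by simp
  have "\<forall>\<^sub>F J in sequentially. real ((h J choose r) * (h J choose (m - r))) / real (2 * h J choose m) = density M (halfcol J)"
    using eventually_gt_at_top[of 0]
  proof eventually_elim
    case (elim J)
    \<comment> \<open>The halves have equal size only for positive \<open>J\<close>, since
      \<open>4 ^ 0\<close> is odd.\<close>
    then have hJ: "2 * h J = 4 ^ J" by (cases J) (auto simp: h_def)
    let ?V = "{..<4 ^ J :: nat}" and ?R = "{..<h J}"
    have RV: "?R \<subseteq> ?V" and half: "4 ^ J - h J = h J" using hJ by auto
    have N: "halfcol J \<in> fin_models colour_theory" unfolding halfcol_def by (rule colouring_fin_models) simp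
    have "{U. U \<subseteq> ?V \<and> card U = m \<and> isomorphic (induced (halfcol J) U) M} = {U. U \<subseteq> ?V \<and> card U = m \<and> card (?R \<inter> U) = r}"
    proof -
      have "isomorphic (induced (halfcol J) U) M \<longleftrightarrow> card (?R \<inter> U) = r" if U: "U \<subseteq> ?V" "card U = m" for U
      proof -
        have "induced (halfcol J) U \<in> fin_models colour_theory"
          using fin_models_induced[OF canonical_colour_theory(2) N, of U] U by (simp add: halfcol_def)
        then have "isomorphic (induced (halfcol J) U) M \<longleftrightarrow> card (verts (induced (halfcol J) U)) = m \<and> card (red (induced (halfcol J) U)) = r"
          unfolding m_def r_def using M' by (intro isomorphic_colour_iff) (auto simp: fin_models_def)
        moreover have "red (induced (halfcol J) U) = ?R \<inter> U"
          using RV U by (auto simp: red_induced halfcol_def h_def)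
        ultimately show ?thesis using U by simp
      qed
      then show ?thesis by blast
    qed
    then have "card {U. U \<subseteq> ?V \<and> card U = m \<and> isomorphic (induced (halfcol J) U) M} = (h J choose r) * (h J choose (m - r))"
      using card_subsets_meeting[of ?V ?R r m] RV rm half by simp
    then show ?case unfolding density_def by (simp add: halfcol_def m_def[symmetric] hJ)
  qed
  with lim show ?thesis unfolding m_def r_def by (rule Lim_transform_eventually)
qed

section \<open>A theon of rank one for the fair colouring\<close>

definition unit_lebesgue :: "real measure" where
  "unit_lebesgue = completion (uniform_measure lborel {0..1})"

definition half_peon :: "nat \<Rightarrow> (nat set \<Rightarrow> real) set" where
  "half_peon P = {x \<in> space (exch_space {..<1 :: nat} unit_lebesgue). x {0} \<ge> 1 / 2}"

lemma space_unit_lebesgue [simp]: "space unit_lebesgue = UNIV"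
  by (simp add: unit_lebesgue_def)

lemma borel_unit_lebesgue: "A \<in> sets borel \<Longrightarrow> A \<in> sets unit_lebesgue"
  by (simp add: unit_lebesgue_def)

lemma emeasure_unit_lebesgue: "A \<in> sets borel \<Longrightarrow> emeasure unit_lebesgue A = emeasure lborel ({0..1} \<inter> A)"
  by (simp add: unit_lebesgue_def divide_ennreal_def)

lemma measure_unit_lebesgue: "A \<in> sets borel \<Longrightarrow> measure unit_lebesgue A = measure lborel ({0..1} \<inter> A)"
  by (simp add: measure_def emeasure_unit_lebesgue)

lemma prob_space_unit_lebesgue: "prob_space unit_lebesgue"
  by (rule prob_spaceI) (simp add: emeasure_unit_lebesgue)

lemma complete_unit_lebesgue: "complete_measure unit_lebesgue"
  unfolding unit_lebesgue_def by (rule completion.complete_measure_axioms)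

text \<open>The unit interval is cut into \<open>n\<close> intervals, with \<open>1 / n\<close>
  below the measure of \<open>A\<close>. One of them meets \<open>A\<close> in positive measure, and
  that intersection is too small to be all of \<open>A\<close>.\<close>

lemma atomless_unit_lebesgue: "atomless unit_lebesgue"
  unfolding atomless_def
proof (intro ballI impI)
  fix A assume A: "A \<in> sets unit_lebesgue" "0 < emeasure unit_lebesgue A"
  interpret prob_space unit_lebesgue by (rule prob_space_unit_lebesgue)
  have "prob A > 0" using A by (simp add: emeasure_eq_measure)
  then obtain n :: nat where n: "n > 0" "1 / real n < prob A"
    using ex_inverse_of_nat_less[of "prob A"] by (auto simp: inverse_eq_divide)
  define I where "I i = {real i / real n .. (real i + 1) / real n}" for i :: nat
  have Im: "I i \<in> sets unit_lebesgue" for i unfolding I_def by (rule borel_unit_lebesgue) simp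
  have I_small: "prob (I i) \<le> 1 / real n" for i
  proof -
    have "emeasure unit_lebesgue (I i) \<le> emeasure lborel (I i)"
      unfolding I_def by (subst emeasure_unit_lebesgue) (auto intro!: emeasure_mono)
    also have "\<dots> = ennreal (1 / real n)"
      using n unfolding I_def by (simp add: emeasure_lborel_Icc_eq divide_right_mono field_simps)
    finally show ?thesis by (simp add: emeasure_eq_measure ennreal_le_iff)
  qed
  have "\<exists>i<n. prob (A \<inter> I i) > 0"
  proof (rule ccontr)
    assume "\<not> ?thesis"
    then have zero: "prob (A \<inter> I i) = 0" if "i < n" for i
      using that by (auto simp: zero_less_measure_iff)
    have out: "emeasure unit_lebesgue (- {0..1}) = 0"
      by (subst emeasure_unit_lebesgue) auto
    have cover: "A \<subseteq> (\<Union>i<n. A \<inter> I i) \<union> - {0..1}"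
    proof
      fix x assume x: "x \<in> A"
      show "x \<in> (\<Union>i<n. A \<inter> I i) \<union> - {0..1}"
      proof (cases "x \<in> {0..1}")
        case True
        show ?thesis
        proof (cases "x = 1")
          case True
          \<comment> \<open>The formula for the index would give \<open>n\<close> at the right end
            point, which is put into the last interval instead.\<close>
          then have "x \<in> I (n - 1)" using n by (simp add: I_def of_nat_diff)
          then show ?thesis using x n by (auto intro!: bexI[of _ "n - 1"])
        next
          case False
          define i where "i = nat \<lfloor>x * real n\<rfloor>"
          have i: "real i \<le> x * real n" "x * real n < real i + 1"
            using \<open>x \<in> {0..1}\<close> unfolding i_def by (auto simp: of_nat_nat intro: of_int_floor_le)
          moreover have "x * real n < real n" using False \<open>x \<in> {0..1}\<close> n by simp
          ultimately have "real i < real n" by linarith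
          then have "i < n" by simp
          moreover have "x \<in> I i" using i n by (simp add: I_def field_simps)
          ultimately show ?thesis using x by auto
        qed
      qed simp
    qed
    have m1: "(\<Union>i<n. A \<inter> I i) \<in> sets unit_lebesgue" "- {0..1::real} \<in> sets unit_lebesgue"
      using A Im by (auto intro!: borel_unit_lebesgue)
    have "prob A \<le> prob ((\<Union>i<n. A \<inter> I i) \<union> - {0..1})"
      using m1 by (intro finite_measure_mono[OF cover]) auto
    also have "\<dots> \<le> prob (\<Union>i<n. A \<inter> I i) + prob (- {0..1})"
      using m1 by (rule measure_Un_le)
    also have "prob (- {0..1}) = 0" using out by (simp add: emeasure_eq_measure)
    also have "prob (\<Union>i<n. A \<inter> I i) \<le> (\<Sum>i<n. prob (A \<inter> I i))"
      using A Im by (intro finite_measure_subadditive_finite) auto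
    also have "\<dots> = 0" using zero by simp
    finally show False using \<open>prob A > 0\<close> by simp
  qed
  then obtain i where i: "prob (A \<inter> I i) > 0" by auto
  have "prob (A \<inter> I i) \<le> prob (I i)" using A Im by (intro finite_measure_mono) auto
  then have "prob (A \<inter> I i) < prob A" using I_small[of i] n by linarith
  then show "\<exists>B\<in>sets unit_lebesgue. B \<subseteq> A \<and> 0 < emeasure unit_lebesgue B \<and> emeasure unit_lebesgue B < emeasure unit_lebesgue A"
    using i A Im by (intro bexI[of _ "A \<inter> I i"]) (auto simp: emeasure_eq_measure ennreal_less_iff)
qed

lemma prob_half: "measure unit_lebesgue {x. 1 / 2 \<le> x} = 1 / 2" "measure unit_lebesgue {x. \<not> 1 / 2 \<le> x} = 1 / 2"
proof -
  have 1: "{0..1} \<inter> {x :: real. 1 / 2 \<le> x} = {1 / 2..1}" and 2: "{0..1} \<inter> {x :: real. \<not> 1 / 2 \<le> x} = {0..<1 / 2}" by auto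
  have "{x :: real. 1 / 2 \<le> x} \<in> sets borel" "{x :: real. \<not> 1 / 2 \<le> x} \<in> sets borel" by measurable
  then show "measure unit_lebesgue {x. 1 / 2 \<le> x} = 1 / 2" "measure unit_lebesgue {x. \<not> 1 / 2 \<le> x} = 1 / 2"
    by (simp_all only: measure_unit_lebesgue 1 2) simp_all
qed

lemma fin_subsets_lessThan_1: "fin_subsets {..<1 :: nat} = {{0}}"
proof -
  have "{..<1 :: nat} = {0}" by auto
  then show ?thesis by (auto simp: fin_subsets_def)
qed

lemma singleton_fin_subsets: "{v} \<in> fin_subsets UNIV"
  by (simp add: fin_subsets_def)

lemma space_exch_space: "space (exch_space V unit_lebesgue) = PiE (fin_subsets V) (\<lambda>_. UNIV)"
  by (simp add: exch_space_def space_PiM)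

lemma red_sampled: "red (sampled_struct colour_theory half_peon \<theta>) = {v. \<theta> {v} \<ge> 1 / 2}"
  by (auto simp: red_def sampled_struct_def colour_theory_def half_peon_def pullback_def
      space_exch_space fin_subsets_lessThan_1[unfolded One_nat_def])

lemma sampled_is_model: "is_model colour_theory (sampled_struct colour_theory half_peon \<theta>)"
  by (auto simp: is_model_def is_struct_def sat_canonical_axiom colour_theory_def sampled_struct_def)

lemma half_peon_theon: "is_theon colour_theory unit_lebesgue half_peon"
proof -
  have "{x \<in> space (PiM (fin_subsets {..<1 :: nat}) (\<lambda>_. unit_lebesgue)). x {0} \<in> {x. 1 / 2 \<le> x}}
      \<in> sets (PiM (fin_subsets {..<1 :: nat}) (\<lambda>_. unit_lebesgue))"
    by (rule sets_Collect_single) (auto simp: fin_subsets_lessThan_1[unfolded One_nat_def] intro!: borel_unit_lebesgue)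
  then have "half_peon 0 \<in> sets (exch_space {..<1} unit_lebesgue)"
    unfolding half_peon_def exch_space_def by (intro sets_completionI_sets) simp
  then show ?thesis
    unfolding is_theon_def
    using prob_space_unit_lebesgue complete_unit_lebesgue atomless_unit_lebesgue sampled_is_model
    by (simp add: colour_theory_def[THEN arg_cong[of _ _ preds]] colour_theory_def[THEN arg_cong[of _ _ arity]])
qed

lemma half_peon_rank: "peon_rank_le unit_lebesgue 1 1 (half_peon P)"
proof -
  have eq: "{A \<in> fin_subsets {..<1 :: nat}. card A \<le> 1} = {{0}}"
    unfolding fin_subsets_lessThan_1 by auto
  let ?\<H> = "{y \<in> {{0 :: nat}} \<rightarrow>\<^sub>E space unit_lebesgue. y {0} \<ge> 1 / 2}"
  show ?thesis
    unfolding peon_rank_le_def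
  proof (intro exI[of _ ?\<H>] conjI)
    show "?\<H> \<subseteq> {A \<in> fin_subsets {..<1 :: nat}. card A \<le> 1} \<rightarrow>\<^sub>E space unit_lebesgue"
      unfolding eq by (rule Collect_restrict)
    show "half_peon P = {x \<in> space (exch_space {..<1 :: nat} unit_lebesgue).
        restrict x {A \<in> fin_subsets {..<1}. card A \<le> 1} \<in> ?\<H>}"
      unfolding half_peon_def eq by (simp add: restrict_PiE_iff)
  qed
qed

text \<open>The event is a cylinder over the \<open>m\<close> coordinates at singletons, so its
  measure is a product of \<open>m\<close> factors \<open>1 / 2\<close>.\<close>

lemma measure_colour_pattern:
  assumes S: "S \<subseteq> {..<m}"
  defines "E \<equiv> {\<theta> \<in> space (exch_space UNIV unit_lebesgue). \<forall>v<m. \<theta> {v} \<ge> 1 / 2 \<longleftrightarrow> v \<in> S}"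
  shows "E \<in> sets (exch_space UNIV unit_lebesgue)" "measure (exch_space UNIV unit_lebesgue) E = (1 / 2) ^ m"
proof -
  let ?M = "\<lambda>_ :: nat set. unit_lebesgue" and ?I = "fin_subsets (UNIV :: nat set)"
  interpret product_prob_space ?M ?I
    by (rule product_prob_spaceI) (rule prob_space_unit_lebesgue)
  let ?J = "(\<lambda>v. {v}) ` {..<m}"
  define X where "X A = (if the_elem A \<in> S then {x :: real. 1 / 2 \<le> x} else {x. \<not> 1 / 2 \<le> x})" for A :: "nat set"
  have bor: "{x :: real. 1 / 2 \<le> x} \<in> sets borel" "{x :: real. \<not> 1 / 2 \<le> x} \<in> sets borel" by measurable
  then have X: "X A \<in> sets unit_lebesgue" for A by (auto simp: X_def intro: borel_unit_lebesgue)
  have J: "?J \<subseteq> ?I" "finite ?J" by (auto simp: singleton_fin_subsets)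
  have E: "E = emb ?I ?J (Pi\<^sub>E ?J X)"
    unfolding E_def exch_space_def prod_emb_def space_completion space_PiM
  proof -
    have "(\<forall>v<m. \<theta> {v} \<ge> 1 / 2 \<longleftrightarrow> v \<in> S) \<longleftrightarrow> (\<forall>A\<in>?J. \<theta> A \<in> X A)" for \<theta> :: "nat set \<Rightarrow> real"
      by (auto simp: X_def)
    then show "{\<theta> \<in> Pi\<^sub>E ?I (\<lambda>_. space unit_lebesgue). \<forall>v<m. \<theta> {v} \<ge> 1 / 2 \<longleftrightarrow> v \<in> S}
        = (\<lambda>x. restrict x ?J) -` Pi\<^sub>E ?J X \<inter> Pi\<^sub>E ?I (\<lambda>_. space unit_lebesgue)"
      by (simp add: restrict_PiE_iff vimage_def) blast
  qed
  have "emb ?I ?J (Pi\<^sub>E ?J X) \<in> sets (PiM ?I ?M)"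
    using J X by (intro measurable_prod_emb sets_PiM_I_finite) auto
  then have meas: "E \<in> sets (PiM ?I ?M)" by (simp add: E)
  then show "E \<in> sets (exch_space UNIV unit_lebesgue)" unfolding exch_space_def by simp
  have "measure (PiM ?I ?M) E = (\<Prod>A\<in>?J. measure unit_lebesgue (X A))"
    unfolding E using J X by (rule measure_PiM_emb)
  also have "\<dots> = (\<Prod>A\<in>?J. 1 / 2)"
    by (intro prod.cong refl) (simp only: X_def if_distrib[of "measure unit_lebesgue"] prob_half if_cancel)
  also have "\<dots> = (1 / 2) ^ m" by (simp add: card_image)
  finally show "measure (exch_space UNIV unit_lebesgue) E = (1 / 2) ^ m"
    unfolding exch_space_def using meas by simp
qed

text \<open>Colourings are isomorphic iff they agree in size and in the number of red points. The
  event is thus a disjoint union of colour patterns, one for each red set of the right size.\<close>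

lemma theon_limit_half_peon:
  assumes M: "M \<in> fin_models colour_theory"
  shows "theon_limit colour_theory unit_lebesgue half_peon (iso_class colour_theory M)
    = real (card (verts M) choose card (red M)) / 2 ^ card (verts M)"
proof -
  let ?\<Omega> = "exch_space (UNIV :: nat set) unit_lebesgue"
  let ?X = "sampled_struct colour_theory half_peon"
  define m where "m = card (verts M)"
  define r where "r = card (red M)"
  define E where "E S = {\<theta> \<in> space ?\<Omega>. \<forall>v<m. \<theta> {v} \<ge> 1 / 2 \<longleftrightarrow> v \<in> S}" for S
  let ?S = "{S. S \<subseteq> {..<m} \<and> card S = r}"
  have M': "is_model colour_theory M" "finite (verts M)" using M by (auto simp: fin_models_def)
  have iff: "(\<exists>A\<in>iso_class colour_theory M. isomorphic (induced (?X \<theta>) {..<card (verts A)}) A)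
      \<longleftrightarrow> card {v. v < m \<and> \<theta> {v} \<ge> 1 / 2} = r" for \<theta>
  proof -
    have "isomorphic (induced (?X \<theta>) {..<card (verts A)}) A \<longleftrightarrow> isomorphic (induced (?X \<theta>) {..<m}) M"
      if "A \<in> iso_class colour_theory M" for A
    proof -
      have A: "isomorphic M A" using that by (simp add: iso_class_def)
      then have "card (verts A) = m" using isomorphic_card[OF A] by (simp add: m_def)
      then show ?thesis
        using isomorphic_trans[OF _ A, of "induced (?X \<theta>) {..<m}"]
          isomorphic_trans[OF _ isomorphic_sym[OF A], of "induced (?X \<theta>) {..<m}"] by auto
    qed
    moreover have "M \<in> iso_class colour_theory M" using M isomorphic_refl by (simp add: iso_class_def)
    ultimately have "(\<exists>A\<in>iso_class colour_theory M. isomorphic (induced (?X \<theta>) {..<card (verts A)}) A)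
        \<longleftrightarrow> isomorphic (induced (?X \<theta>) {..<m}) M" by blast
    also have "\<dots> \<longleftrightarrow> card (verts (induced (?X \<theta>) {..<m})) = m \<and> card (red (induced (?X \<theta>) {..<m})) = r"
      unfolding m_def r_def
    proof (rule isomorphic_colour_iff[OF _ _ M'])
      show "is_model colour_theory (induced (?X \<theta>) {..<card (verts M)})"
        by (rule is_model_induced[OF canonical_colour_theory(2) sampled_is_model]) (simp add: sampled_struct_def)
    qed simp
    also have "red (induced (?X \<theta>) {..<m}) = {v. v < m \<and> \<theta> {v} \<ge> 1 / 2}"
      by (auto simp: red_induced red_sampled)
    finally show ?thesis by simp
  qed
  have set_eq: "{\<theta> \<in> space ?\<Omega>. \<exists>A\<in>iso_class colour_theory M. isomorphic (induced (?X \<theta>) {..<card (verts A)}) A}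
      = (\<Union>S\<in>?S. E S)"
  proof (intro equalityI subsetI)
    fix \<theta> assume "\<theta> \<in> {\<theta> \<in> space ?\<Omega>. \<exists>A\<in>iso_class colour_theory M. isomorphic (induced (?X \<theta>) {..<card (verts A)}) A}"
    then have "\<theta> \<in> space ?\<Omega>" "card {v. v < m \<and> \<theta> {v} \<ge> 1 / 2} = r" by (simp_all add: iff)
    then show "\<theta> \<in> (\<Union>S\<in>?S. E S)"
      by (intro UN_I[of "{v. v < m \<and> \<theta> {v} \<ge> 1 / 2}"]) (auto simp: E_def)
  next
    fix \<theta> assume "\<theta> \<in> (\<Union>S\<in>?S. E S)"
    then obtain S where S: "S \<subseteq> {..<m}" "card S = r" "\<theta> \<in> E S" by auto
    then have "{v. v < m \<and> \<theta> {v} \<ge> 1 / 2} = S" by (auto simp: E_def)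
    then show "\<theta> \<in> {\<theta> \<in> space ?\<Omega>. \<exists>A\<in>iso_class colour_theory M. isomorphic (induced (?X \<theta>) {..<card (verts A)}) A}"
      using S by (simp add: iff E_def)
  qed
  have disj: "disjoint_family_on E ?S"
    unfolding disjoint_family_on_def
  proof (intro ballI impI)
    fix S S' assume "S \<in> ?S" "S' \<in> ?S" "S \<noteq> S'"
    then obtain v where "v < m" "v \<in> S \<longleftrightarrow> v \<notin> S'" by blast
    then show "E S \<inter> E S' = {}" unfolding E_def by blast
  qed
  have "finite_measure ?\<Omega>"
  proof (rule finite_measureI)
    interpret P: prob_space "PiM (fin_subsets (UNIV :: nat set)) (\<lambda>_. unit_lebesgue)"
      by (rule prob_space_PiM) (rule prob_space_unit_lebesgue)
    show "emeasure ?\<Omega> (space ?\<Omega>) \<noteq> \<infinity>"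
      unfolding exch_space_def space_completion by (simp add: P.emeasure_space_1)
  qed
  then interpret finite_measure ?\<Omega> .
  have "measure ?\<Omega> (\<Union>S\<in>?S. E S) = (\<Sum>S\<in>?S. measure ?\<Omega> (E S))"
  proof (rule finite_measure_finite_Union[OF _ _ disj])
    show "E ` ?S \<subseteq> sets ?\<Omega>"
      unfolding E_def using measure_colour_pattern(1)[of _ m] by blast
  qed simp
  also have "\<dots> = (\<Sum>S\<in>?S. (1 / 2) ^ m)"
    unfolding E_def by (intro sum.cong refl measure_colour_pattern(2)) simp
  also have "\<dots> = real (m choose r) / 2 ^ m"
    by (simp add: n_subsets power_one_over)
  finally have "measure ?\<Omega> (\<Union>S\<in>?S. E S) = real (m choose r) / 2 ^ m" .
  then show ?thesis
    unfolding theon_limit_def using M by (simp add: iso_classes_def set_eq m_def r_def)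
qed

text \<open>The coloured halves and the theon give the same binomial values. The former can be
  combined with \<open>RGseq\<close>, the latter bounds the rank.\<close>

lemma halfcol_converges: "converges_to colour_theory halfcol (theon_limit colour_theory unit_lebesgue half_peon)"
  unfolding converges_to_def
  using density_halfcol_tendsto theon_limit_half_peon
  by (auto simp: halfcol_def colouring_fin_models)

lemma limit_rank_half_peon: "limit_rank colour_theory (theon_limit colour_theory unit_lebesgue half_peon) \<le> 1"
  unfolding limit_rank_def
  by (rule Least_le, intro exI[of _ unit_lebesgue] exI[of _ half_peon] conjI refl ballI half_peon_theon)
    (simp add: colour_theory_def half_peon_rank[unfolded One_nat_def])

section \<open>A coupling with colours that is not independent\<close>

definition combine :: "('p, 'v) rstruct \<Rightarrow> ('q, 'v) rstruct \<Rightarrow> ('p + 'q, 'v) rstruct" where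
  "combine A B = \<lparr>verts = verts A, rels = case_sum (rels A) (rels B)\<rparr>"

lemma combine_simps [simp]:
  "verts (combine A B) = verts A" "reductL (combine A B) = A"
  "verts B = verts A \<Longrightarrow> reductR (combine A B) = B"
  by (simp_all add: combine_def reductL_def reductR_def)

lemma combine_fin_models:
  assumes "A \<in> fin_models T" "B \<in> fin_models T'" "verts B = verts A"
  shows "combine A B \<in> fin_models (disj_union T T')"
  using assms by (simp add: fin_models_def is_model_disj_union)

lemma converges_to_subseq:
  assumes "converges_to T N \<phi>" "strict_mono r"
  shows "converges_to T (\<lambda>n. N (r n)) \<phi>"
  using assms LIMSEQ_subseq_LIMSEQ[OF _ assms(2)] unfolding converges_to_def by (fastforce simp: o_def)

text \<open>In \<open>combine (RGseq d J) (halfcol J)\<close> the red points precede all others, so a set of \<open>d\<close> red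
  points forms an edge either with every point of the other colour or with none. In \<open>witness d\<close>,
  the red set \<open>{1..d}\<close> forms an edge with \<open>0\<close> but not with \<open>d + 1\<close>.\<close>

definition witness :: "nat \<Rightarrow> (unit + nat, nat) rstruct" where
  "witness d = combine (RG (Suc d) {{..<d}} {..<d + 2}) (colouring {..<d + 2} {1..d})"

lemma witness_fin_models: "witness d \<in> fin_models (disj_union (hypergraph_theory (Suc d)) colour_theory)"
  unfolding witness_def by (intro combine_fin_models RG_fin_models colouring_fin_models) auto

lemma witness_not_induced:
  assumes d: "d \<ge> 1" and U: "U \<subseteq> {..<4 ^ J}"
  shows "\<not> isomorphic (induced (combine (RGseq d J) (halfcol J)) U) (witness d)"
proof
  let ?N = "combine (RGseq d J) (halfcol J)" and ?g = "pseudorandom d J"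
  assume "isomorphic (induced ?N U) (witness d)"
  then obtain h where h: "is_iso h (witness d) (induced ?N U)"
    using isomorphic_sym unfolding isomorphic_def by blast
  have rel: "xs \<in> rels (witness d) P \<longleftrightarrow> map h xs \<in> rels (induced ?N U) P" if "set xs \<subseteq> {..<d + 2}" for xs P
    using h that unfolding is_iso_def by (simp add: witness_def)
  have inj: "inj_on h {..<d + 2}" and hU: "h ` {..<d + 2} = U"
    using h by (auto simp: is_iso_def bij_betw_def witness_def)
  have hlt: "h i < 4 ^ J" if "i < d + 2" for i
    using hU U that by auto
  \<comment> \<open>Red points go to the first half of the segment, \<open>0\<close> and
    \<open>d + 1\<close> to the second.\<close>
  have colour: "h i < 4 ^ J div 2 \<longleftrightarrow> i \<in> {1..d}" if "i < d + 2" for i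
  proof -
    have "[i] \<in> rels (witness d) (Inr 0) \<longleftrightarrow> map h [i] \<in> rels (induced ?N U) (Inr 0)"
      by (rule rel) (use that in simp)
    moreover have "h i \<in> U" using hU that by auto
    ultimately show ?thesis
      using that hlt[OF that] by (auto simp: witness_def combine_def colouring_def induced_def halfcol_def)
  qed
  have edge: "xs \<in> rels (witness d) (Inl ()) \<longleftrightarrow> length xs = Suc d \<and> distinct xs \<and>
      set xs \<subseteq> {..<d + 2} \<and> set xs - {Max (set xs)} = {..<d}" for xs
    by (auto simp: witness_def combine_def RG_def)
  have edgeN: "ys \<in> rels (induced ?N U) (Inl ()) \<longleftrightarrow> length ys = Suc d \<and> distinct ys \<and>
      set ys \<subseteq> U \<and> set ys - {Max (set ys)} \<in> ?g" for ys
    using U by (auto simp: combine_def RGseq_def RG_def induced_def)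
  \<comment> \<open>A point \<open>z\<close> that is not red is mapped beyond all images of red
    points, so it is the maximum there. Removing it leaves the image of the red set, whatever
    \<open>z\<close> is.\<close>
  have edge_iff: "xs \<in> rels (witness d) (Inl ()) \<longleftrightarrow> h ` {1..d} \<in> ?g"
    if xs: "set xs = insert z {1..d}" "length xs = Suc d" "distinct xs" and z: "z < d + 2" "z \<notin> {1..d}" for xs z
  proof -
    have sub: "set xs \<subseteq> {..<d + 2}" using xs(1) z by auto
    have lt: "h i < h z" if i: "i \<in> {1..d}" for i
      using colour[of i] colour[of z] i z by auto
    then have Max: "Max (h ` set xs) = h z"
      unfolding xs(1) by (intro Max_eqI) (auto simp: less_imp_le)
    have "h z \<notin> h ` {1..d}" using lt by force
    then have "set (map h xs) - {Max (set (map h xs))} = h ` {1..d}"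
      unfolding set_map Max by (auto simp: xs(1))
    moreover have "distinct (map h xs)"
      using xs(3) inj_on_subset[OF inj sub] by (simp add: distinct_map)
    moreover have "set (map h xs) \<subseteq> U" using sub hU by auto
    ultimately show ?thesis
      unfolding rel[OF sub] edgeN using xs(2) by (simp del: set_map)
  qed
  \<comment> \<open>In the witness the maximum need not be the point that is not red:
    \<open>{0..d}\<close> loses \<open>d\<close> and leaves \<open>{..<d}\<close>, so it is an edge,
    whereas \<open>{1..d + 1}\<close> loses \<open>d + 1\<close> and leaves \<open>{1..d}\<close>,
    which is not in the system.\<close>
  have "Max (set [0..<Suc d]) = d" by (rule Max_eqI) auto
  then have "[0..<Suc d] \<in> rels (witness d) (Inl ())"
    unfolding edge by auto
  then have "h ` {1..d} \<in> ?g"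
    using edge_iff[of "[0..<Suc d]" 0] by fastforce
  then have "[1..<d + 2] \<in> rels (witness d) (Inl ())"
    using edge_iff[of "[1..<d + 2]" "d + 1"] by fastforce
  then have "set [1..<d + 2] - {Max (set [1..<d + 2])} = {..<d}"
    unfolding edge by blast
  moreover have "0 \<in> {..<d}" using d by simp
  ultimately have "0 \<in> set [1..<d + 2]" by blast
  then show False by auto
qed

lemma density_witness_eq_0:
  assumes "d \<ge> 1"
  shows "density (witness d) (combine (RGseq d J) (halfcol J)) = 0"
  unfolding density_def using witness_not_induced[OF assms, of _ J] by auto

theorem not_UCouple_RGseq_limit:
  assumes d: "d \<ge> 2" and \<phi>: "\<phi> \<in> limit_objects (hypergraph_theory (Suc d))"
    "converges_to (hypergraph_theory (Suc d)) (RGseq d) \<phi>"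
  shows "\<not> UCouple 1 (hypergraph_theory (Suc d)) \<phi>"
proof
  let ?T = "hypergraph_theory (Suc d)"
  let ?TC = "disj_union ?T colour_theory"
  define N where "N J = combine (RGseq d J) (halfcol J)" for J
  define \<psi> where "\<psi> = theon_limit colour_theory unit_lebesgue half_peon"
  assume UC: "UCouple 1 ?T \<phi>"
  have uT: "universal_theory ?T" by (simp add: universal_hypergraph_theory)
  note uC = canonical_colour_theory(2)
  have halfcol: "converges_to colour_theory halfcol \<psi>" unfolding \<psi>_def by (rule halfcol_converges)
  have vh: "verts (halfcol J) = verts (RGseq d J)" for J by (simp add: halfcol_def)
  have Nmod: "N J \<in> fin_models ?TC" for J
    unfolding N_def using halfcol vh by (intro combine_fin_models RGseq_fin_models) (auto simp: converges_to_def)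
  \<comment> \<open>The combined sequence need not converge. A convergent subsequence is enough,
    since both reducts keep their limits along it.\<close>
  obtain r \<xi> where r: "strict_mono r" and \<xi>: "converges_to ?TC (N \<circ> r) \<xi>" "\<xi> \<in> extensional (iso_classes ?TC)"
    by (rule convergent_subsequence[OF universal_disj_union[OF uT uC] Nmod])
  have "strict_mono (\<lambda>n. card (verts ((N \<circ> r) n)))"
    using r by (simp add: N_def strict_mono_def power_strict_increasing)
  then have \<xi>_lim: "\<xi> \<in> limit_objects ?TC" using \<xi> by (intro limit_objectsI)
  have \<psi>_ext: "\<psi> \<in> extensional (iso_classes colour_theory)" by (simp add: \<psi>_def theon_limit_def)
  have "strict_mono (\<lambda>J. card (verts (halfcol J)))"
    unfolding vh by (simp add: strict_mono_def power_strict_increasing)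
  then have \<psi>_lim: "\<psi> \<in> limit_objects colour_theory"
    using halfcol \<psi>_ext by (intro limit_objectsI)
  have \<phi>_ext: "\<phi> \<in> extensional (iso_classes ?T)" using \<phi>(1) by (simp add: limit_objects_def PiE_def)
  have "limit_reductL ?T colour_theory \<xi> = \<phi>"
  proof (rule converges_to_unique)
    show "converges_to ?T (\<lambda>n. RGseq d (r n)) (limit_reductL ?T colour_theory \<xi>)"
      using converges_to_reductL[OF uT uC \<xi>(1)] by (simp add: N_def)
    show "converges_to ?T (\<lambda>n. RGseq d (r n)) \<phi>" by (rule converges_to_subseq[OF \<phi>(2) r])
  qed (simp_all add: \<phi>_ext limit_reductL_def)
  moreover have "limit_reductR ?T colour_theory \<xi> = \<psi>"
  proof (rule converges_to_unique)
    show "converges_to colour_theory (\<lambda>n. halfcol (r n)) (limit_reductR ?T colour_theory \<xi>)"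
      using converges_to_reductR[OF uT uC \<xi>(1)] by (simp add: N_def vh)
    show "converges_to colour_theory (\<lambda>n. halfcol (r n)) \<psi>" by (rule converges_to_subseq[OF halfcol r])
  qed (simp_all add: \<psi>_ext limit_reductR_def)
  ultimately have "\<xi> \<in> couplings ?T \<phi> colour_theory \<psi>"
    using \<xi>_lim by (simp add: couplings_def)
  moreover have "uniquely_coupleable ?T \<phi> colour_theory \<psi>"
    using UC canonical_colour_theory(1) \<psi>_lim limit_rank_half_peon unfolding UCouple_def \<psi>_def by blast
  ultimately have indep: "\<xi> = indep_coupling ?T \<phi> colour_theory \<psi>"
    by (simp add: uniquely_coupleable_def)
  let ?W = "iso_class ?TC (witness d)"
  \<comment> \<open>The witness has density zero throughout, but independence would give it a
    positive value.\<close>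
  have "(\<lambda>n. density (witness d) ((N \<circ> r) n)) \<longlonglongrightarrow> \<xi> ?W"
    using \<xi>(1) witness_fin_models unfolding converges_to_def by blast
  moreover have "density (witness d) ((N \<circ> r) n) = 0" for n
    using density_witness_eq_0[of d "r n"] d by (simp add: N_def)
  ultimately have "\<xi> ?W = 0" by (simp add: LIMSEQ_const_iff)
  moreover have "indep_coupling ?T \<phi> colour_theory \<psi> ?W > 0"
  proof (rule indep_coupling_pos[OF witness_fin_models])
    let ?L = "reductL (witness d)"
    have L: "?L = RG (Suc d) {{..<d}} {..<d + 2}" by (simp add: witness_def)
    have "\<phi> (iso_class ?T ?L) = pat_prob d ?L"
      using \<phi>(2) density_RGseq_tendsto[OF d, of ?L] fin_models_reduct(1)[OF witness_fin_models, of d] LIMSEQ_unique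
      unfolding converges_to_def by blast
    moreover have "pat_prob d ?L > 0"
    proof -
      \<comment> \<open>The system of the witness is one of those counted in
        \<open>pat_prob\<close>.\<close>
      have "0 < (of_bool (isomorphic (RG (Suc d) {{..<d}} {..<card (verts ?L)}) ?L) :: real)"
        by (simp add: L isomorphic_refl)
      also have "\<dots> \<le> (\<Sum>P\<in>Pow (dsets (card (verts ?L)) d). of_bool (isomorphic (RG (Suc d) P {..<card (verts ?L)}) ?L))"
        by (rule member_le_sum) (auto simp: L dsets_def)
      finally show ?thesis unfolding pat_prob_def by simp
    qed
    ultimately show "\<phi> (iso_class ?T ?L) > 0" by simp
    have R: "reductR (witness d) = colouring {..<d + 2} {1..d}" by (simp add: witness_def)
    have "card (red (reductR (witness d))) \<le> card (verts (reductR (witness d)))"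
      unfolding R by (intro card_mono) auto
    then show "\<psi> (iso_class colour_theory (reductR (witness d))) > 0"
      unfolding \<psi>_def using theon_limit_half_peon[OF fin_models_reduct(2)[OF witness_fin_models, of d]] by simp
  qed
  ultimately show False using indep by simp
qed

theorem theorem3p9:
  fixes l :: nat
  assumes "odd l" and "l \<ge> 1"
  shows "\<exists>\<phi>\<in>limit_objects (hypergraph_theory (l + 2)).
    UInduce l (hypergraph_theory (l + 2)) \<phi> \<and> \<not> UCouple 1 (hypergraph_theory (l + 2)) \<phi>"
proof -
  have d: "l + 1 \<ge> 2" "l < l + 1" and k: "l + 2 = Suc (l + 1)" using assms(2) by auto
  obtain \<phi> where \<phi>: "\<phi> \<in> limit_objects (hypergraph_theory (Suc (l + 1)))"
    "converges_to (hypergraph_theory (Suc (l + 1))) (RGseq (l + 1)) \<phi>"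
    using exists_RGseq_limit[OF d(1)] by blast
  show ?thesis
    unfolding k using UInduce_RGseq_limit[OF d(1) assms(2) d(2) \<phi>] not_UCouple_RGseq_limit[OF d(1) \<phi>] \<phi>(1) by blast
qed

end
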